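(* For every $\delta\in(0,1)$ there is a constant $C_\delta>0$, depending only on $\delta$, such that the following holds. Let $n\ge 2$ be an integer with $n\ge 4(1-\delta)/\delta^2$, let $q$ be a prime power with $q\ge 1/(1-\delta)^2$, let $1\le k\le n$ be an integer, and put $r=\frac{k-1}{\log n}$. If $r\le q(1-\delta)$, then $$\left|\mathbb{P}(\Omega(f_n)=k)-\mathbb{P}(K(\pi_n)=k)\,h_q(r)\right|\le C_\delta\,(r+1)^{C_\delta r}\,\mathbb{P}(X=k-1)\,\frac{k}{q(\log n)^2},$$ where $X$ is a Poisson random variable with mean $\log n$.
   Context: For a prime power $q$, $\mathbb{F}_q$ is the field with $q$ elements, $f_n=f_{n,q}$ is a uniformly random monic polynomial of degree $n$ in $\mathbb{F}_q[T]$, and $\Omega(f)$ is the number of monic irreducible factors of $f$ counted with multiplicity. $\pi_n$ is a uniformly random permutation in the symmetric group $S_n$, and $K(\pi)$ is the number of cycles of $\pi$ (fixed points included). Let $\mathcal{P}=\mathcal{P}_q$ be the set of monic irreducible polynomials over $\mathbb{F}_q$ and $|P|=q^{\deg P}$. For real $0\le x<q$ define $$h_q(x)=\prod_{P\in\mathcal{P}}\left(1-\frac{x}{|P|}\right)^{-1}\left(1-\frac{1}{|P|}\right)^{x}.$$ *)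

theory Defs
  imports
    "HOL-Probability.Probability"
    "HOL-Combinatorics.Orbits"
    "HOL-Number_Theory.Prime_Powers"
    "HOL-Algebra.Polynomial_Divisibility"
begin

text \<open>
  The constant of the theorem must not depend on \<open>q\<close>, so the finite field has to be quantified
  inside the formula and cannot be a type of class \<^class>\<open>field\<close>. It is therefore a structure
  \<open>F\<close> of \<open>HOL-Algebra\<close>, with carrier a set of natural numbers in the theorem (every finite
  field has an isomorphic copy of this form). Polynomials are lists of coefficients, leading coefficient first;
  the zero polynomial is the empty list, whose \<^term>\<open>hd\<close> is unspecified and which is
  hence excluded explicitly from the monic polynomials.
\<close>

definition monic_polys :: "('a, 'b) ring_scheme \<Rightarrow> 'a list set" where
  "monic_polys F =
     {f \<in> carrier (poly_ring F). f \<noteq> [] \<and> Polynomials.lead_coeff f = \<one>\<^bsub>F\<^esub>}"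

definition monic_polys_deg :: "('a, 'b) ring_scheme \<Rightarrow> nat \<Rightarrow> 'a list set" where
  "monic_polys_deg F n = {f \<in> monic_polys F. Polynomials.degree f = n}"

definition monic_irreds :: "('a, 'b) ring_scheme \<Rightarrow> 'a list set" where
  "monic_irreds F = {P \<in> monic_polys F. pirreducible\<^bsub>F\<^esub> (carrier F) P}"

definition poly_multiplicity ::
    "('a, 'b) ring_scheme \<Rightarrow> 'a list \<Rightarrow> 'a list \<Rightarrow> nat" where
  "poly_multiplicity F P f = (GREATEST m. (P [^]\<^bsub>poly_ring F\<^esub> m) pdivides\<^bsub>F\<^esub> f)"

definition Omega :: "('a, 'b) ring_scheme \<Rightarrow> 'a list \<Rightarrow> nat" where
  "Omega F f = (\<Sum>P \<in> {P \<in> monic_irreds F. P pdivides\<^bsub>F\<^esub> f}. poly_multiplicity F P f)"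

definition poly_norm :: "('a, 'b) ring_scheme \<Rightarrow> 'a list \<Rightarrow> real" where
  "poly_norm F P = real (card (carrier F)) ^ Polynomials.degree P"

text \<open>
  The product over all monic irreducibles is unordered (the multiplicative analogue of
  \<^const>\<open>infsum\<close>); for \<open>0 \<le> x < q\<close> its factors are \<open>1 + O(1 / \<bar>P\<bar>\<^sup>2)\<close>, so that it
  converges absolutely.
\<close>

definition h_q :: "('a, 'b) ring_scheme \<Rightarrow> real \<Rightarrow> real" where
  "h_q F x = Lim (finite_subsets_at_top (monic_irreds F))
     (\<lambda>S. \<Prod>P\<in>S. inverse (1 - x / poly_norm F P) * (1 - 1 / poly_norm F P) powr x)"

text \<open>The cycles of a permutation of \<open>A\<close>, fixed points included, are its orbits on \<open>A\<close>.\<close>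

definition num_cycles :: "'a set \<Rightarrow> ('a \<Rightarrow> 'a) \<Rightarrow> nat" where
  "num_cycles A \<pi> = card (orbit \<pi> ` A)"

end

theory Submission
  imports Defs "HOL-Combinatorics.Stirling"
begin

text \<open>
  Write \<open>p(n, k)\<close> for the probability that a random permutation of \<open>n\<close> points has \<open>k\<close> cycles and
  \<open>L = log n\<close>. The generating function of \<open>P(\<Omega>(f\<^sub>n) = k)\<close> is \<open>(1 - u)\<close> to the power \<open>-z\<close> times
  \<open>H(u, z) = exp (\<Sum>\<^sub>P \<Sum>\<^sub>j\<^sub>\<ge>\<^sub>2 (z\<^sup>j - z) (u/q)\<^bsup>j deg P\<^esup> / j) = \<Sum> a\<^sub>m\<^sub>i u\<^sup>m z\<^sup>i\<close>, and \<open>H(1, r) = h\<^sub>q(r)\<close>. Hence the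
  error term of the theorem is \<open>\<Sum> a\<^sub>m\<^sub>i (p(n - m, k - i) - r\<^sup>i p(n, k))\<close>.

  The coefficients are controlled by \<open>\<Sum>\<^sub>m\<^sub>\<ge>\<^sub>1 \<bar>a\<^sub>m\<^sub>i\<bar> u\<^sup>m \<rho>\<^sup>i \<le> B exp B\<close> with \<open>B\<close> of order \<open>(\<rho>\<^sup>2 + \<rho>) / q\<close>, where
  \<open>\<rho> = r + \<delta>\<close> and \<open>u = 1 + \<delta>/4\<close>, so that \<open>\<rho> u\<close> stays below \<open>q\<close> by a constant factor. It remains to bound the
  differences by \<open>\<rho>\<^sup>i u\<^sup>m P(X = k - 1) k / L\<^sup>2\<close>. Changing \<open>n - m\<close> into \<open>n\<close> costs only \<open>O(m\<^sup>2 / n)\<close>. For the change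
  of \<open>k\<close>, write \<open>n p(n, k)\<close> as the coefficient of \<open>z\<^bsup>k-1\<^esup>\<close> in \<open>exp (L z) W(z)\<close>, where \<open>W\<close> is a truncated Weierstrass
  product for \<open>1 / \<Gamma>(1 + z)\<close>. A factor \<open>z\<^sup>i\<close> multiplies the coefficient of \<open>z\<^bsup>k-1\<^esup>\<close> in \<open>exp (L z)\<close> by
  \<open>(k-1)(k-2)\<cdots>(k-i) / L\<^sup>i\<close>, and for \<open>r = (k-1) / L\<close> this agrees with \<open>r\<^sup>i\<close> up to a relative error that is quadratic
  in \<open>i\<close>: the first-order terms cancel.
\<close>

subsection \<open>Truncated weighted norms of power series\<close>

text \<open>The margins in \<open>\<rho>\<close> and \<open>u\<close> absorb polynomial losses.
  Shifting the number of cycles by \<open>i\<close> loses a factor of order \<open>i^2\<close>,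
  shifting \<open>n\<close> by \<open>m\<close> loses \<open>m^2\<close>. As
  \<open>(r + \<delta>)^i\<close> dominates \<open>(i choose 2) r^(i-2) \<delta>^2\<close> and
  \<open>u^m\<close> dominates a multiple of \<open>m^2\<close>, both losses become geometric
  weights, the very weights at which the coefficients of \<open>H\<close> are measured. The saving
  of \<open>1/q\<close> comes from the absent term \<open>m = 0\<close>: there the only coefficient
  is \<open>1\<close> and the difference vanishes, so the exponential of \<open>log H\<close>
  contributes only from its linear term on, which has size \<open>B\<close>. Norms are cut off at
  \<open>J\<close> and \<open>M\<close>, with bounds uniform in both. Convergence of
  \<open>H\<close> matters only where \<open>M\<close> tends to infinity and the partial sums of
  \<open>H(1, r)\<close> become the Euler product. The factorization of the generating function
  rests on a differential equation in \<open>u\<close>: the logarithmic derivative can be read off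
  by counting degrees, and this also yields the prime polynomial theorem, which splits off
  \<open>(1 - u)^(-z)\<close>.\<close>

locale ring_seminorm =
  fixes \<nu> :: "'a::comm_ring_1 \<Rightarrow> real"
  assumes nonneg: "\<nu> x \<ge> 0"
    and zero: "\<nu> 0 = 0"
    and one: "\<nu> 1 \<le> 1"
    and add: "\<nu> (x + y) \<le> \<nu> x + \<nu> y"
    and mult: "\<nu> (x * y) \<le> \<nu> x * \<nu> y"
begin

lemma sum_le: "\<nu> (\<Sum>i\<in>A. f i) \<le> (\<Sum>i\<in>A. \<nu> (f i))"
proof (induction A rule: infinite_finite_induct)
  case (insert x F)
  then show ?case using add[of "f x" "sum f F"] by simp
qed (simp_all add: zero)

lemma prod_le: "\<nu> (\<Prod>i\<in>A. f i) \<le> (\<Prod>i\<in>A. \<nu> (f i))"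
proof (induction A rule: infinite_finite_induct)
  case (insert x F)
  have "\<nu> (f x * prod f F) \<le> \<nu> (f x) * \<nu> (prod f F)" by (rule mult)
  also have "\<dots> \<le> \<nu> (f x) * (\<Prod>i\<in>F. \<nu> (f i))"
    by (intro mult_left_mono insert.IH nonneg)
  finally show ?case using insert by simp
qed (simp_all add: one)

lemma power_le: "\<nu> (x ^ n) \<le> \<nu> x ^ n"
  using prod_le[of "\<lambda>_. x" "{..<n}"] by simp

end

interpretation abs_seminorm: ring_seminorm "abs :: real \<Rightarrow> real"
  by standard (simp_all add: abs_mult)

definition trunc_norm :: "('a::comm_ring_1 \<Rightarrow> real) \<Rightarrow> real \<Rightarrow> nat \<Rightarrow> 'a fps \<Rightarrow> real" where
  "trunc_norm \<nu> \<rho> J f = (\<Sum>j\<le>J. \<nu> (fps_nth f j) * \<rho> ^ j)"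

text \<open>Cutting off at \<open>J\<close> preserves submultiplicativity because the triangle
  \<open>i + j \<le> J\<close> lies in the square of pairs up to \<open>J\<close>. As the result is
  again a seminorm, the construction can be iterated: once in \<open>z\<close> with weight
  \<open>\<rho>\<close>, then in the outer variable with weight \<open>u\<close>.\<close>

lemma (in ring_seminorm) trunc_norm_seminorm:
  assumes "\<rho> \<ge> 0"
  shows "ring_seminorm (trunc_norm \<nu> \<rho> J)"
proof
  fix f g :: "'a fps"
  show "trunc_norm \<nu> \<rho> J f \<ge> 0"
    unfolding trunc_norm_def using assms nonneg by (intro sum_nonneg mult_nonneg_nonneg) auto
  show "trunc_norm \<nu> \<rho> J 0 = 0"
    by (simp add: trunc_norm_def zero)
  have "(\<Sum>j\<le>J. \<nu> (fps_nth 1 j) * \<rho> ^ j) = (\<Sum>j\<le>J. if j = 0 then \<nu> 1 else 0)"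
    by (intro sum.cong) (auto simp: zero)
  also have "\<dots> \<le> 1" using one by simp
  finally show "trunc_norm \<nu> \<rho> J 1 \<le> 1" by (simp add: trunc_norm_def)
  show "trunc_norm \<nu> \<rho> J (f + g) \<le> trunc_norm \<nu> \<rho> J f + trunc_norm \<nu> \<rho> J g"
    unfolding trunc_norm_def sum.distrib[symmetric]
    using assms add by (intro sum_mono) (simp add: mult_right_mono flip: distrib_right)
  have "trunc_norm \<nu> \<rho> J (f * g) \<le>
          (\<Sum>j\<le>J. \<Sum>i\<le>j. (\<nu> (fps_nth f i) * \<rho> ^ i) * (\<nu> (fps_nth g (j - i)) * \<rho> ^ (j - i)))"
    unfolding trunc_norm_def
  proof (intro sum_mono)
    fix j
    have "\<nu> (fps_nth (f * g) j) \<le> (\<Sum>i\<le>j. \<nu> (fps_nth f i) * \<nu> (fps_nth g (j - i)))"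
      unfolding fps_mult_nth atLeast0AtMost
      by (rule order_trans[OF sum_le sum_mono]) (rule mult)
    hence "\<nu> (fps_nth (f * g) j) * \<rho> ^ j
        \<le> (\<Sum>i\<le>j. \<nu> (fps_nth f i) * \<nu> (fps_nth g (j - i))) * \<rho> ^ j"
      using assms by (intro mult_right_mono) auto
    also have "\<dots> = (\<Sum>i\<le>j. (\<nu> (fps_nth f i) * \<rho> ^ i) * (\<nu> (fps_nth g (j - i)) * \<rho> ^ (j - i)))"
      unfolding sum_distrib_right
    proof (intro sum.cong refl)
      fix i assume "i \<in> {..j}"
      hence "\<rho> ^ j = \<rho> ^ i * \<rho> ^ (j - i)" by (simp flip: power_add)
      thus "\<nu> (fps_nth f i) * \<nu> (fps_nth g (j - i)) * \<rho> ^ j =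
          \<nu> (fps_nth f i) * \<rho> ^ i * (\<nu> (fps_nth g (j - i)) * \<rho> ^ (j - i))" by simp
    qed
    finally show "\<nu> (fps_nth (f * g) j) * \<rho> ^ j \<le>
      (\<Sum>i\<le>j. (\<nu> (fps_nth f i) * \<rho> ^ i) * (\<nu> (fps_nth g (j - i)) * \<rho> ^ (j - i)))" .
  qed
  also have "\<dots> = (\<Sum>(i,j)\<in>{(i,j). i + j \<le> J}. (\<nu> (fps_nth f i) * \<rho> ^ i) * (\<nu> (fps_nth g j) * \<rho> ^ j))"
    by (rule sum.triangle_reindex_eq[symmetric])
  also have "\<dots> \<le> (\<Sum>(i,j)\<in>{..J} \<times> {..J}. (\<nu> (fps_nth f i) * \<rho> ^ i) * (\<nu> (fps_nth g j) * \<rho> ^ j))"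
    using assms nonneg by (intro sum_mono2) (auto intro!: mult_nonneg_nonneg)
  also have "\<dots> = trunc_norm \<nu> \<rho> J f * trunc_norm \<nu> \<rho> J g"
    unfolding trunc_norm_def sum_product by (simp add: sum.cartesian_product)
  finally show "trunc_norm \<nu> \<rho> J (f * g) \<le> trunc_norm \<nu> \<rho> J f * trunc_norm \<nu> \<rho> J g" .
qed

section \<open>Norms of exponentials and of Weierstrass factors\<close>

lemma exp_partial_sum_le:
  fixes x :: real
  assumes "x \<ge> 0"
  shows "(\<Sum>j\<le>J. x ^ j / fact j) \<le> exp x"
proof -
  have "(\<lambda>j. x ^ j /\<^sub>R fact j) sums exp x" by (rule exp_converges)
  hence "(\<lambda>j. x ^ j / fact j) sums exp x" by (simp add: field_simps)
  thus ?thesis using assms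
    by (intro order_trans[OF sum_le_suminf[of "\<lambda>j. x ^ j / fact j" "{..J}"]]) (auto simp: sums_iff)
qed

lemma trunc_norm_exp_le:
  assumes "\<rho> \<ge> 0"
  shows "trunc_norm abs \<rho> J (fps_exp c) \<le> exp (\<bar>c\<bar> * \<rho>)"
proof -
  have "trunc_norm abs \<rho> J (fps_exp c) = (\<Sum>j\<le>J. (\<bar>c\<bar> * \<rho>) ^ j / fact j)"
    unfolding trunc_norm_def by (intro sum.cong) (auto simp: power_abs power_mult_distrib abs_mult)
  also have "\<dots> \<le> exp (\<bar>c\<bar> * \<rho>)" using assms by (intro exp_partial_sum_le) auto
  finally show ?thesis .
qed

text \<open>The genus-one primary factor for a zero at \<open>-1/c\<close>; the exponential cancels
  the linear coefficient. With \<open>c = 1/j\<close> these are the factors of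
  \<open>1 / \<Gamma>(1 + z)\<close>.\<close>

definition canonical_factor :: "real \<Rightarrow> real fps" where
  "canonical_factor c = (1 + fps_const c * fps_X) * fps_exp (-c)"

lemma canonical_factor_norm_linear:
  assumes "\<rho> \<ge> 0" "c \<ge> 0"
  shows "trunc_norm abs \<rho> J (canonical_factor c) \<le> exp (2 * (c * \<rho>))"
proof -
  interpret tn: ring_seminorm "trunc_norm (abs :: real \<Rightarrow> real) \<rho> J"
    by (rule abs_seminorm.trunc_norm_seminorm) fact
  have "trunc_norm abs \<rho> J (1 + fps_const c * fps_X) = (\<Sum>j\<le>J. (if j = 0 then 1 else 0) + (if j = 1 then c * \<rho> else 0))"
    unfolding trunc_norm_def using assms by (intro sum.cong) (auto simp: fps_X_def)
  also have "\<dots> \<le> 1 + c * \<rho>" using assms by (auto simp: sum.distrib)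
  also have "\<dots> \<le> exp (c * \<rho>)" by (rule exp_ge_add_one_self)
  finally have 1: "trunc_norm abs \<rho> J (1 + fps_const c * fps_X) \<le> exp (c * \<rho>)" .
  have 2: "trunc_norm abs \<rho> J (fps_exp (-c)) \<le> exp (c * \<rho>)"
    using trunc_norm_exp_le[OF assms(1), of J "-c"] assms by simp
  have "trunc_norm abs \<rho> J (canonical_factor c) \<le> exp (c * \<rho>) * exp (c * \<rho>)"
    unfolding canonical_factor_def
    by (rule order_trans[OF tn.mult mult_mono[OF 1 2]]) (simp_all add: tn.nonneg)
  also have "\<dots> = exp (2 * (c * \<rho>))" by (simp only: mult_2 exp_add)
  finally show ?thesis .
qed

text \<open>The coefficient of \<open>z^j\<close> is \<open>(-c)^j (1 - j) / j!\<close>, which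
  vanishes for \<open>j = 1\<close>. For \<open>j \<ge> 2\<close> it is at most
  \<open>c^j / (j - 2)!\<close> in absolute value, so \<open>x^2 exp x\<close> bounds the tail, and
  \<open>exp x \<le> 3\<close> for \<open>x \<le> 1\<close> gives the constant.\<close>

lemma canonical_factor_norm_quadratic:
  assumes "\<rho> \<ge> 0" "c \<ge> 0" "c * \<rho> \<le> 1"
  shows "trunc_norm abs \<rho> J (canonical_factor c) \<le> exp (3 * (c * \<rho>)\<^sup>2)"
proof -
  define x where "x = c * \<rho>"
  have x: "0 \<le> x" "x \<le> 1" using assms by (auto simp: x_def)
  have nth: "\<bar>fps_nth (canonical_factor c) j\<bar> * \<rho> ^ j \<le>
      (if j = 0 then 1 else 0) + (if j \<ge> 2 then x\<^sup>2 * (x ^ (j - 2) / fact (j - 2)) else 0)" for j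
  proof (cases j)
    case 0
    thus ?thesis by (simp add: canonical_factor_def)
  next
    case (Suc i)
    have "fps_nth (canonical_factor c) j = (-c) ^ j / fact j + c * ((-c) ^ i / fact i)"
      by (simp add: canonical_factor_def Suc distrib_right mult.assoc)
    also have "\<dots> = (-c) ^ j / fact j * (1 - real j)"
    proof -
      have "c * ((-c) ^ i / fact i) = - ((-c) ^ j / fact i)" by (simp add: Suc)
      also have "(-c) ^ j / fact i = real j * ((-c) ^ j / fact j)"
        by (simp add: Suc del: of_nat_Suc power_Suc)
      finally show ?thesis by (simp only: right_diff_distrib) simp
    qed
    finally have "\<bar>fps_nth (canonical_factor c) j\<bar> = c ^ j * real (j - 1) / fact j"
      using assms Suc by (simp add: abs_mult power_abs)
    hence *: "\<bar>fps_nth (canonical_factor c) j\<bar> * \<rho> ^ j = x ^ j * (real (j - 1) / fact j)"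
      by (simp add: x_def power_mult_distrib)
    show ?thesis
    proof (cases "j \<ge> 2")
      case True
      then obtain m where m: "j = Suc (Suc m)"
        using le_Suc_ex[OF True] by auto
      have "real (j - 1) / fact j = 1 / (real (Suc (Suc m)) * fact m)"
        by (simp add: m field_simps del: of_nat_Suc)
      also have "\<dots> \<le> 1 / fact m"
        by (intro divide_left_mono) (auto intro!: mult_pos_pos)
      finally have "x ^ j * (real (j - 1) / fact j) \<le> x ^ j * (1 / fact m)"
        using x by (intro mult_left_mono) auto
      also have "\<dots> = x\<^sup>2 * (x ^ (j - 2) / fact (j - 2))"
        by (simp add: m power2_eq_square)
      finally show ?thesis using True * by simp
    next
      case False
      hence "j = 1" using Suc by simp
      thus ?thesis using * by auto
    qed
  qed
  have "trunc_norm abs \<rho> J (canonical_factor c) \<le>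
      (\<Sum>j\<le>J. (if j = 0 then 1 else 0) + (if j \<ge> 2 then x\<^sup>2 * (x ^ (j - 2) / fact (j - 2)) else 0))"
    unfolding trunc_norm_def by (intro sum_mono nth)
  also have "\<dots> = 1 + (\<Sum>j\<le>J. if j \<ge> 2 then x\<^sup>2 * (x ^ (j - 2) / fact (j - 2)) else 0)"
    by (simp add: sum.distrib)
  also have "(\<Sum>j\<le>J. if j \<ge> 2 then x\<^sup>2 * (x ^ (j - 2) / fact (j - 2)) else 0)
      = (\<Sum>j\<in>{2..J}. x\<^sup>2 * (x ^ (j - 2) / fact (j - 2)))"
    by (intro sum.mono_neutral_cong_right) auto
  also have "\<dots> \<le> (\<Sum>j\<in>{2..J+2}. x\<^sup>2 * (x ^ (j - 2) / fact (j - 2)))"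
    using x by (intro sum_mono2) auto
  also have "\<dots> = (\<Sum>j\<in>{0..J}. x\<^sup>2 * (x ^ j / fact j))"
    by (rule sum.reindex_bij_witness[of _ "\<lambda>j. j + 2" "\<lambda>j. j - 2"]) auto
  also have "\<dots> = x\<^sup>2 * (\<Sum>j\<le>J. x ^ j / fact j)"
    by (simp add: sum_distrib_left atLeast0AtMost)
  also have "\<dots> \<le> x\<^sup>2 * exp x"
    using x by (intro mult_left_mono exp_partial_sum_le) auto
  also have "\<dots> \<le> x\<^sup>2 * 3"
    using x order_trans[OF _ exp_le, of "exp x"] by (intro mult_left_mono) auto
  also have "1 + x\<^sup>2 * 3 \<le> exp (x\<^sup>2 * 3)" by (rule exp_ge_add_one_self)
  finally show ?thesis by (simp add: x_def mult.commute)
qed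

subsection \<open>Cycle probabilities\<close>

text \<open>The cycle generating function \<open>z (z + 1) ... (z + n - 1) / n!\<close> without its
  factor \<open>z / n\<close>. Splitting this off makes the constant coefficient \<open>1\<close>
  and explains the shift from \<open>k\<close> to \<open>l = k - 1\<close>.\<close>

definition cycle_fps :: "nat \<Rightarrow> real fps" where
  "cycle_fps n = (\<Prod>j\<in>{1..<n}. 1 + fps_const (1 / real j) * fps_X)"

lemma cycle_fps_Suc: "n \<ge> 1 \<Longrightarrow> cycle_fps (Suc n) = cycle_fps n * (1 + fps_const (1 / real n) * fps_X)"
  by (simp add: cycle_fps_def)

lemma cycle_fps_1: "cycle_fps (Suc 0) = 1"
  by (simp add: cycle_fps_def)

lemma cycle_fps_nth_0: "fps_nth (cycle_fps n) (0) = 1"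
proof -
  have "fps_nth (\<Prod>j\<in>A. 1 + fps_const (1 / real j) * fps_X) 0 = 1" for A
    by (induction A rule: infinite_finite_induct) auto
  thus ?thesis by (simp add: cycle_fps_def)
qed

lemma cycle_fps_Suc_nth:
  assumes "n \<ge> 1"
  shows "fps_nth (cycle_fps (Suc n)) (Suc l) = fps_nth (cycle_fps n) (Suc l) + fps_nth (cycle_fps n) (l) / real n"
proof -
  have "cycle_fps (Suc n) = cycle_fps n + fps_const (1 / real n) * (fps_X * cycle_fps n)"
    using assms by (simp add: cycle_fps_Suc algebra_simps)
  thus ?thesis by simp
qed

lemma cycle_fps_nth_nonneg: "fps_nth (cycle_fps n) (l) \<ge> 0"
proof (cases "n = 0")
  case True thus ?thesis by (auto simp: cycle_fps_def)
next
  case False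
  hence "n \<ge> Suc 0" by simp
  thus ?thesis
  proof (induction n arbitrary: l rule: dec_induct)
    case base thus ?case by (auto simp: cycle_fps_1)
  next
    case (step m)
    thus ?case by (cases l) (auto simp: cycle_fps_nth_0 cycle_fps_Suc_nth)
  qed
qed

text \<open>The coefficient is an elementary symmetric function of
  \<open>1, 1/2, ..., 1/(n-1)\<close>, and the \<open>l\<close>-th power of the harmonic sum
  contains each product of \<open>l\<close> distinct terms \<open>l!\<close> times. The induction
  step keeps the first two terms of a binomial expansion.\<close>

lemma cycle_fps_nth_le_harm:
  assumes "n \<ge> 1"
  shows "fps_nth (cycle_fps n) (l) \<le> harm (n - 1) ^ l / fact l"
  using assms
proof (induction n arbitrary: l rule: dec_induct)
  case base thus ?case by (auto simp: cycle_fps_1 harm_def)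
next
  case (step m)
  define H where "H = (harm (m - 1) :: real)"
  have H: "H \<ge> 0" by (simp add: H_def harm_nonneg)
  have Hm: "harm m = H + 1 / real m"
    using step by (cases m) (auto simp: H_def harm_Suc field_simps)
  show ?case
  proof (cases l)
    case 0 thus ?thesis by (simp add: cycle_fps_nth_0)
  next
    case (Suc i)
    have "fps_nth (cycle_fps (Suc m)) (l) \<le> H ^ l / fact l + H ^ i / fact i / real m"
      unfolding Suc cycle_fps_Suc_nth[OF step.hyps(1)] H_def
      by (intro add_mono divide_right_mono step.IH) auto
    also have "\<dots> = (H ^ l + real l * H ^ i * (1 / real m)) / fact l"
    proof -
      have "H ^ i / fact i = real l * H ^ i / fact l" by (simp add: Suc del: of_nat_Suc)
      thus ?thesis by (simp add: add_divide_distrib)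
    qed
    also have "H ^ l + real l * H ^ i * (1 / real m) \<le> (H + 1 / real m) ^ l"
    proof -
      define x where "x = 1 / real m"
      have x: "x \<ge> 0" by (simp add: x_def)
      have "H ^ l + real l * H ^ i * x \<le> (H + x) ^ l" unfolding Suc
      proof (induction i)
        case (Suc i)
        have "H ^ Suc (Suc i) + real (Suc (Suc i)) * H ^ Suc i * x \<le>
              (H ^ Suc i + real (Suc i) * H ^ i * x) * (H + x)"
          using H x by (simp add: algebra_simps)
        also have "\<dots> \<le> (H + x) ^ Suc i * (H + x)"
          using H x Suc by (intro mult_right_mono) auto
        finally show ?case by (simp add: mult_ac)
      qed simp
      thus ?thesis by (simp add: x_def)
    qed
    finally show ?thesis by (simp add: Hm divide_right_mono)
  qed
qed

lemma harm_pred_bounds: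
  assumes "n \<ge> 1"
  shows "ln (real n) \<le> harm (n - 1)" "harm (n - 1) \<le> 1 + ln (real n)"
proof -
  show "ln (real n) \<le> harm (n - 1)" using ln_le_harm[of "n - 1"] assms by simp
  have "harm (n - 1) \<le> (harm n :: real)" using assms by (cases n) (auto simp: harm_Suc)
  also have "harm n - ln (real n) \<le> harm 1 - ln (real 1)"
    using assms by (intro euler_mascheroni_sequence_decreasing) simp_all
  finally show "harm (n - 1) \<le> 1 + ln (real n)" by (simp add: harm_expand)
qed

section \<open>Falling factorials compared with powers\<close>

lemma one_le_power_div_fact_real:
  "(real l) ^ l / fact l \<ge> 1"
proof -
  have "fact l \<le> (of_nat l :: real) ^ l"
    by (metis fact_le_power le_refl of_nat_fact of_nat_le_iff of_nat_power)
  thus ?thesis by simp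
qed

text \<open>The product of real differences contains a factor zero as soon as \<open>i > l\<close>,
  so sums over shifted indices can run over a fixed range.\<close>

definition ffall :: "nat \<Rightarrow> nat \<Rightarrow> real" where
  "ffall l i = (\<Prod>j<i. real l - real j)"

lemma ffall_Suc: "ffall l (Suc i) = ffall l i * (real l - real i)"
  by (simp add: ffall_def)

lemma ffall_eq_0: "i > l \<Longrightarrow> ffall l i = 0"
  by (auto simp: ffall_def)

lemma ffall_le_power: "ffall l i \<le> real l ^ i"
proof (cases "i \<le> l")
  case True
  hence "ffall l i \<le> (\<Prod>j<i. real l)" unfolding ffall_def by (intro prod_mono) auto
  thus ?thesis by simp
qed (simp add: ffall_eq_0)

text \<open>The factors fall short of \<open>l\<close> by \<open>0, 1, ..., i - 1\<close>, and these
  deficits add up to \<open>i choose 2\<close>.\<close>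

lemma power_minus_ffall_le:
  "real l ^ i - ffall l i \<le> real (i choose 2) * real l ^ (i - 1)"
proof (induction i)
  case 0 thus ?case by (simp add: ffall_def)
next
  case (Suc i)
  have "real l ^ Suc i - ffall l (Suc i) = real l * (real l ^ i - ffall l i) + real i * ffall l i"
    by (simp add: ffall_Suc algebra_simps)
  also have "\<dots> \<le> real l * (real (i choose 2) * real l ^ (i - 1)) + real i * real l ^ i"
    by (intro add_mono mult_left_mono Suc ffall_le_power) auto
  also have "\<dots> = real (Suc i choose 2) * real l ^ i"
    by (cases i) (auto simp: numeral_2_eq_2 algebra_simps)
  finally show ?case by simp
qed

lemma ffall_fact: "i \<le> l \<Longrightarrow> ffall l i * fact (l - i) = fact l"
proof (induction i)
  case (Suc i)
  hence "fact (l - i) = (real l - real i) * fact (l - Suc i)"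
    by (subst fact_reduce) (auto simp: of_nat_diff)
  thus ?case using Suc by (simp add: ffall_Suc mult_ac)
qed (simp add: ffall_def)

text \<open>A single term of the expansion of \<open>(r + \<eta>)^i\<close>. It trades a quadratic
  factor for a slightly larger base, at the price of \<open>1 / \<eta>^2\<close>.\<close>

lemma binomial_term_le:
  fixes r \<eta> :: real
  assumes "r \<ge> 0" "\<eta> \<ge> 0" "i \<ge> 2"
  shows "real (i choose 2) * r ^ (i - 2) * \<eta>\<^sup>2 \<le> (r + \<eta>) ^ i"
proof -
  have "real (i choose 2) * \<eta> ^ 2 * r ^ (i - 2) \<le> (\<Sum>k\<le>i. real (i choose k) * \<eta> ^ k * r ^ (i - k))"
    using assms by (intro member_le_sum[of 2 "{..i}" "\<lambda>k. real (i choose k) * \<eta> ^ k * r ^ (i - k)"]) auto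
  also have "\<dots> = (\<eta> + r) ^ i" by (rule binomial_ring[symmetric])
  finally show ?thesis by (simp add: add.commute mult_ac)
qed

context
  fixes L r \<eta> :: real and l :: nat
  assumes L: "L > 0" and r: "r = real l / L" and \<eta>: "\<eta> > 0"
begin

lemma r_nonneg: "r \<ge> 0" using L by (simp add: r)

lemma ffall_div_le: "ffall l i / L ^ i \<le> r ^ i"
  using L ffall_le_power[of l i] by (simp add: r power_divide divide_right_mono)

text \<open>The choice \<open>r = l / L\<close> makes the left-hand side vanish for \<open>i \<le> 1\<close>.\<close>

lemma ffall_approx:
  "\<bar>ffall l i / L ^ i - r ^ i\<bar> \<le> real l / L\<^sup>2 / \<eta>\<^sup>2 * (r + \<eta>) ^ i"
proof (cases "i \<ge> 2")
  case False
  hence "i = 0 \<or> i = 1" by auto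
  hence "ffall l i / L ^ i - r ^ i = 0" by (auto simp: ffall_def r)
  thus ?thesis using L \<eta> r_nonneg by simp
next
  case True
  have "\<bar>ffall l i / L ^ i - r ^ i\<bar> = (real l ^ i - ffall l i) / L ^ i"
    using ffall_div_le[of i] by (simp add: r power_divide diff_divide_distrib)
  also have "\<dots> \<le> (real (i choose 2) * real l ^ (i - 1)) / L ^ i"
    using L power_minus_ffall_le by (intro divide_right_mono) auto
  also have "\<dots> = real l / L\<^sup>2 * (real (i choose 2) * r ^ (i - 2))"
  proof -
    obtain m where "i = Suc (Suc m)" using le_Suc_ex[OF True] by auto
    thus ?thesis using L by (simp add: r power_divide power2_eq_square mult_ac)
  qed
  also have "\<dots> \<le> real l / L\<^sup>2 * ((r + \<eta>) ^ i / \<eta>\<^sup>2)"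
    using binomial_term_le[OF r_nonneg, of \<eta> i] \<eta> True L
    by (intro mult_left_mono) (auto simp: field_simps)
  finally show ?thesis by simp
qed

text \<open>Both normalized falling factorials are compared with pure powers, and the common main
  term \<open>r^(i + j)\<close> cancels. The index \<open>i\<close> is the shift by
  \<open>z^i\<close>, while \<open>j\<close> is the position of a coefficient of
  \<open>W\<close>.\<close>

lemma ffall_approx_diff:
  "\<bar>ffall l (i + j) / L ^ (i + j) - r ^ i * (ffall l j / L ^ j)\<bar>
     \<le> 2 * (real l / L\<^sup>2 / \<eta>\<^sup>2) * (r + \<eta>) ^ i * (r + \<eta>) ^ j"
proof -
  define c where "c = real l / L\<^sup>2 / \<eta>\<^sup>2"
  have c: "c \<ge> 0" using L by (simp add: c_def)
  have "ffall l (i + j) / L ^ (i + j) - r ^ i * (ffall l j / L ^ j) =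
      (ffall l (i + j) / L ^ (i + j) - r ^ (i + j)) - r ^ i * (ffall l j / L ^ j - r ^ j)"
    by (simp add: algebra_simps power_add)
  also have "\<bar>\<dots>\<bar> \<le> \<bar>ffall l (i + j) / L ^ (i + j) - r ^ (i + j)\<bar> + r ^ i * \<bar>ffall l j / L ^ j - r ^ j\<bar>"
    using r_nonneg by (intro order_trans[OF abs_triangle_ineq4]) (simp add: abs_mult)
  also have "\<dots> \<le> c * (r + \<eta>) ^ (i + j) + (r + \<eta>) ^ i * (c * (r + \<eta>) ^ j)"
    unfolding c_def using r_nonneg \<eta>
    by (intro add_mono mult_mono ffall_approx power_mono) auto
  also have "\<dots> = 2 * c * (r + \<eta>) ^ i * (r + \<eta>) ^ j" by (simp add: power_add)
  finally show ?thesis by (simp add: c_def)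
qed

end

section \<open>The truncated Weierstrass product\<close>

definition cycle_entire :: "nat \<Rightarrow> real fps" where
  "cycle_entire n = cycle_fps n * fps_exp (- ln (real n))"

lemma cycle_fps_conv_entire: "cycle_fps n = cycle_entire n * fps_exp (ln (real n))"
  by (simp add: cycle_entire_def mult.assoc flip: fps_exp_add_mult)

lemma fps_exp_sum: "fps_exp (\<Sum>i\<in>A. f i) = (\<Prod>i\<in>A. fps_exp (f i :: real))"
  by (induction A rule: infinite_finite_induct) (auto simp: fps_exp_add_mult)

text \<open>Here \<open>n^(-z)\<close> is redistributed: writing \<open>ln n\<close> as the harmonic
  sum minus a remainder gives every factor \<open>1 + z / j\<close> its own
  \<open>exp (-z / j)\<close>. The remainder lies between \<open>0\<close> and \<open>1\<close> and
  costs only \<open>exp \<rho>\<close> in norm.\<close>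

lemma cycle_entire_factor:
  assumes "n \<ge> 1"
  shows "cycle_entire n = fps_exp (harm (n - 1) - ln (real n)) * (\<Prod>j\<in>{1..<n}. canonical_factor (1 / real j))"
proof -
  have "{1..n - 1} = {1..<n}" using assms by auto
  hence "harm (n - 1) = (\<Sum>j\<in>{1..<n}. 1 / real j)"
    by (simp add: harm_def field_simps)
  hence "fps_exp (- ln (real n)) = fps_exp (harm (n - 1) - ln (real n)) * fps_exp (\<Sum>j\<in>{1..<n}. - (1 / real j))"
    by (subst fps_exp_add_mult[symmetric]) (simp add: sum_negf)
  thus ?thesis
    by (simp add: cycle_entire_def cycle_fps_def canonical_factor_def fps_exp_sum prod.distrib mult_ac)
qed

text \<open>Telescoping with \<open>1 / j^2 \<le> 1 / (j - 1) - 1 / j\<close>. The subtracted term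
  is kept so that the induction closes.\<close>

lemma sum_inverse_squares_tail:
  assumes "N \<ge> 1" "n \<ge> Suc N"
  shows "(\<Sum>j\<in>{Suc N..<n}. 1 / (real j)\<^sup>2) \<le> 1 / real N - 1 / real (n - 1)"
  using assms(2)
proof (induction n rule: dec_induct)
  case (step m)
  define a where "a = real m - 1"
  have m: "real m = a + 1" "a > 0" "real (m - 1) = a" using step assms by (auto simp: a_def)
  have "1 / (a + 1)\<^sup>2 \<le> 1 / a - 1 / (a + 1)"
  proof -
    have "1 / a - 1 / (a + 1) = 1 / (a * (a + 1))" using m by (simp add: field_simps)
    moreover have "1 / (a + 1)\<^sup>2 \<le> 1 / (a * (a + 1))"
      using m by (intro divide_left_mono) (auto simp: power2_eq_square)
    ultimately show ?thesis by simp
  qed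
  thus ?case using step m by simp
qed simp

text \<open>
  The two bounds for the norm of a canonical factor are combined here: linear for \<open>j \<le> \<rho>\<close>, quadratic
  for \<open>j > \<rho>\<close>. The quadratic one alone would give \<open>exp (O(\<rho>\<^sup>2))\<close>, too large for the theorem.
\<close>

lemma sum_min_le:
  assumes "\<rho> > 0"
  shows "(\<Sum>j\<in>{1..<n}. if real j \<le> \<rho> then \<rho> / real j else (\<rho> / real j)\<^sup>2) \<le> \<rho> * (2 + ln (\<rho> + 1))"
proof -
  define N where "N = nat \<lceil>\<rho>\<rceil>"
  have N: "\<rho> \<le> real N" "real N \<le> \<rho> + 1" "N \<ge> 1" using assms by (auto simp: N_def) linarith+
  let ?f = "\<lambda>j. if real j \<le> \<rho> then \<rho> / real j else (\<rho> / real j)\<^sup>2"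
  have f1: "?f j \<le> \<rho> * (1 / real j)" if "j \<ge> 1" for j
  proof (cases "real j \<le> \<rho>")
    case False
    hence "(\<rho> / real j) * (\<rho> / real j) \<le> (\<rho> / real j) * 1"
      using assms that by (intro mult_left_mono) auto
    thus ?thesis using False by (simp add: power2_eq_square)
  qed auto
  \<comment> \<open>Enlarging the range avoids a case distinction between \<open>n\<close> and
    \<open>\<rho>\<close>. The head up to \<open>N\<close> is at most \<open>\<rho>\<close> times a
    harmonic number, the tail at most \<open>\<rho>^2 / N \<le> \<rho>\<close>.\<close>
  have "sum ?f {1..<n} \<le> sum ?f ({1..N} \<union> {Suc N..<Suc N + n})"
    using assms by (intro sum_mono2) auto
  also have "\<dots> = sum ?f {1..N} + sum ?f {Suc N..<Suc N + n}"
    by (intro sum.union_disjoint) auto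
  also have "sum ?f {1..N} \<le> (\<Sum>j\<in>{1..N}. \<rho> * (1 / real j))"
    by (intro sum_mono f1) auto
  also have "\<dots> = \<rho> * harm N" by (simp add: harm_def sum_distrib_left field_simps)
  also have "harm N \<le> 1 + ln (real N)"
    using euler_mascheroni_sequence_decreasing[of 1 N] N by (simp add: harm_expand)
  also have "ln (real N) \<le> ln (\<rho> + 1)" using N by (subst ln_le_cancel_iff) auto
  also have "sum ?f {Suc N..<Suc N + n} = (\<Sum>j\<in>{Suc N..<Suc N + n}. \<rho>\<^sup>2 * (1 / (real j)\<^sup>2))"
    using N by (intro sum.cong) (auto simp: power_divide)
  also have "\<dots> = \<rho>\<^sup>2 * (\<Sum>j\<in>{Suc N..<Suc N + n}. 1 / (real j)\<^sup>2)" by (rule sum_distrib_left[symmetric])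
  also have "(\<Sum>j\<in>{Suc N..<Suc N + n}. 1 / (real j)\<^sup>2) \<le> 1 / real N"
    by (rule order_trans[OF sum_inverse_squares_tail[of N "Suc N + n"]]) (use N in auto)
  also have "\<rho>\<^sup>2 * (1 / real N) \<le> \<rho>"
  proof -
    have "\<rho> * \<rho> \<le> \<rho> * real N" using N assms by (intro mult_left_mono) auto
    thus ?thesis using N by (simp add: divide_le_eq power2_eq_square)
  qed
  finally show ?thesis using assms by (simp add: algebra_simps)
qed

text \<open>The exponents of the two factor bounds have constants \<open>2\<close> and
  \<open>3\<close>, and \<open>3\<close> covers both, giving
  \<open>3 \<rho> (2 + ln (\<rho> + 1))\<close> for the product. The leftover exponential adds
  \<open>\<rho>\<close>, whence \<open>7 = 3 * 2 + 1\<close>. The bound is uniform in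
  \<open>n\<close> and \<open>J\<close>.\<close>

lemma cycle_entire_norm_le:
  assumes "n \<ge> 1" "\<rho> > 0"
  shows "trunc_norm abs \<rho> J (cycle_entire n) \<le> exp (7 * \<rho> + 3 * \<rho> * ln (\<rho> + 1))"
proof -
  interpret tn: ring_seminorm "trunc_norm (abs :: real \<Rightarrow> real) \<rho> J"
    using assms by (intro abs_seminorm.trunc_norm_seminorm) auto
  define g where "g = (\<lambda>j. if real j \<le> \<rho> then \<rho> / real j else (\<rho> / real j)\<^sup>2)"
  have fac: "trunc_norm abs \<rho> J (canonical_factor (1 / real j)) \<le> exp (3 * g j)" if "j \<in> {1..<n}" for j
  proof (cases "real j \<le> \<rho>")
    case True
    have "trunc_norm abs \<rho> J (canonical_factor (1 / real j)) \<le> exp (2 * (1 / real j * \<rho>))"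
      using assms by (intro canonical_factor_norm_linear) auto
    also have "\<dots> \<le> exp (3 * g j)" using True assms by (simp add: g_def divide_right_mono)
    finally show ?thesis .
  next
    case False
    thus ?thesis using canonical_factor_norm_quadratic[of \<rho> "1 / real j" J] assms that by (simp add: g_def)
  qed
  have "trunc_norm abs \<rho> J (\<Prod>j\<in>{1..<n}. canonical_factor (1 / real j)) \<le>
      (\<Prod>j\<in>{1..<n}. trunc_norm abs \<rho> J (canonical_factor (1 / real j)))" by (rule tn.prod_le)
  also have "\<dots> \<le> (\<Prod>j\<in>{1..<n}. exp (3 * g j))" by (intro prod_mono conjI fac tn.nonneg)
  also have "\<dots> = exp (3 * (\<Sum>j\<in>{1..<n}. g j))" by (simp add: exp_sum sum_distrib_left)
  also have "\<dots> \<le> exp (3 * (\<rho> * (2 + ln (\<rho> + 1))))"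
    using sum_min_le[OF assms(2), of n] by (simp add: g_def)
  finally have 1: "trunc_norm abs \<rho> J (\<Prod>j\<in>{1..<n}. canonical_factor (1 / real j)) \<le> \<dots>" .
  have "\<bar>harm (n - 1) - ln (real n)\<bar> \<le> 1" using harm_pred_bounds[OF assms(1)] by auto
  hence "exp (\<bar>harm (n - 1) - ln (real n)\<bar> * \<rho>) \<le> exp \<rho>" using assms by (simp add: mult_left_le_one_le)
  hence 2: "trunc_norm abs \<rho> J (fps_exp (harm (n - 1) - ln (real n))) \<le> exp \<rho>"
    using assms by (intro order_trans[OF trunc_norm_exp_le]) auto
  have "trunc_norm abs \<rho> J (cycle_entire n) \<le> exp \<rho> * exp (3 * (\<rho> * (2 + ln (\<rho> + 1))))"
    unfolding cycle_entire_factor[OF assms(1)]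
    by (rule order_trans[OF tn.mult mult_mono[OF 2 1]]) (simp_all add: tn.nonneg)
  thus ?thesis by (simp add: algebra_simps flip: exp_add)
qed

text \<open>\<open>stirling\<close> denotes the unsigned numbers of the first kind; their meaning
  for permutations is supplied by \<open>prob_num_cycles\<close>.\<close>

definition cycle_prob :: "nat \<Rightarrow> nat \<Rightarrow> real" where
  "cycle_prob n k = real (stirling n k) / fact n"

lemma cycle_prob_0_left: "cycle_prob 0 k = (if k = 0 then 1 else 0)"
  by (cases k) (auto simp: cycle_prob_def)

lemma cycle_prob_0_right: "n \<ge> 1 \<Longrightarrow> cycle_prob n 0 = 0"
  by (simp add: cycle_prob_def)

lemma cycle_prob_nonneg: "cycle_prob n k \<ge> 0"
  by (simp add: cycle_prob_def)

lemma cycle_prob_Suc: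
  assumes "n \<ge> 1"
  shows "cycle_prob n (Suc l) = fps_nth (cycle_fps n) l / real n"
  using assms
proof (induction n arbitrary: l rule: dec_induct)
  case base thus ?case by (cases l) (auto simp: cycle_fps_1 cycle_prob_def)
next
  case (step m)
  have "cycle_prob (Suc m) (Suc l) = (real m * cycle_prob m (Suc l) + cycle_prob m l) / real (Suc m)"
    by (simp add: cycle_prob_def add_divide_distrib mult_ac del: of_nat_Suc)
  also have "real m * cycle_prob m (Suc l) + cycle_prob m l = fps_nth (cycle_fps (Suc m)) l"
  proof (cases l)
    case 0 thus ?thesis using step by (simp add: cycle_prob_0_right cycle_fps_nth_0)
  next
    case (Suc i)
    thus ?thesis using step by (simp add: cycle_fps_Suc_nth)
  qed
  finally show ?case .
qed

section \<open>Perturbing the arguments of the cycle probabilities\<close>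

context
  fixes n l :: nat and L r \<eta> :: real
  assumes n: "n \<ge> 2" and L_def: "L = ln (real n)" and r: "r = real l / L"
    and \<eta>: "0 < \<eta>" "\<eta> \<le> 1"
begin

text \<open>The coefficient of \<open>z^l\<close> in \<open>exp (L z)\<close>, which is
  \<open>n\<close> times the Poisson weight since \<open>exp (-L) = 1 / n\<close>.\<close>

definition exp_coeff where "exp_coeff = L ^ l / fact l"

lemma L_pos: "L > 0" using n by (simp add: L_def)

lemma r_nonneg': "r \<ge> 0" using L_pos by (simp add: r)

lemma exp_coeff_pos: "exp_coeff > 0" using L_pos by (simp add: exp_coeff_def)

lemma poisson_eq: "pmf (poisson_pmf (ln (real n))) l = exp_coeff / real n"
  unfolding exp_coeff_def L_def[symmetric] using n L_pos by (simp add: exp_minus) (simp add: L_def divide_inverse)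

lemma power_div_fact_shift:
  assumes "i \<le> l"
  shows "L ^ (l - i) / fact (l - i) = exp_coeff * (ffall l i / L ^ i)"
proof -
  have "L ^ l = L ^ (l - i) * L ^ i" using assms by (simp flip: power_add)
  moreover have "(fact l :: real) = ffall l i * fact (l - i)" using ffall_fact[OF assms] by simp
  moreover have "ffall l i \<noteq> 0" using ffall_fact[OF assms] by (metis fact_nonzero mult_zero_left)
  ultimately show ?thesis using L_pos by (simp add: exp_coeff_def)
qed

text \<open>The harmonic number is at most \<open>L (1 + 1 / L)\<close>, and
  \<open>(1 + 1 / L)^(l - i) \<le> exp (l / L) = exp r\<close> is the whole cost of replacing it by
  \<open>L\<close>.\<close>

lemma cycle_fps_nth_le:
  assumes "1 \<le> n'" "n' \<le> n" "i \<le> l"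
  shows "fps_nth (cycle_fps n') (l - i) \<le> exp r * r ^ i * exp_coeff"
proof -
  have "harm (n' - 1) \<le> 1 + ln (real n')" by (rule harm_pred_bounds) fact
  also have "\<dots> \<le> 1 + L" using assms by (simp add: L_def)
  also have "1 + L = L * (1 + 1 / L)" using L_pos by (simp add: field_simps)
  finally have h: "harm (n' - 1) \<le> L * (1 + 1 / L)" .
  have "fps_nth (cycle_fps n') (l - i) \<le> harm (n' - 1) ^ (l - i) / fact (l - i)"
    by (rule cycle_fps_nth_le_harm) fact
  also have "\<dots> \<le> (L * (1 + 1 / L)) ^ (l - i) / fact (l - i)"
    using h by (intro divide_right_mono power_mono) (auto simp: harm_nonneg)
  also have "\<dots> = (1 + 1 / L) ^ (l - i) * (L ^ (l - i) / fact (l - i))"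
    by (simp add: power_mult_distrib)
  also have "\<dots> \<le> exp r * (L ^ (l - i) / fact (l - i))"
  proof (intro mult_right_mono)
    have "(1 + 1 / L) ^ (l - i) \<le> exp (1 / L) ^ (l - i)"
      using L_pos by (intro power_mono exp_ge_add_one_self) auto
    also have "\<dots> = exp (real (l - i) / L)" by (simp flip: exp_of_nat_mult)
    also have "\<dots> \<le> exp r" using L_pos by (simp add: r divide_right_mono)
    finally show "(1 + 1 / L) ^ (l - i) \<le> exp r" .
  qed (use L_pos in auto)
  also have "L ^ (l - i) / fact (l - i) = exp_coeff * (ffall l i / L ^ i)"
    by (rule power_div_fact_shift) fact
  also have "exp r * (exp_coeff * (ffall l i / L ^ i)) \<le> exp r * (exp_coeff * r ^ i)"
    using exp_coeff_pos ffall_div_le[OF L_pos r, of \<eta> i] \<eta> by (intro mult_left_mono) auto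
  finally show ?thesis by (simp add: mult_ac)
qed

text \<open>Coefficient extraction in \<open>exp (L z) W(z)\<close>. The terms with
  \<open>i + j > l\<close> are added at no cost since \<open>ffall\<close> vanishes there; the range
  of \<open>j\<close> then no longer depends on \<open>i\<close>, and the cases \<open>i\<close> and
  \<open>0\<close> can be subtracted term by term.\<close>

lemma cycle_fps_nth_expansion:
  assumes "i \<le> l"
  shows "fps_nth (cycle_fps n) (l - i) =
    exp_coeff * (\<Sum>j\<le>l. fps_nth (cycle_entire n) j * (ffall l (i + j) / L ^ (i + j)))"
proof -
  have "fps_nth (cycle_fps n) (l - i) =
      (\<Sum>j\<le>l - i. fps_nth (cycle_entire n) j * (L ^ (l - i - j) / fact (l - i - j)))"
    by (subst cycle_fps_conv_entire) (simp add: fps_mult_nth atLeast0AtMost L_def)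
  also have "\<dots> = (\<Sum>j\<le>l - i. exp_coeff * (fps_nth (cycle_entire n) j * (ffall l (i + j) / L ^ (i + j))))"
  proof (intro sum.cong refl)
    fix j assume "j \<in> {..l - i}"
    hence "i + j \<le> l" using assms by auto
    from power_div_fact_shift[OF this]
    show "fps_nth (cycle_entire n) j * (L ^ (l - i - j) / fact (l - i - j)) =
      exp_coeff * (fps_nth (cycle_entire n) j * (ffall l (i + j) / L ^ (i + j)))"
      by (simp add: mult_ac)
  qed
  also have "\<dots> = (\<Sum>j\<le>l. exp_coeff * (fps_nth (cycle_entire n) j * (ffall l (i + j) / L ^ (i + j))))"
    using assms by (intro sum.mono_neutral_left) (auto simp: ffall_eq_0)
  finally show ?thesis by (simp add: sum_distrib_left)
qed

text \<open>For \<open>i > Suc l\<close> truncated subtraction would read off \<open>cycle_prob N 0\<close>, which is \<open>1\<close> for \<open>N = 0\<close>.\<close>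

definition shifted_prob :: "nat \<Rightarrow> nat \<Rightarrow> real" where
  "shifted_prob N i = (if i \<le> Suc l then cycle_prob N (Suc l - i) else 0)"

lemma shifted_prob_eq:
  assumes "N \<ge> 1"
  shows "shifted_prob N i = (if i \<le> l then fps_nth (cycle_fps N) (l - i) / real N else 0)"
  using assms by (auto simp: shifted_prob_def cycle_prob_Suc Suc_diff_le cycle_prob_0_right not_less_eq_eq le_Suc_eq)

lemma shifted_prob_approx:
  "\<bar>shifted_prob n i - r ^ i * cycle_prob n (Suc l)\<bar> \<le>
     exp_coeff / real n * (real l / L\<^sup>2) * (2 / \<eta>\<^sup>2 * exp (7 * (r + \<eta>) + 3 * (r + \<eta>) * ln (r + \<eta> + 1))) * (r + \<eta>) ^ i"
proof -
  define \<rho> where "\<rho> = r + \<eta>"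
  define w where "w = (\<lambda>j. fps_nth (cycle_entire n) j)"
  have \<rho>: "\<rho> > 0" using r_nonneg' \<eta> by (simp add: \<rho>_def)
  have 1: "shifted_prob n i = exp_coeff / real n * (\<Sum>j\<le>l. w j * (ffall l (i + j) / L ^ (i + j)))"
  proof (cases "i \<le> l")
    case True
    thus ?thesis using n cycle_fps_nth_expansion[OF True] by (simp add: shifted_prob_eq w_def)
  next
    case False
    thus ?thesis using n by (simp add: shifted_prob_eq ffall_eq_0)
  qed
  have 2: "cycle_prob n (Suc l) = exp_coeff / real n * (\<Sum>j\<le>l. w j * (ffall l j / L ^ j))"
    using n cycle_fps_nth_expansion[of 0] by (simp add: cycle_prob_Suc w_def)
  have "shifted_prob n i - r ^ i * cycle_prob n (Suc l) =
      exp_coeff / real n * (\<Sum>j\<le>l. w j * (ffall l (i + j) / L ^ (i + j) - r ^ i * (ffall l j / L ^ j)))"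
    by (simp add: 1 2 right_diff_distrib sum_subtractf sum_distrib_left mult_ac)
  also have "\<bar>\<dots>\<bar> \<le> exp_coeff / real n * (\<Sum>j\<le>l. \<bar>w j\<bar> * (2 * (real l / L\<^sup>2 / \<eta>\<^sup>2) * \<rho> ^ i * \<rho> ^ j))"
    unfolding abs_mult
    using exp_coeff_pos ffall_approx_diff[OF L_pos r \<eta>(1), of i]
    by (intro mult_mono order_trans[OF sum_abs] sum_mono)
       (auto simp: abs_mult \<rho>_def simp del: times_divide_eq_right intro!: mult_left_mono)
  also have "\<dots> = exp_coeff / real n * (real l / L\<^sup>2) * (2 / \<eta>\<^sup>2 * trunc_norm abs \<rho> l (cycle_entire n)) * \<rho> ^ i"
    by (simp add: trunc_norm_def w_def sum_distrib_left sum_distrib_right mult_ac)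
  also have "\<dots> \<le> exp_coeff / real n * (real l / L\<^sup>2) * (2 / \<eta>\<^sup>2 * exp (7 * \<rho> + 3 * \<rho> * ln (\<rho> + 1))) * \<rho> ^ i"
    using exp_coeff_pos \<rho> n by (intro mult_right_mono mult_left_mono cycle_entire_norm_le) auto
  finally show ?thesis by (simp add: \<rho>_def)
qed

lemma shifted_prob_le:
  assumes "N \<ge> 1" "N \<le> n"
  shows "shifted_prob N i \<le> exp r * r ^ i * exp_coeff / real N"
  using cycle_fps_nth_le[OF assms, of i] assms exp_coeff_pos r_nonneg'
  by (auto simp: shifted_prob_eq divide_right_mono)

lemma shifted_prob_nonneg: "shifted_prob N i \<ge> 0"
  by (simp add: shifted_prob_def cycle_prob_nonneg)

text \<open>Raising the index by one adds the next lower coefficient divided by the current index,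
  which is at least the initial \<open>N\<close>. That coefficient carries one more power of
  \<open>r\<close> in its bound, and \<open>m\<close> such steps give the factor
  \<open>m / N\<close>.\<close>

lemma cycle_fps_nth_increment:
  assumes "1 \<le> N" "N + m \<le> n" "i \<le> l"
  shows "fps_nth (cycle_fps N) (l - i) \<le> fps_nth (cycle_fps (N + m)) (l - i)"
        "fps_nth (cycle_fps (N + m)) (l - i) - fps_nth (cycle_fps N) (l - i) \<le>
           real m / real N * (exp r * r ^ Suc i * exp_coeff)"
proof -
  have step: "fps_nth (cycle_fps (Suc M)) (l - i) \<ge> fps_nth (cycle_fps M) (l - i) \<and>
     fps_nth (cycle_fps (Suc M)) (l - i) - fps_nth (cycle_fps M) (l - i) \<le> exp r * r ^ Suc i * exp_coeff / real N"
    if M: "N \<le> M" "M < n" for M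
  proof (cases "i = l")
    case True
    thus ?thesis using r_nonneg' exp_coeff_pos by (simp add: cycle_fps_nth_0)
  next
    case False
    hence eq: "l - i = Suc (l - Suc i)" and il: "Suc i \<le> l" using assms by auto
    have "fps_nth (cycle_fps M) (l - Suc i) / real M \<le> (exp r * r ^ Suc i * exp_coeff) / real N"
      using M assms il exp_coeff_pos r_nonneg'
      by (intro frac_le cycle_fps_nth_le) (auto intro!: cycle_fps_nth_nonneg)
    moreover have "fps_nth (cycle_fps M) (l - Suc i) / real M \<ge> 0"
      by (simp add: cycle_fps_nth_nonneg)
    moreover have "M \<ge> 1" using assms M by simp
    ultimately show ?thesis unfolding eq by (simp add: cycle_fps_Suc_nth)
  qed
  have "fps_nth (cycle_fps N) (l - i) \<le> fps_nth (cycle_fps (N + m)) (l - i) \<and>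
        fps_nth (cycle_fps (N + m)) (l - i) - fps_nth (cycle_fps N) (l - i) \<le>
           real m / real N * (exp r * r ^ Suc i * exp_coeff)"
    using assms(2)
  proof (induction m)
    case (Suc m)
    have "real (Suc m) / real N * (exp r * r ^ Suc i * exp_coeff) =
       real m / real N * (exp r * r ^ Suc i * exp_coeff) + exp r * r ^ Suc i * exp_coeff / real N"
      by (simp add: field_simps add_divide_distrib)
    thus ?case using Suc step[of "N + m"] by simp
  qed simp
  thus "fps_nth (cycle_fps N) (l - i) \<le> fps_nth (cycle_fps (N + m)) (l - i)"
       "fps_nth (cycle_fps (N + m)) (l - i) - fps_nth (cycle_fps N) (l - i) \<le>
           real m / real N * (exp r * r ^ Suc i * exp_coeff)" by blast+
qed

lemma shifted_prob_diff_le: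
  assumes "1 \<le> m" "m < n"
  shows "\<bar>shifted_prob (n - m) i - shifted_prob n i\<bar> \<le>
     2 * ((real m)\<^sup>2 / real n) * ((1 + r) * exp r) * r ^ i * (exp_coeff / real n)"
proof (cases "i \<le> l")
  case True
  define A B where "A = fps_nth (cycle_fps (n - m)) (l - i)" and "B = fps_nth (cycle_fps n) (l - i)"
  define G where "G = exp r * r ^ i * exp_coeff"
  have AB: "A \<le> B" "B - A \<le> real m / real (n - m) * (r * G)"
    using cycle_fps_nth_increment[of "n - m" m i] assms True by (auto simp: A_def B_def G_def mult_ac)
  have A: "0 \<le> A" "A \<le> G"
    using cycle_fps_nth_le[of "n - m" i] assms True by (auto simp: A_def G_def cycle_fps_nth_nonneg)
  have "shifted_prob (n - m) i - shifted_prob n i = A / real (n - m) - B / real n"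
    using assms True by (simp add: shifted_prob_eq A_def B_def)
  \<comment> \<open>Separates the change of the denominator from the change of the coefficient; each
    contributes a factor \<open>m / (n - m)\<close>.\<close>
  also have "\<dots> = A * (real m / real (n - m)) / real n - (B - A) / real n"
    using assms by (simp add: field_simps of_nat_diff)
  also have "\<bar>\<dots>\<bar> \<le> A * (real m / real (n - m)) / real n + (B - A) / real n"
    using AB A by (intro order_trans[OF abs_triangle_ineq4]) simp
  also have "\<dots> \<le> G * (real m / real (n - m)) / real n + real m / real (n - m) * (r * G) / real n"
    using AB A by (intro add_mono divide_right_mono mult_right_mono) auto
  also have "\<dots> = (real m / real (n - m)) * ((1 + r) * G / real n)"
    by (simp add: algebra_simps add_divide_distrib)
  also have "\<dots> \<le> (2 * ((real m)\<^sup>2 / real n)) * ((1 + r) * G / real n)"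
  proof (intro mult_right_mono)
    \<comment> \<open>From \<open>(m - 1) (n - m - 1) \<ge> 0\<close> follows
      \<open>m (n - m) \<ge> n - 1 \<ge> n / 2\<close>. This keeps the bound valid up to
      \<open>m = n - 1\<close>, where \<open>1 / (n - m)\<close> is no longer small.\<close>
    have "real n \<le> 2 * (real m * real (n - m))"
    proof -
      have "real m * real (n - m) - (real m + real (n - m) - 1) = (real m - 1) * (real (n - m) - 1)"
        by (simp add: algebra_simps)
      also have "\<dots> \<ge> 0" using assms by (intro mult_nonneg_nonneg) auto
      finally have "real m * real (n - m) \<ge> real n - 1" using assms by (simp add: of_nat_diff)
      moreover have "2 \<le> real n" using n by simp
      ultimately show ?thesis by argo
    qed
    hence "real m * real n \<le> real m * (2 * (real m * real (n - m)))"
      by (intro mult_left_mono) auto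
    thus "real m / real (n - m) \<le> 2 * ((real m)\<^sup>2 / real n)"
      using assms by (simp add: field_simps power2_eq_square)
    show "(1 + r) * G / real n \<ge> 0" using r_nonneg' exp_coeff_pos by (simp add: G_def)
  qed
  finally show ?thesis by (simp add: G_def mult_ac)
next
  case False
  thus ?thesis using assms n r_nonneg' exp_coeff_pos by (simp add: shifted_prob_eq)
qed

text \<open>Serves the exceptional value \<open>p(0, 0) = 1\<close>, met for \<open>m = n\<close>
  and \<open>i = k\<close>. It is not small, but \<open>r^l exp_coeff = l^l / l!\<close> is at least
  \<open>1\<close>, and the surplus power of \<open>r + \<eta>\<close> costs the factor
  \<open>1 / \<eta>\<close>.\<close>

lemma indicator_le: 
  assumes "i = Suc l"
  shows "1 \<le> real n / \<eta> * (r + \<eta>) ^ i * (exp_coeff / real n)"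
proof -
  have "1 \<le> (real l) ^ l / fact l" by (rule one_le_power_div_fact_real)
  also have "\<dots> = r ^ l * exp_coeff" using L_pos by (simp add: r exp_coeff_def power_divide)
  also have "\<dots> \<le> (r + \<eta>) ^ l * exp_coeff"
    using exp_coeff_pos r_nonneg' \<eta> by (intro mult_right_mono power_mono) auto
  also have "\<dots> \<le> ((r + \<eta>) / \<eta>) * ((r + \<eta>) ^ l * exp_coeff)"
    using exp_coeff_pos r_nonneg' \<eta> mult_right_mono[of 1 "(r + \<eta>) / \<eta>" "(r + \<eta>) ^ l * exp_coeff"] by simp
  also have "\<dots> = real n / \<eta> * (r + \<eta>) ^ i * (exp_coeff / real n)"
    using n by (simp add: assms)
  finally show ?thesis .
qed

text \<open>For \<open>m \<ge> n\<close> the estimate no longer rests on closeness of the two terms: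
  \<open>m^2 / n\<close> is at least \<open>n\<close>, and crude bounds for each of them
  suffice.\<close>

lemma shifted_prob_diff_le':
  assumes "m \<ge> 1"
  shows "\<bar>(if m \<le> n then shifted_prob (n - m) i else 0) - shifted_prob n i\<bar> \<le>
     2 / \<eta> * ((real m)\<^sup>2 / real n) * ((1 + r) * exp r) * (r + \<eta>) ^ i * (exp_coeff / real n)"
proof -
  define Y where "Y = (r + \<eta>) ^ i * (exp_coeff / real n)"
  define Q where "Q = (1 + r) * exp r"
  have Q: "Q \<ge> 1" "Q \<ge> exp r"
    using r_nonneg' mult_mono[of 1 "1 + r" 1 "exp r"] mult_right_mono[of 1 "1 + r" "exp r"] by (auto simp: Q_def)
  have Y: "r ^ i * (exp_coeff / real n) \<le> Y" "Y \<ge> 0"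
    unfolding Y_def using r_nonneg' exp_coeff_pos \<eta>
    by (intro mult_right_mono power_mono mult_nonneg_nonneg zero_le_power; simp)+
  have s: "shifted_prob n i \<le> Q * Y"
  proof -
    have "shifted_prob n i \<le> exp r * (r ^ i * (exp_coeff / real n))"
      using shifted_prob_le[of n i] n by simp
    also have "\<dots> \<le> Q * Y" using Y Q r_nonneg' exp_coeff_pos by (intro mult_mono) auto
    finally show ?thesis .
  qed
  have inv: "1 / \<eta> \<ge> 1" using \<eta> by simp
  consider "m < n" | "m = n" | "m > n" by linarith
  hence "\<bar>(if m \<le> n then shifted_prob (n - m) i else 0) - shifted_prob n i\<bar> \<le>
     2 / \<eta> * ((real m)\<^sup>2 / real n) * (Q * Y)"
  proof cases
    case 1
    have "\<bar>shifted_prob (n - m) i - shifted_prob n i\<bar> \<le> 2 * ((real m)\<^sup>2 / real n) * (Q * (r ^ i * (exp_coeff / real n)))"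
      using shifted_prob_diff_le[OF assms 1, of i] by (simp add: Q_def mult_ac)
    also have "\<dots> \<le> 2 / \<eta> * ((real m)\<^sup>2 / real n) * (Q * Y)"
      using Y Q inv r_nonneg' exp_coeff_pos \<eta> mult_left_mono[OF inv, of 2] by (intro mult_mono) auto
    finally show ?thesis using 1 by simp
  next
    case 2
    have "shifted_prob 0 i \<le> real n / \<eta> * Y"
    proof (cases "i = Suc l")
      case True
      thus ?thesis using indicator_le[OF True]
        by (auto simp: shifted_prob_def cycle_prob_0_left Y_def)
    next
      case False
      thus ?thesis using Y \<eta> by (auto simp: shifted_prob_def cycle_prob_0_left)
    qed
    also have "\<dots> \<le> real n / \<eta> * (Q * Y)"
      using Y Q \<eta> mult_right_mono[OF Q(1) Y(2)] by (intro mult_left_mono) auto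
    finally have 3: "shifted_prob 0 i \<le> real n / \<eta> * (Q * Y)" .
    have "1 \<le> real n / \<eta>" using \<eta> n by simp
    hence "1 * (Q * Y) \<le> real n / \<eta> * (Q * Y)" using Q Y by (intro mult_right_mono) auto
    hence 4: "shifted_prob n i \<le> real n / \<eta> * (Q * Y)" using s by simp
    have "\<bar>shifted_prob 0 i - shifted_prob n i\<bar> \<le> 2 * (real n / \<eta> * (Q * Y))"
      using 3 4 shifted_prob_nonneg[of 0 i] shifted_prob_nonneg[of n i] Y Q by (smt (verit))
    also have "\<dots> = 2 / \<eta> * ((real m)\<^sup>2 / real n) * (Q * Y)"
      using 2 n by (simp add: power2_eq_square)
    finally show ?thesis using 2 by simp
  next
    case 3
    have "real n * 1 \<le> real m * real m" using 3 by (intro mult_mono) auto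
    hence "1 * 1 \<le> 2 / \<eta> * ((real m)\<^sup>2 / real n)"
      using n \<eta> by (intro mult_mono) (auto simp: power2_eq_square)
    hence "1 * (Q * Y) \<le> 2 / \<eta> * ((real m)\<^sup>2 / real n) * (Q * Y)"
      using Q Y by (intro mult_right_mono) auto
    thus ?thesis using 3 s shifted_prob_nonneg[of n i] by simp
  qed
  thus ?thesis by (simp add: Q_def Y_def mult_ac)
qed

text \<open>Puts the loss \<open>m^2 / n\<close> from changing \<open>n\<close> on the scale
  \<open>1 / L^2\<close> of the theorem.\<close>

lemma ln_squared_le: "L\<^sup>2 \<le> 4 * real n"
proof -
  have "L = 2 * ln (sqrt (real n))" using n by (simp add: L_def ln_sqrt)
  also have "\<dots> \<le> 2 * sqrt (real n)" using n ln_bound[of "sqrt (real n)"] by simp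
  finally have "L\<^sup>2 \<le> (2 * sqrt (real n))\<^sup>2" using L_pos by (intro power_mono) auto
  thus ?thesis by (simp add: power_mult_distrib)
qed

text \<open>The first constant comes from changing \<open>n\<close>, the second from changing
  \<open>k\<close>. The error of the second kind vanishes for \<open>l = 0\<close>, that of the
  first does not, which accounts for the numerator \<open>k = Suc l\<close> in place of
  \<open>l\<close>.\<close>

lemma shifted_prob_main:
  assumes Cu: "\<And>m. (real m)\<^sup>2 \<le> Cu * u ^ m" and u: "u \<ge> 1"
  shows "\<bar>(if m \<le> n then shifted_prob (n - m) i else 0) - r ^ i * cycle_prob n (Suc l)\<bar> \<le>
    (8 * Cu / \<eta> * ((1 + r) * exp r) + 2 / \<eta>\<^sup>2 * exp (7 * (r + \<eta>) + 3 * (r + \<eta>) * ln (r + \<eta> + 1)))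
      * (exp_coeff / real n * (real (Suc l) / L\<^sup>2)) * ((r + \<eta>) ^ i * u ^ m)"
proof -
  define K1 where "K1 = (1 + r) * exp r"
  define K2 where "K2 = 2 / \<eta>\<^sup>2 * exp (7 * (r + \<eta>) + 3 * (r + \<eta>) * ln (r + \<eta> + 1))"
  define Y where "Y = (r + \<eta>) ^ i"
  define P where "P = exp_coeff / real n"
  define kL where "kL = real (Suc l) / L\<^sup>2"
  have nn: "K1 \<ge> 0" "K2 \<ge> 0" "Y \<ge> 0" "P \<ge> 0" "kL \<ge> 0"
    using r_nonneg' \<eta> exp_coeff_pos by (auto simp: K1_def K2_def Y_def P_def kL_def)
  have um: "u ^ m \<ge> 1" using u by (rule one_le_power)
  have Cu0: "Cu \<ge> 0" using Cu[of 0] by simp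
  have 1: "\<bar>(if m \<le> n then shifted_prob (n - m) i else 0) - shifted_prob n i\<bar> \<le> 8 * Cu / \<eta> * K1 * (P * kL) * (Y * u ^ m)"
  proof (cases "m = 0")
    case True
    thus ?thesis using nn Cu0 \<eta> by simp
  next
    case False
    hence "\<bar>(if m \<le> n then shifted_prob (n - m) i else 0) - shifted_prob n i\<bar> \<le>
      2 / \<eta> * ((real m)\<^sup>2 / real n) * K1 * Y * P"
      using shifted_prob_diff_le'[of m i] by (simp add: K1_def Y_def P_def)
    also have "\<dots> = (2 / \<eta> * K1 * Y * P) * ((real m)\<^sup>2 * (1 / real n))" by simp
    also have "\<dots> \<le> (2 / \<eta> * K1 * Y * P) * ((Cu * u ^ m) * (4 * kL))"
    proof (intro mult_left_mono mult_mono Cu)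
      have "1 / real n \<le> 4 / L\<^sup>2" using ln_squared_le n L_pos by (simp add: field_simps)
      also have "\<dots> \<le> 4 * kL" by (simp add: kL_def divide_right_mono)
      finally show "1 / real n \<le> 4 * kL" .
    qed (use nn \<eta> Cu0 u in auto)
    also have "\<dots> = 8 * Cu / \<eta> * K1 * (P * kL) * (Y * u ^ m)" by simp
    finally show ?thesis .
  qed
  have "\<bar>shifted_prob n i - r ^ i * cycle_prob n (Suc l)\<bar> \<le> P * (real l / L\<^sup>2) * K2 * Y"
    using shifted_prob_approx[of i] by (simp only: K2_def P_def Y_def)
  also have "\<dots> \<le> P * kL * K2 * (Y * u ^ m)"
    using nn um mult_left_mono[OF um nn(3)] by (intro mult_mono) (auto simp: kL_def divide_right_mono)
  finally have 2: "\<bar>shifted_prob n i - r ^ i * cycle_prob n (Suc l)\<bar> \<le> K2 * (P * kL) * (Y * u ^ m)"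
    by (simp add: mult_ac)
  have "\<bar>(if m \<le> n then shifted_prob (n - m) i else 0) - r ^ i * cycle_prob n (Suc l)\<bar> \<le>
     (8 * Cu / \<eta> * K1 * (P * kL) * (Y * u ^ m)) + (K2 * (P * kL) * (Y * u ^ m))"
    using 1 2 by linarith
  also have "\<dots> = (8 * Cu / \<eta> * K1 + K2) * (P * kL) * (Y * u ^ m)"
    by (simp add: algebra_simps)
  finally show ?thesis by (simp only: K1_def K2_def P_def Y_def kL_def)
qed

end

subsection \<open>Exponentials of power series over polynomials\<close>

text \<open>Routing through \<open>fps_of_poly\<close> lets the seminorm laws be inherited from
  \<open>trunc_norm\<close>.\<close>

definition poly_norm1 :: "real \<Rightarrow> nat \<Rightarrow> real poly \<Rightarrow> real" where
  "poly_norm1 \<rho> J p = trunc_norm abs \<rho> J (fps_of_poly p)"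

lemma poly_norm1_altdef: "poly_norm1 \<rho> J p = (\<Sum>i\<le>J. \<bar>Polynomial.coeff p i\<bar> * \<rho> ^ i)"
  by (simp add: poly_norm1_def trunc_norm_def)

lemma poly_norm1_seminorm:
  assumes "\<rho> \<ge> 0"
  shows "ring_seminorm (poly_norm1 \<rho> J)"
proof -
  interpret tn: ring_seminorm "trunc_norm (abs :: real \<Rightarrow> real) \<rho> J"
    by (rule abs_seminorm.trunc_norm_seminorm) fact
  show ?thesis
    by standard (simp_all add: poly_norm1_def tn.nonneg tn.zero tn.one tn.add tn.mult
                   fps_of_poly_add fps_of_poly_mult)
qed

lemma poly_norm1_smult: "poly_norm1 \<rho> J (Polynomial.smult c p) = \<bar>c\<bar> * poly_norm1 \<rho> J p"
  by (simp add: poly_norm1_altdef abs_mult sum_distrib_left mult_ac)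

lemma poly_norm1_monom_le: "\<rho> \<ge> 0 \<Longrightarrow> poly_norm1 \<rho> J (Polynomial.monom 1 j) \<le> \<rho> ^ j"
proof -
  assume "\<rho> \<ge> 0"
  have "poly_norm1 \<rho> J (Polynomial.monom 1 j) = (\<Sum>i\<le>J. if i = j then \<rho> ^ j else 0)"
    unfolding poly_norm1_altdef by (intro sum.cong) (auto simp: coeff_monom)
  also have "\<dots> \<le> \<rho> ^ j" using \<open>\<rho> \<ge> 0\<close> by simp
  finally show ?thesis .
qed

lemma poly_eq_sum_coeff:
  fixes p :: "real poly"
  assumes "Polynomial.degree p \<le> J"
  shows "poly p z = (\<Sum>i\<le>J. Polynomial.coeff p i * z ^ i)"
  unfolding poly_altdef using assms
  by (intro sum.mono_neutral_left) (auto simp: coeff_eq_0)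

text \<open>If \<open>f\<close> has no constant term, \<open>f^k\<close> starts at order
  \<open>k\<close>, so stopping the inner sum at \<open>m\<close> loses nothing and every
  coefficient is a polynomial in \<open>z\<close>.\<close>

definition poly_fps_exp :: "real poly fps \<Rightarrow> real poly fps" where
  "poly_fps_exp f = Abs_fps (\<lambda>m. \<Sum>k\<le>m. Polynomial.smult (1 / fact k) (fps_nth (f ^ k) m))"

lemma poly_fps_exp_nth_0: "fps_nth (poly_fps_exp f) 0 = 1"
  by (simp add: poly_fps_exp_def)

lemma poly_fps_exp_deriv:
  assumes "fps_nth f 0 = 0"
  shows "fps_deriv (poly_fps_exp f) = fps_deriv f * poly_fps_exp f"
proof -
  \<comment> \<open>\<open>real poly\<close> is not a field, so the exponential series is written
    out with constant polynomials.\<close>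
  define E where "E = (Abs_fps (\<lambda>n. [:1 / fact n:]) :: real poly fps)"
  have E: "fps_deriv E = E"
  proof (rule fps_ext)
    fix n
    have "fps_nth (fps_deriv E) n = [:real (Suc n):] * [:1 / fact (Suc n):]"
      by (simp add: E_def of_nat_poly del: of_nat_Suc)
    also have "\<dots> = [:1 / fact n:]" by (simp del: of_nat_Suc)
    finally show "fps_nth (fps_deriv E) n = fps_nth E n" by (simp add: E_def)
  qed
  have eq: "poly_fps_exp f = fps_compose E f"
    by (rule fps_ext) (simp add: poly_fps_exp_def fps_compose_nth E_def atLeast0AtMost)
  show ?thesis unfolding eq using fps_compose_deriv[OF assms, of E] by (simp add: E mult.commute)
qed

text \<open>Without \<open>m = 0\<close> the term \<open>k = 0\<close> disappears, and the
  exponential series without its first term is at most \<open>B exp B\<close>. The factor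
  \<open>B\<close> in front is what later provides \<open>1 / q\<close>.\<close>

lemma poly_fps_exp_norm_le:
  assumes "\<rho> \<ge> 0" "u \<ge> 0" "trunc_norm (poly_norm1 \<rho> J) u M f \<le> B"
  shows "(\<Sum>m\<in>{1..M}. poly_norm1 \<rho> J (fps_nth (poly_fps_exp f) m) * u ^ m) \<le> B * exp B"
proof -
  interpret pn: ring_seminorm "poly_norm1 \<rho> J" by (rule poly_norm1_seminorm) fact
  interpret tn: ring_seminorm "trunc_norm (poly_norm1 \<rho> J) u M" by (rule pn.trunc_norm_seminorm) fact
  have B: "B \<ge> 0" using tn.nonneg[of f] assms(3) by linarith
  have "(\<Sum>m\<in>{1..M}. poly_norm1 \<rho> J (fps_nth (poly_fps_exp f) m) * u ^ m) \<le>
        (\<Sum>m\<in>{1..M}. \<Sum>k\<in>{1..M}. 1 / fact k * (poly_norm1 \<rho> J (fps_nth (f ^ k) m) * u ^ m))"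
  proof (intro sum_mono)
    fix m assume m: "m \<in> {1..M}"
    have "fps_nth (poly_fps_exp f) m = (\<Sum>k\<le>m. Polynomial.smult (1 / fact k) (fps_nth (f ^ k) m))"
      by (simp add: poly_fps_exp_def)
    also have "\<dots> = (\<Sum>k\<in>{1..m}. Polynomial.smult (1 / fact k) (fps_nth (f ^ k) m))"
      using m by (intro sum.mono_neutral_right) (auto simp: not_less_eq_eq)
    finally have "poly_norm1 \<rho> J (fps_nth (poly_fps_exp f) m) \<le>
        (\<Sum>k\<in>{1..m}. 1 / fact k * poly_norm1 \<rho> J (fps_nth (f ^ k) m))"
      using pn.sum_le[of "\<lambda>k. Polynomial.smult (1 / fact k) (fps_nth (f ^ k) m)" "{1..m}"]
      by (simp add: poly_norm1_smult)
    also have "\<dots> \<le> (\<Sum>k\<in>{1..M}. 1 / fact k * poly_norm1 \<rho> J (fps_nth (f ^ k) m))"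
      using m by (intro sum_mono2) (auto simp: pn.nonneg)
    finally have "poly_norm1 \<rho> J (fps_nth (poly_fps_exp f) m) * u ^ m \<le>
       (\<Sum>k\<in>{1..M}. 1 / fact k * poly_norm1 \<rho> J (fps_nth (f ^ k) m)) * u ^ m"
      using assms by (intro mult_right_mono) auto
    thus "poly_norm1 \<rho> J (fps_nth (poly_fps_exp f) m) * u ^ m \<le>
       (\<Sum>k\<in>{1..M}. 1 / fact k * (poly_norm1 \<rho> J (fps_nth (f ^ k) m) * u ^ m))"
      by (simp only: sum_distrib_right mult.assoc)
  qed
  also have "\<dots> = (\<Sum>k\<in>{1..M}. 1 / fact k * (\<Sum>m\<in>{1..M}. poly_norm1 \<rho> J (fps_nth (f ^ k) m) * u ^ m))"
    by (subst sum.swap) (simp add: sum_distrib_left)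
  also have "\<dots> \<le> (\<Sum>k\<in>{1..M}. 1 / fact k * B ^ k)"
  proof (intro sum_mono mult_left_mono)
    fix k
    have "(\<Sum>m\<in>{1..M}. poly_norm1 \<rho> J (fps_nth (f ^ k) m) * u ^ m) \<le> trunc_norm (poly_norm1 \<rho> J) u M (f ^ k)"
      unfolding trunc_norm_def using assms by (intro sum_mono2) (auto simp: pn.nonneg)
    also have "\<dots> \<le> trunc_norm (poly_norm1 \<rho> J) u M f ^ k" by (rule tn.power_le)
    also have "\<dots> \<le> B ^ k" using assms tn.nonneg by (intro power_mono) auto
    finally show "(\<Sum>m\<in>{1..M}. poly_norm1 \<rho> J (fps_nth (f ^ k) m) * u ^ m) \<le> B ^ k" .
  qed auto
  also have "\<dots> \<le> B * exp B"
  proof (cases M)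
    case (Suc N)
    have "(\<Sum>k\<in>{1..M}. 1 / fact k * B ^ k) = (\<Sum>k\<in>{0..N}. 1 / fact (Suc k) * B ^ Suc k)"
      unfolding Suc by (rule sum.reindex_bij_witness[of _ Suc "\<lambda>k. k - 1"]) auto
    also have "\<dots> \<le> (\<Sum>k\<in>{0..N}. B * (B ^ k / fact k))"
    proof (intro sum_mono)
      fix k
      have "1 / fact (Suc k) \<le> (1 :: real) / fact k" by (intro divide_left_mono) (auto intro: fact_mono simp del: fact_Suc)
      from mult_right_mono[OF this, of "B ^ Suc k"] show "1 / fact (Suc k) * B ^ Suc k \<le> B * (B ^ k / fact k)"
        using B by (simp del: fact_Suc)
    qed
    also have "\<dots> = B * (\<Sum>k\<le>N. B ^ k / fact k)" by (simp add: sum_distrib_left atLeast0AtMost)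
    also have "\<dots> \<le> B * exp B" using B by (intro mult_left_mono exp_partial_sum_le)
    finally show ?thesis .
  qed (use B in auto)
  finally show ?thesis .
qed

section \<open>Evaluation of a formal exponential at a real number\<close>

lemma fps_power_nonneg_sums:
  fixes t :: "real fps"
  assumes "\<And>m. fps_nth t m \<ge> 0" "summable (fps_nth t)"
  shows "fps_nth (t ^ k) m \<ge> 0 \<and> fps_nth (t ^ k) sums (suminf (fps_nth t) ^ k)"
proof (induction k arbitrary: m)
  case 0
  have "(\<lambda>m. if m = 0 then 1 else (0 :: real)) sums 1" using sums_single[of 0 "\<lambda>_. 1 :: real"] by simp
  thus ?case by (auto simp: fps_one_def cong: if_cong)
next
  case (Suc k)
  have "(\<lambda>m. \<Sum>i\<le>m. fps_nth t i * fps_nth (t ^ k) (m - i)) sums ((\<Sum>m. fps_nth t m) * (\<Sum>m. fps_nth (t ^ k) m))"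
    using Suc assms by (intro Cauchy_product_sums) (auto simp: sums_iff)
  moreover have "(\<Sum>m. fps_nth (t ^ k) m) = suminf (fps_nth t) ^ k" using Suc by (auto simp: sums_iff)
  moreover have "fps_nth (t ^ Suc k) = (\<lambda>m. \<Sum>i\<le>m. fps_nth t i * fps_nth (t ^ k) (m - i))"
    by (auto simp: fps_mult_nth atLeast0AtMost)
  ultimately show ?case using Suc assms by (auto intro!: sum_nonneg)
qed

lemma abs_fps_power_le:
  fixes s :: "real fps"
  shows "\<bar>fps_nth (s ^ k) m\<bar> \<le> fps_nth (Abs_fps (\<lambda>m. \<bar>fps_nth s m\<bar>) ^ k) m"
proof (induction k arbitrary: m)
  case (Suc k)
  show ?case unfolding power_Suc fps_mult_nth
    by (rule order_trans[OF sum_abs]) (auto intro!: sum_mono mult_mono Suc simp: abs_mult)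
qed auto

lemma fps_power_sums:
  fixes s :: "real fps"
  assumes "summable (\<lambda>m. \<bar>fps_nth s m\<bar>)"
  shows "summable (\<lambda>m. \<bar>fps_nth (s ^ k) m\<bar>)" "fps_nth (s ^ k) sums (suminf (fps_nth s) ^ k)"
proof -
  define t where "t = Abs_fps (\<lambda>m. \<bar>fps_nth s m\<bar>)"
  have tnth: "fps_nth t = (\<lambda>m. \<bar>fps_nth s m\<bar>)" by (simp add: t_def fun_eq_iff)
  have t_nonneg: "fps_nth t m \<ge> 0" for m by (simp add: t_def)
  have t: "summable (fps_nth (t ^ k))" for k
    using fps_power_nonneg_sums[of t k] assms by (auto simp: tnth t_nonneg sums_iff)
  show abs: "summable (\<lambda>m. \<bar>fps_nth (s ^ k) m\<bar>)" for k
    by (rule summable_comparison_test'[OF t[of k], of 0]) (auto simp: t_def abs_fps_power_le)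
  show "fps_nth (s ^ k) sums (suminf (fps_nth s) ^ k)"
  proof (induction k)
    case 0
    have "(\<lambda>m. if m = 0 then 1 else (0 :: real)) sums 1" using sums_single[of 0 "\<lambda>_. 1 :: real"] by simp
    thus ?case by (auto simp: fps_one_def cong: if_cong)
  next
    case (Suc k)
    have "(\<lambda>m. \<Sum>i\<le>m. fps_nth s i * fps_nth (s ^ k) (m - i)) sums ((\<Sum>m. fps_nth s m) * (\<Sum>m. fps_nth (s ^ k) m))"
      using abs[of k] assms by (intro Cauchy_product_sums) auto
    moreover have "(\<Sum>m. fps_nth (s ^ k) m) = suminf (fps_nth s) ^ k" using Suc by (auto simp: sums_iff)
    moreover have "fps_nth (s ^ Suc k) = (\<lambda>m. \<Sum>i\<le>m. fps_nth s i * fps_nth (s ^ k) (m - i))"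
      by (auto simp: fps_mult_nth atLeast0AtMost)
    ultimately show ?case by simp
  qed
qed

text \<open>A double sum over \<open>(k, m)\<close>: summing over \<open>m\<close> first leaves the
  exponential series, while for fixed \<open>m\<close> the sum over \<open>k\<close> is finite
  because \<open>s^k\<close> starts at order \<open>k\<close>. The exchange is justified by the
  series of absolute values, whose powers majorize those of \<open>s\<close>.\<close>

lemma fps_exp_compose_sums:
  fixes s :: "real fps"
  assumes s0: "fps_nth s 0 = 0" and "summable (\<lambda>m. \<bar>fps_nth s m\<bar>)"
  shows "(\<lambda>m. \<Sum>k\<le>m. fps_nth (s ^ k) m / fact k) sums exp (suminf (fps_nth s))"
proof -
  define t where "t = Abs_fps (\<lambda>m. \<bar>fps_nth s m\<bar>)"
  define S T where "S = suminf (fps_nth s)" and "T = suminf (fps_nth t)"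
  define g where "g = (\<lambda>(k,m). fps_nth (s ^ k) m / fact k)"
  have tnth: "fps_nth t = (\<lambda>m. \<bar>fps_nth s m\<bar>)" by (simp add: t_def fun_eq_iff)
  have t: "fps_nth (t ^ k) m \<ge> 0" "fps_nth (t ^ k) sums (T ^ k)" for k m
    using fps_power_nonneg_sums[of t k] assms by (auto simp: tnth T_def)
  have s_hs: "((\<lambda>m. g (k, m)) has_sum (S ^ k / fact k)) UNIV" for k
  proof -
    have "((\<lambda>m. fps_nth (s ^ k) m) has_sum (S ^ k)) UNIV"
      using fps_power_sums[OF assms(2), of k] by (intro norm_summable_imp_has_sum) (auto simp: S_def)
    from has_sum_cmult_left[OF this, of "1 / fact k"] show ?thesis by (simp add: g_def)
  qed
  have t_hs: "((\<lambda>m. fps_nth (t ^ k) m / fact k) has_sum (T ^ k / fact k)) UNIV" for k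
  proof -
    have "((\<lambda>m. fps_nth (t ^ k) m) has_sum (T ^ k)) UNIV"
      using t[of k] by (intro norm_summable_imp_has_sum) (auto simp: sums_iff)
    from has_sum_cmult_left[OF this, of "1 / fact k"] show ?thesis by simp
  qed
  have exp_hs: "((\<lambda>k. x ^ k / fact k) has_sum exp x) UNIV" for x :: real
  proof -
    have "(\<lambda>k. x ^ k /\<^sub>R fact k) sums exp x" "summable (\<lambda>k. norm (x ^ k /\<^sub>R fact k))"
      by (rule exp_converges, rule summable_norm_exp)
    thus ?thesis by (intro norm_summable_imp_has_sum) (auto simp: field_simps)
  qed
  define tg where "tg = (\<lambda>(k,m). fps_nth (t ^ k) m / fact k)"
  have summ: "tg summable_on UNIV \<times> UNIV"
  proof (rule summable_on_SigmaI)
    show "((\<lambda>m. tg (k, m)) has_sum T ^ k / fact k) UNIV" for k using t_hs[of k] by (simp add: tg_def)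
    show "(\<lambda>k. T ^ k / fact k) summable_on UNIV" using exp_hs[of T] by (rule has_sum_imp_summable)
  qed (auto simp: tg_def t(1))
  have "(\<lambda>x. norm (g x)) summable_on UNIV \<times> UNIV"
    by (rule summable_on_comparison_test[OF summ])
       (auto simp: g_def tg_def t_def abs_fps_power_le divide_right_mono)
  hence g_summ: "g summable_on UNIV \<times> UNIV" by (rule abs_summable_summable)
  have "infsum g (UNIV \<times> UNIV) = exp S"
  proof -
    have "(g has_sum infsum g (UNIV \<times> UNIV)) (Sigma UNIV (\<lambda>_. UNIV))" using g_summ by (simp add: has_sum_infsum)
    from has_sum_SigmaD[OF this s_hs] have "((\<lambda>k. S ^ k / fact k) has_sum infsum g (UNIV \<times> UNIV)) UNIV" .
    thus ?thesis using exp_hs[of S] by (metis has_sum_unique)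
  qed
  hence "(g has_sum exp S) (UNIV \<times> UNIV)" using g_summ by (metis has_sum_infsum)
  hence 1: "((\<lambda>(m,k). g (k, m)) has_sum exp S) (UNIV \<times> UNIV)"
    by (subst (asm) has_sum_swap) (simp add: case_prod_unfold prod.swap_def)
  have 2: "((\<lambda>k. (\<lambda>(m,k). g (k, m)) (m, k)) has_sum (\<Sum>k\<le>m. fps_nth (s ^ k) m / fact k)) UNIV" for m
  proof -
    have "((\<lambda>k. fps_nth (s ^ k) m / fact k) has_sum (\<Sum>k\<le>m. fps_nth (s ^ k) m / fact k)) {..m}"
      by (rule has_sum_finite) auto
    also have "?this \<longleftrightarrow> ((\<lambda>k. fps_nth (s ^ k) m / fact k) has_sum (\<Sum>k\<le>m. fps_nth (s ^ k) m / fact k)) UNIV"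
      using startsby_zero_power_prefix[OF s0] by (intro has_sum_cong_neutral) auto
    finally show ?thesis by (simp add: g_def)
  qed
  have "((\<lambda>m. \<Sum>k\<le>m. fps_nth (s ^ k) m / fact k) has_sum exp S) UNIV"
    by (rule has_sum_SigmaD[OF 1]) (rule 2)
  thus ?thesis unfolding S_def by (rule has_sum_imp_sums)
qed

lemma poly_fps_exp_sums:
  assumes f0: "fps_nth f 0 = 0" and summ: "summable (\<lambda>m. \<bar>poly (fps_nth f m) z\<bar>)"
  shows "(\<lambda>m. poly (fps_nth (poly_fps_exp f) m) z) sums exp (\<Sum>m. poly (fps_nth f m) z)"
proof -
  define s where "s = Abs_fps (\<lambda>m. poly (fps_nth f m) z)"
  have snth: "fps_nth s = (\<lambda>m. poly (fps_nth f m) z)" by (simp add: s_def fun_eq_iff)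
  have pow: "fps_nth (s ^ k) m = poly (fps_nth (f ^ k) m) z" for k m
  proof (induction k arbitrary: m)
    case (Suc k)
    thus ?case by (simp add: fps_mult_nth poly_sum s_def)
  qed auto
  have "(\<lambda>m. \<Sum>k\<le>m. fps_nth (s ^ k) m / fact k) sums exp (suminf (fps_nth s))"
    using assms by (intro fps_exp_compose_sums) (auto simp: snth)
  thus ?thesis by (simp add: pow poly_fps_exp_def poly_sum snth)
qed

text \<open>Each coefficient is determined by the earlier ones up to the factor
  \<open>Suc m\<close>, which cancels in a domain of characteristic zero.\<close>

lemma fps_ode_unique:
  fixes A B D :: "real poly fps"
  assumes "fps_deriv A = D * A" "fps_deriv B = D * B" "fps_nth A 0 = fps_nth B 0"
  shows "A = B"
proof (rule fps_ext)
  fix n show "fps_nth A n = fps_nth B n"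
  proof (induction n rule: less_induct)
    case (less n)
    show ?case
    proof (cases n)
      case 0 thus ?thesis using assms by simp
    next
      case (Suc m)
      have "of_nat (Suc m) * fps_nth A (Suc m) = fps_nth (fps_deriv A) m" by simp
      also have "\<dots> = (\<Sum>i=0..m. fps_nth D i * fps_nth A (m - i))" by (simp add: assms fps_mult_nth)
      also have "\<dots> = (\<Sum>i=0..m. fps_nth D i * fps_nth B (m - i))"
        using less Suc by (intro sum.cong) auto
      also have "\<dots> = fps_nth (fps_deriv B) m" by (simp add: assms fps_mult_nth)
      also have "\<dots> = of_nat (Suc m) * fps_nth B (Suc m)" by simp
      finally show ?thesis unfolding Suc mult_cancel_left by (simp del: of_nat_Suc)
    qed
  qed
qed

subsection \<open>Euler products over a graded set of primes\<close>

text \<open>The analysis sees irreducible polynomials only through their degrees. The crude count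
  \<open>q^d\<close> suffices because only prime powers with exponent at least \<open>2\<close>
  contribute to \<open>log H\<close>, and \<open>q^d / q^(2 d)\<close> is summable.\<close>

locale prime_system =
  fixes \<P> :: "'p set" and dg :: "'p \<Rightarrow> nat" and q :: nat
  assumes dg_pos: "P \<in> \<P> \<Longrightarrow> dg P \<ge> 1"
    and finite_dg: "finite {P \<in> \<P>. dg P = d}"
    and card_dg: "card {P \<in> \<P>. dg P = d} \<le> q ^ d"
    and q_ge_2: "q \<ge> 2"
begin

definition prime_powers_deg :: "nat \<Rightarrow> ('p \<times> nat) set" where
  "prime_powers_deg l = {(P, j). P \<in> \<P> \<and> 1 \<le> j \<and> j * dg P = l}"

lemma finite_dg_le: "finite {P \<in> \<P>. dg P \<le> N}"
proof -
  have "{P \<in> \<P>. dg P \<le> N} = (\<Union>d\<le>N. {P \<in> \<P>. dg P = d})" by auto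
  thus ?thesis using finite_dg by simp
qed

lemma prime_powers_deg_subset: "prime_powers_deg l \<subseteq> {P \<in> \<P>. dg P \<le> l} \<times> {1..l}"
proof -
  have "dg P \<le> l \<and> j \<le> l" if "P \<in> \<P>" "1 \<le> j" "j * dg P = l" for P j
    using that dg_pos[of P] mult_le_mono1[of 1 j "dg P"] mult_le_mono2[of 1 "dg P" j] by auto
  thus ?thesis by (auto simp: prime_powers_deg_def)
qed

lemma finite_prime_powers_deg: "finite (prime_powers_deg l)"
  by (rule finite_subset[OF prime_powers_deg_subset]) (auto simp: finite_dg_le)

lemma prime_powers_deg_0: "prime_powers_deg 0 = {}"
  using dg_pos by (fastforce simp: prime_powers_deg_def)

text \<open>The coefficients of \<open>log H\<close>; the terms with \<open>j = 1\<close> vanish.\<close>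

definition log_coeff :: "nat \<Rightarrow> real poly" where
  "log_coeff l = (\<Sum>(P, j)\<in>prime_powers_deg l.
     Polynomial.smult (1 / (real j * real q ^ l)) (Polynomial.monom 1 j - Polynomial.monom 1 1))"

definition log_fps :: "real poly fps" where "log_fps = Abs_fps log_coeff"

definition euler_fps :: "real poly fps" where "euler_fps = poly_fps_exp log_fps"

lemma log_fps_nth_0: "fps_nth log_fps 0 = 0"
  by (simp add: log_fps_def log_coeff_def prime_powers_deg_0)

lemma geometric_tail_le:
  fixes x :: real
  assumes "0 \<le> x" "x < 1"
  shows "(\<Sum>j\<in>{2..M}. x ^ j) \<le> x\<^sup>2 / (1 - x)"
proof (cases "M \<ge> 2")
  case True
  have "(\<Sum>j\<in>{2..M}. x ^ j) = (x\<^sup>2 - x ^ Suc M) / (1 - x)"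
    using assms True by (subst sum_gp) auto
  also have "\<dots> \<le> x\<^sup>2 / (1 - x)" using assms by (intro divide_right_mono) auto
  finally show ?thesis .
qed (use assms in auto)

text \<open>\<open>\<rho> u \<le> q (1 - c)\<close> keeps the ratio \<open>\<rho> (u / q)^d\<close>
  below \<open>1 - c\<close>, so for each prime the sum over \<open>j\<close> is comparable to its
  first term \<open>j = 2\<close>. With at most \<open>q^d\<close> primes of degree
  \<open>d\<close>, a geometric series of ratio \<open>u^2 / q\<close> remains.\<close>

lemma sum_powers_le:
  fixes \<rho> u c :: real
  assumes \<rho>: "\<rho> \<ge> 0" and u: "1 \<le> u" "u \<le> 5/4" and c: "0 < c" "c \<le> 1/4"
    and \<rho>u: "\<rho> * u \<le> real q * (1 - c)"
  shows "(\<Sum>(P,j)\<in>{P \<in> \<P>. dg P \<le> M} \<times> {2..M}. (\<rho> ^ j + \<rho>) * (u / real q) ^ (j * dg P)) \<le> 8 / c * (\<rho>\<^sup>2 + \<rho>) / real q"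
proof -
  define x where "x = u\<^sup>2 / real q"
  have "u\<^sup>2 \<le> (5/4)\<^sup>2" using u by (intro power_mono) auto
  hence u2: "u\<^sup>2 \<le> 25/16" by (simp add: power2_eq_square)
  have q2: "real q \<ge> 2" using q_ge_2 by simp
  have x: "0 \<le> x" "x \<le> 25/32" "x \<le> 25/16 / real q"
    unfolding x_def using u2 q2 frac_le[of "25/16" "u\<^sup>2" 2 "real q"] divide_right_mono[OF u2, of "real q"] by simp_all
  have uq: "u / real q \<le> 5/8" "u / real q \<ge> 0" using u q2 frac_le[of "5/4" u 2 "real q"] by auto
  have inner: "(\<Sum>j\<in>{2..M}. (\<rho> ^ j + \<rho>) * (u / real q) ^ (j * d)) \<le> (\<rho>\<^sup>2 + \<rho>) / c * ((u / real q) ^ d)\<^sup>2"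
    if d: "d \<ge> 1" for d
  proof -
    define y where "y = (u / real q) ^ d"
    have "y \<le> (u / real q) ^ 1" unfolding y_def using uq d by (intro power_decreasing) linarith+
    hence y: "0 \<le> y" "y \<le> u / real q" "y \<le> 5/8"
      using uq order_trans[of y "u / real q" "5/8"] unfolding y_def by simp_all
    have "\<rho> * y \<le> \<rho> * (u / real q)" using y \<rho> by (intro mult_left_mono) auto
    also have "\<dots> \<le> 1 - c" using \<rho>u q2 by (simp add: divide_le_eq mult.commute)
    finally have \<rho>y: "\<rho> * y \<le> 1 - c" "0 \<le> \<rho> * y" using \<rho> y by auto
    have "(\<Sum>j\<in>{2..M}. (\<rho> ^ j + \<rho>) * (u / real q) ^ (j * d)) =
        (\<Sum>j\<in>{2..M}. (\<rho> * y) ^ j) + \<rho> * (\<Sum>j\<in>{2..M}. y ^ j)"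
      by (simp add: y_def sum_distrib_left sum.distrib power_mult_distrib distrib_right
               flip: power_mult) (simp add: mult.commute)
    also have "\<dots> \<le> (\<rho> * y)\<^sup>2 / (1 - \<rho> * y) + \<rho> * (y\<^sup>2 / (1 - y))"
      using \<rho>y y \<rho> c by (intro add_mono mult_left_mono geometric_tail_le) auto
    \<comment> \<open>Both denominators are at least \<open>c\<close>: the first by the hypothesis
      on \<open>\<rho> u\<close>, the second because \<open>1 - y \<ge> 3/8\<close> and
      \<open>c \<le> 1/4\<close>.\<close>
    also have "\<dots> \<le> (\<rho> * y)\<^sup>2 / c + \<rho> * (y\<^sup>2 / c)"
      using \<rho>y y \<rho> c by (intro add_mono mult_left_mono divide_left_mono) (auto intro!: mult_pos_pos)
    also have "\<dots> = (\<rho>\<^sup>2 + \<rho>) / c * y\<^sup>2" by (simp add: power_mult_distrib add_divide_distrib distrib_right)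
    finally show ?thesis by (simp add: y_def)
  qed
  have "(\<Sum>(P,j)\<in>{P \<in> \<P>. dg P \<le> M} \<times> {2..M}. (\<rho> ^ j + \<rho>) * (u / real q) ^ (j * dg P)) =
      (\<Sum>P\<in>{P \<in> \<P>. dg P \<le> M}. \<Sum>j\<in>{2..M}. (\<rho> ^ j + \<rho>) * (u / real q) ^ (j * dg P))"
    by (rule sum.cartesian_product[symmetric])
  also have "\<dots> \<le> (\<Sum>P\<in>{P \<in> \<P>. dg P \<le> M}. (\<rho>\<^sup>2 + \<rho>) / c * ((u / real q) ^ dg P)\<^sup>2)"
    using dg_pos by (intro sum_mono inner) auto
  also have "\<dots> = (\<Sum>d\<in>{1..M}. \<Sum>P\<in>{P \<in> {P \<in> \<P>. dg P \<le> M}. dg P = d}. (\<rho>\<^sup>2 + \<rho>) / c * ((u / real q) ^ dg P)\<^sup>2)"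
    using dg_pos by (intro sum.group[symmetric] finite_dg_le) auto
  also have "\<dots> = (\<Sum>d\<in>{1..M}. real (card {P \<in> \<P>. dg P = d}) * ((\<rho>\<^sup>2 + \<rho>) / c * ((u / real q) ^ d)\<^sup>2))"
  proof (intro sum.cong refl)
    fix d assume "d \<in> {1..M}"
    hence "{P \<in> {P \<in> \<P>. dg P \<le> M}. dg P = d} = {P \<in> \<P>. dg P = d}" by auto
    thus "(\<Sum>P\<in>{P \<in> {P \<in> \<P>. dg P \<le> M}. dg P = d}. (\<rho>\<^sup>2 + \<rho>) / c * ((u / real q) ^ dg P)\<^sup>2) =
       real (card {P \<in> \<P>. dg P = d}) * ((\<rho>\<^sup>2 + \<rho>) / c * ((u / real q) ^ d)\<^sup>2)" by simp
  qed
  also have "\<dots> \<le> (\<Sum>d\<in>{1..M}. real q ^ d * ((\<rho>\<^sup>2 + \<rho>) / c * ((u / real q) ^ d)\<^sup>2))"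
  proof (intro sum_mono mult_right_mono)
    fix d show "real (card {P \<in> \<P>. dg P = d}) \<le> real q ^ d"
      using card_dg[of d] by (metis of_nat_le_iff of_nat_power)
  qed (use \<rho> c in auto)
  also have "\<dots> = (\<rho>\<^sup>2 + \<rho>) / c * (\<Sum>d\<in>{1..M}. x ^ d)"
  proof -
    have "real q ^ d * ((u / real q) ^ d)\<^sup>2 = x ^ d" for d
    proof -
      have "real q ^ d * ((u / real q) ^ d)\<^sup>2 = (real q * (u / real q)\<^sup>2) ^ d"
      proof -
        have "((u / real q) ^ d)\<^sup>2 = ((u / real q)\<^sup>2) ^ d" by (simp only: power_mult[symmetric] mult.commute)
        thus ?thesis by (simp only: power_mult_distrib)
      qed
      also have "real q * (u / real q)\<^sup>2 = x" using q2 by (simp add: x_def power2_eq_square)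
      finally show ?thesis .
    qed
    hence "real q ^ d * ((\<rho>\<^sup>2 + \<rho>) / c * ((u / real q) ^ d)\<^sup>2) = (\<rho>\<^sup>2 + \<rho>) / c * x ^ d" for d
      by (metis mult.left_commute)
    thus ?thesis by (simp only: sum_distrib_left)
  qed
  also have "\<dots> \<le> (\<rho>\<^sup>2 + \<rho>) / c * (8 / real q)"
  proof (intro mult_left_mono)
    have "(\<Sum>d\<in>{1..M}. x ^ d) = x * (\<Sum>d<M. x ^ d)"
      by (simp add: sum_distrib_left sum.atLeast1_atMost_eq)
    also have "(\<Sum>d<M. x ^ d) = (1 - x ^ M) / (1 - x)" using x by (simp add: sum_gp_strict)
    \<comment> \<open>The ratio is at most \<open>25/32\<close>, from \<open>u \<le> 5/4\<close> and
      \<open>q \<ge> 2\<close>; the resulting product of \<open>25/16\<close> and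
      \<open>32/7\<close>, which is \<open>50/7\<close>, is rounded up to \<open>8\<close>.\<close>
    also have "\<dots> \<le> 1 / (1 - 25/32)" using x by (intro frac_le) auto
    also have "x * (1 / (1 - 25/32)) \<le> (25/16 / real q) * (1 / (1 - 25/32))"
      using x by (intro mult_right_mono) auto
    also have "\<dots> \<le> 8 / real q" using q2 by (simp add: field_simps)
    finally show "(\<Sum>d\<in>{1..M}. x ^ d) \<le> 8 / real q" using x by (simp add: mult_left_mono)
  qed (use \<rho> c in auto)
  finally show ?thesis by (simp add: mult_ac)
qed

text \<open>The prime powers of degree at most \<open>M\<close> with exponent at least
  \<open>2\<close> lie in the rectangle treated by \<open>sum_powers_le\<close>. A term loses its
  \<open>1 / j\<close>, and its two monomials are bounded separately by \<open>\<rho>^j\<close> and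
  \<open>\<rho>\<close>.\<close>

lemma log_fps_norm_le:
  fixes \<rho> u c :: real
  assumes \<rho>: "\<rho> \<ge> 0" and u: "1 \<le> u" "u \<le> 5/4" and c: "0 < c" "c \<le> 1/4"
    and \<rho>u: "\<rho> * u \<le> real q * (1 - c)"
  shows "trunc_norm (poly_norm1 \<rho> J) u M log_fps \<le> 8 / c * (\<rho>\<^sup>2 + \<rho>) / real q"
proof -
  interpret pn: ring_seminorm "poly_norm1 \<rho> J" by (rule poly_norm1_seminorm) fact
  define w where "w = (\<lambda>(P :: 'p, j :: nat). (\<rho> ^ j + \<rho>) * (u / real q) ^ (j * dg P))"
  have w0: "w x \<ge> 0" for x using \<rho> u by (auto simp: w_def split: prod.splits)
  have "trunc_norm (poly_norm1 \<rho> J) u M log_fps \<le>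
     (\<Sum>l\<le>M. \<Sum>x\<in>{x \<in> {P \<in> \<P>. dg P \<le> M} \<times> {2..M}. snd x * dg (fst x) = l}. w x)"
    unfolding trunc_norm_def
  proof (intro sum_mono)
    fix l assume l: "l \<in> {..M}"
    define g where "g = (\<lambda>(P :: 'p, j).
        Polynomial.smult (1 / (real j * real q ^ l)) (Polynomial.monom 1 j - Polynomial.monom 1 1 :: real poly))"
    define R where "R = {x \<in> {P \<in> \<P>. dg P \<le> M} \<times> {2..M}. snd x * dg (fst x) = l}"
    have R: "R \<subseteq> prime_powers_deg l" by (auto simp: R_def prime_powers_deg_def)
    have "log_coeff l = (\<Sum>x\<in>R. g x)"
      unfolding log_coeff_def g_def
    proof (intro sum.mono_neutral_right R finite_prime_powers_deg ballI)
      fix x assume x: "x \<in> prime_powers_deg l - R"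
      obtain P j where [simp]: "x = (P, j)" by (cases x)
      have "dg P \<le> l \<and> j \<le> l" using x prime_powers_deg_subset[of l] by auto
      hence "\<not> 2 \<le> j" using x l by (auto simp: R_def prime_powers_deg_def)
      moreover have "j \<ge> 1" using x by (auto simp: prime_powers_deg_def)
      ultimately have "j = 1" by simp
      thus "(case x of (P, j) \<Rightarrow> Polynomial.smult (1 / (real j * real q ^ l)) (Polynomial.monom 1 j - Polynomial.monom 1 1)) = (0 :: real poly)"
        by simp
    qed
    hence "poly_norm1 \<rho> J (fps_nth log_fps l) * u ^ l \<le> (\<Sum>x\<in>R. poly_norm1 \<rho> J (g x)) * u ^ l"
      using u by (auto simp: log_fps_def intro!: mult_right_mono pn.sum_le)
    also have "\<dots> = (\<Sum>x\<in>R. poly_norm1 \<rho> J (g x) * u ^ l)" by (simp add: sum_distrib_right)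
    also have "\<dots> \<le> (\<Sum>x\<in>R. w x)"
    proof (intro sum_mono)
      fix x assume x: "x \<in> R"
      obtain P j where [simp]: "x = (P, j)" by (cases x)
      have j: "j \<ge> 2" and l_eq: "l = j * dg P" using x by (auto simp: R_def)
      have "poly_norm1 \<rho> J (Polynomial.monom 1 j - Polynomial.monom 1 1) \<le>
         poly_norm1 \<rho> J (Polynomial.monom 1 j) + poly_norm1 \<rho> J (Polynomial.smult (-1) (Polynomial.monom 1 1))"
        using pn.add[of "Polynomial.monom 1 j" "Polynomial.smult (-1) (Polynomial.monom 1 1)"] by simp
      also have "\<dots> \<le> \<rho> ^ j + \<rho>"
        unfolding poly_norm1_smult using \<rho> poly_norm1_monom_le[of \<rho> J j] poly_norm1_monom_le[of \<rho> J 1] by simp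
      finally have *: "poly_norm1 \<rho> J (Polynomial.monom 1 j - Polynomial.monom 1 1) \<le> \<rho> ^ j + \<rho>" .
      have "poly_norm1 \<rho> J (g x) = 1 / (real j * real q ^ l) * poly_norm1 \<rho> J (Polynomial.monom 1 j - Polynomial.monom 1 1)"
        by (simp add: g_def poly_norm1_smult)
      also have "\<dots> \<le> 1 / real q ^ l * (\<rho> ^ j + \<rho>)"
      proof (intro mult_mono *)
        have "1 * real q ^ l \<le> real j * real q ^ l" using j by (intro mult_right_mono) auto
        thus "1 / (real j * real q ^ l) \<le> 1 / real q ^ l"
          using q_ge_2 j by (intro divide_left_mono) auto
      qed (auto simp: pn.nonneg)
      finally have "poly_norm1 \<rho> J (g x) * u ^ l \<le> 1 / real q ^ l * (\<rho> ^ j + \<rho>) * u ^ l"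
        using u by (intro mult_right_mono) auto
      thus "poly_norm1 \<rho> J (g x) * u ^ l \<le> w x" by (simp add: w_def l_eq power_divide mult_ac)
    qed
    finally show "poly_norm1 \<rho> J (fps_nth log_fps l) * u ^ l \<le>
      (\<Sum>x\<in>{x \<in> {P \<in> \<P>. dg P \<le> M} \<times> {2..M}. snd x * dg (fst x) = l}. w x)" by (simp add: R_def)
  qed
  also have "\<dots> = (\<Sum>x\<in>{x \<in> {P \<in> \<P>. dg P \<le> M} \<times> {2..M}. snd x * dg (fst x) \<le> M}. w x)"
  proof -
    define V where "V = {x \<in> {P \<in> \<P>. dg P \<le> M} \<times> {2..M}. snd x * dg (fst x) \<le> M}"
    have "finite V" unfolding V_def by (rule finite_subset[of _ "{P \<in> \<P>. dg P \<le> M} \<times> {2..M}"]) (auto simp: finite_dg_le)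
    hence "(\<Sum>l\<le>M. \<Sum>x\<in>{x \<in> V. snd x * dg (fst x) = l}. w x) = (\<Sum>x\<in>V. w x)"
      by (intro sum.group) (auto simp: V_def)
    also have "(\<Sum>l\<le>M. \<Sum>x\<in>{x \<in> V. snd x * dg (fst x) = l}. w x) =
        (\<Sum>l\<le>M. \<Sum>x\<in>{x \<in> {P \<in> \<P>. dg P \<le> M} \<times> {2..M}. snd x * dg (fst x) = l}. w x)"
      by (intro sum.cong) (auto simp: V_def)
    finally show ?thesis by (simp add: V_def)
  qed
  also have "\<dots> \<le> (\<Sum>x\<in>{P \<in> \<P>. dg P \<le> M} \<times> {2..M}. w x)"
    by (intro sum_mono2) (auto simp: finite_dg_le w0)
  also have "\<dots> \<le> 8 / c * (\<rho>\<^sup>2 + \<rho>) / real q" unfolding w_def using assms by (rule sum_powers_le)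
  finally show ?thesis .
qed

lemma euler_fps_norm_le:
  fixes \<rho> u c :: real
  assumes \<rho>: "\<rho> \<ge> 0" and u: "1 \<le> u" "u \<le> 5/4" and c: "0 < c" "c \<le> 1/4"
    and \<rho>u: "\<rho> * u \<le> real q * (1 - c)"
  defines "B \<equiv> 8 / c * (\<rho>\<^sup>2 + \<rho>) / real q"
  shows "(\<Sum>m\<in>{1..M}. poly_norm1 \<rho> J (fps_nth euler_fps m) * u ^ m) \<le> B * exp B"
  unfolding euler_fps_def B_def using assms
  by (intro poly_fps_exp_norm_le log_fps_norm_le) auto

section \<open>Convergence of the Euler product\<close>

definition log_term :: "real \<Rightarrow> 'p \<times> nat \<Rightarrow> real" where
  "log_term z = (\<lambda>(P, j). (z ^ j - z) / (real j * real q ^ (j * dg P)))"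

text \<open>Every finite set of pairs lies in a rectangle, and \<open>sum_powers_le\<close> with
  \<open>u = 1\<close> bounds all rectangles uniformly.\<close>

lemma log_term_summable:
  assumes z: "0 \<le> z" "z < real q"
  shows "(\<lambda>x. norm (log_term z x)) summable_on (\<P> \<times> {2..})"
proof (rule nonneg_bdd_above_summable_on)
  \<comment> \<open>The relative distance from \<open>z\<close> to \<open>q\<close>, capped to meet
    the requirement \<open>c \<le> 1/4\<close> of \<open>sum_powers_le\<close>.\<close>
  define c where "c = min (1/4) (1 - z / real q)"
  have "c \<le> 1/4" unfolding c_def by (rule min.cobounded1)
  moreover have "c > 0" using z by (auto simp: c_def)
  ultimately have c: "0 < c" "c \<le> 1/4" by auto
  have zc: "z * 1 \<le> real q * (1 - c)"
  proof -
    have "z = real q * (z / real q)" using z by simp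
    also have "\<dots> \<le> real q * (1 - c)" by (intro mult_left_mono) (auto simp: c_def)
    finally show ?thesis by simp
  qed
  show "bdd_above (sum (\<lambda>x. norm (log_term z x)) ` {F. F \<subseteq> \<P> \<times> {2..} \<and> finite F})"
  proof (rule bdd_aboveI2)
    fix F :: "('p \<times> nat) set" assume "F \<in> {F. F \<subseteq> \<P> \<times> {2..} \<and> finite F}"
    hence F: "F \<subseteq> \<P> \<times> {2..}" "finite F" by auto
    define M where "M = Max ((\<lambda>x. snd x + dg (fst x)) ` F \<union> {0})"
    have M: "snd x + dg (fst x) \<le> M" if "x \<in> F" for x
      unfolding M_def using F that by (intro Max_ge) auto
    have "sum (\<lambda>x. norm (log_term z x)) F \<le> (\<Sum>(P,j)\<in>F. (z ^ j + z) * (1 / real q) ^ (j * dg P))"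
    proof (intro sum_mono)
      fix x assume "x \<in> F"
      then obtain P j where [simp]: "x = (P, j)" and j: "j \<ge> 2" using F by auto
      have "norm (log_term z x) = \<bar>z ^ j - z\<bar> / (real j * real q ^ (j * dg P))"
        by (simp add: log_term_def)
      also have "\<dots> \<le> (z ^ j + z) / (1 * real q ^ (j * dg P))"
        using j q_ge_2 z by (intro frac_le mult_right_mono) (auto simp: abs_le_iff)
      finally show "norm (log_term z x) \<le> (case x of (P, j) \<Rightarrow> (z ^ j + z) * (1 / real q) ^ (j * dg P))"
        by (simp add: power_divide)
    qed
    also have "\<dots> \<le> (\<Sum>(P,j)\<in>{P \<in> \<P>. dg P \<le> M} \<times> {2..M}. (z ^ j + z) * (1 / real q) ^ (j * dg P))"
    proof (intro sum_mono2)
      show "F \<subseteq> {P \<in> \<P>. dg P \<le> M} \<times> {2..M}" using F(1) M by force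
    qed (use z in \<open>auto simp: finite_dg_le\<close>)
    also have "\<dots> \<le> 8 / c * (z\<^sup>2 + z) / real q"
      using z c zc by (intro sum_powers_le) auto
    finally show "sum (\<lambda>x. norm (log_term z x)) F \<le> 8 / c * (z\<^sup>2 + z) / real q" .
  qed
qed auto

definition euler_factor :: "real \<Rightarrow> 'p \<Rightarrow> real" where
  "euler_factor z P = inverse (1 - z / real q ^ dg P) * (1 - 1 / real q ^ dg P) powr z"

text \<open>With \<open>y = 1 / |P|\<close> the logarithm is
  \<open>z ln (1 - y) - ln (1 - z y)\<close>, and the two Mercator series combine to terms
  \<open>(z^j - z) y^j / j\<close>.\<close>

lemma euler_factor_has_sum:
  assumes z: "0 \<le> z" "z < real q" and P: "P \<in> \<P>"
  shows "euler_factor z P > 0" "((\<lambda>j. log_term z (P, j)) has_sum ln (euler_factor z P)) {2..}"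
proof -
  define y where "y = 1 / real q ^ dg P"
  have qd: "real q ^ dg P \<ge> real q" using dg_pos[OF P] q_ge_2 power_increasing[of 1 "dg P" "real q"] by simp
  have "real q \<ge> 2" using q_ge_2 by simp
  hence "1 < real q ^ dg P" "z < real q ^ dg P" using qd z by linarith+
  hence y: "0 < y" "y < 1" "z * y < 1" unfolding y_def using q_ge_2 by (simp_all add: divide_less_eq)
  have fac: "euler_factor z P = inverse (1 - z * y) * (1 - y) powr z" by (simp add: euler_factor_def y_def)
  show "euler_factor z P > 0" using y by (simp add: fac)
  have lnf: "ln (euler_factor z P) = z * ln (1 - y) - ln (1 - z * y)"
    using y by (simp add: fac ln_mult ln_inverse ln_powr)
  have "(\<lambda>j. - ((- (- (z * y))) ^ j) / real j) sums ln (1 + (- (z * y)))"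
    using y z by (intro ln_series') auto
  moreover have "(\<lambda>j. z * (- ((- (- y)) ^ j) / real j)) sums (z * ln (1 + (- y)))"
    using y by (intro sums_mult ln_series') auto
  ultimately have "(\<lambda>j. z * (- ((- (- y)) ^ j) / real j) - (- ((- (- (z * y))) ^ j) / real j)) sums ln (euler_factor z P)"
    unfolding lnf by (intro sums_diff) auto
  moreover have "z * (- ((- (- y)) ^ j) / real j) - (- ((- (- (z * y))) ^ j) / real j) = log_term z (P, j)" for j
    by (cases "j = 0", simp add: log_term_def, auto simp: log_term_def y_def power_mult_distrib power_divide field_simps simp flip: power_mult,
        simp add: diff_divide_distrib)
  ultimately have s: "(\<lambda>j. log_term z (P, j)) sums ln (euler_factor z P)" by simp
  have "(\<lambda>x. norm (log_term z x)) summable_on (Pair P ` {2..})"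
    by (rule summable_on_subset_banach[OF log_term_summable[OF z]]) (use P in auto)
  hence "(\<lambda>j. norm (log_term z (P, j))) summable_on {2..}"
    by (subst (asm) summable_on_reindex) (auto simp: inj_on_def o_def)
  \<comment> \<open>The indices \<open>0\<close> and \<open>1\<close> contribute nothing: at
    \<open>j = 0\<close> the division by zero yields \<open>0\<close>, at \<open>j = 1\<close> the
    numerator \<open>z^j - z\<close> vanishes.\<close>
  hence "(\<lambda>j. norm (log_term z (P, j))) summable_on UNIV"
    by (rule summable_on_cong_neutral[THEN iffD1, rotated 3])
       (auto simp: log_term_def not_le less_2_cases_iff)
  hence "summable (\<lambda>j. norm (log_term z (P, j)))" by (rule summable_on_imp_summable)
  from norm_summable_imp_has_sum[OF this s]
  have "((\<lambda>j. log_term z (P, j)) has_sum ln (euler_factor z P)) UNIV" .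
  thus "((\<lambda>j. log_term z (P, j)) has_sum ln (euler_factor z P)) {2..}"
    by (rule has_sum_cong_neutral[THEN iffD1, rotated 3])
       (auto simp: log_term_def not_le less_2_cases_iff)
qed

lemma euler_product_tendsto:
  assumes z: "0 \<le> z" "z < real q"
  shows "((\<lambda>S. \<Prod>P\<in>S. euler_factor z P) \<longlongrightarrow> exp (infsum (log_term z) (\<P> \<times> {2..}))) (finite_subsets_at_top \<P>)"
proof -
  have "(log_term z has_sum infsum (log_term z) (\<P> \<times> {2..})) (Sigma \<P> (\<lambda>_. {2..}))"
    using abs_summable_summable[OF log_term_summable[OF z]] by (simp add: has_sum_infsum)
  hence "((\<lambda>P. ln (euler_factor z P)) has_sum infsum (log_term z) (\<P> \<times> {2..})) \<P>"
    by (rule has_sum_SigmaD) (use euler_factor_has_sum(2)[OF z] in auto)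
  hence "((\<lambda>S. exp (\<Sum>P\<in>S. ln (euler_factor z P))) \<longlongrightarrow> exp (infsum (log_term z) (\<P> \<times> {2..}))) (finite_subsets_at_top \<P>)"
    unfolding has_sum_def by (rule tendsto_exp)
  moreover have "\<forall>\<^sub>F S in finite_subsets_at_top \<P>. exp (\<Sum>P\<in>S. ln (euler_factor z P)) = (\<Prod>P\<in>S. euler_factor z P)"
  proof (rule eventually_finite_subsets_at_top_weakI)
    fix S assume "finite S" "S \<subseteq> \<P>"
    thus "exp (\<Sum>P\<in>S. ln (euler_factor z P)) = (\<Prod>P\<in>S. euler_factor z P)"
      using euler_factor_has_sum(1)[OF z] by (subst exp_sum) (auto intro!: prod.cong)
  qed
  ultimately show ?thesis by (rule Lim_transform_eventually)
qed

text \<open>The absolutely convergent family over \<open>(P, j)\<close> is regrouped by the degree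
  \<open>j deg P\<close>, each group being finite.\<close>

lemma log_coeff_sums:
  assumes z: "0 \<le> z" "z < real q"
  shows "summable (\<lambda>l. \<bar>poly (log_coeff l) z\<bar>)"
    "(\<lambda>l. poly (log_coeff l) z) sums infsum (log_term z) (\<P> \<times> {2..})"
proof -
  define W where "W = (\<lambda>l. {x \<in> \<P> \<times> {2..}. snd x * dg (fst x) = l})"
  have bij: "bij_betw snd (Sigma UNIV W) (\<P> \<times> {2..})"
    by (rule bij_betwI[of _ _ _ "\<lambda>x. (snd x * dg (fst x), x)"]) (auto simp: W_def)
  have W_sub: "W l \<subseteq> prime_powers_deg l" for l by (auto simp: W_def prime_powers_deg_def)
  have Wfin: "finite (W l)" for l using W_sub finite_prime_powers_deg finite_subset by blast
  have sumW: "(\<Sum>x\<in>W l. log_term z x) = poly (log_coeff l) z" for l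
  proof -
    have "poly (log_coeff l) z = (\<Sum>x\<in>prime_powers_deg l. log_term z x)"
      unfolding log_coeff_def poly_sum
      by (intro sum.cong refl) (auto simp: log_term_def poly_monom prime_powers_deg_def)
    also have "\<dots> = (\<Sum>x\<in>W l. log_term z x)"
    proof (intro sum.mono_neutral_right finite_prime_powers_deg W_sub ballI)
      fix x assume "x \<in> prime_powers_deg l - W l"
      then obtain P j where "x = (P, j)" "j = 1" by (cases x) (force simp: prime_powers_deg_def W_def)
      thus "log_term z x = 0" by (simp add: log_term_def)
    qed
    finally show ?thesis ..
  qed
  have "(log_term z has_sum infsum (log_term z) (\<P> \<times> {2..})) (\<P> \<times> {2..})"
    using abs_summable_summable[OF log_term_summable[OF z]] by (simp add: has_sum_infsum)
  hence "((\<lambda>x. log_term z (snd x)) has_sum infsum (log_term z) (\<P> \<times> {2..})) (Sigma UNIV W)"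
    by (subst has_sum_reindex_bij_betw[OF bij])
  hence "((\<lambda>l. poly (log_coeff l) z) has_sum infsum (log_term z) (\<P> \<times> {2..})) UNIV"
    by (rule has_sum_SigmaD) (auto simp: Wfin simp flip: sumW)
  thus "(\<lambda>l. poly (log_coeff l) z) sums infsum (log_term z) (\<P> \<times> {2..})" by (rule has_sum_imp_sums)
  have "(\<lambda>x. norm (log_term z (snd x))) summable_on (Sigma UNIV W)"
    using log_term_summable[OF z] by (subst summable_on_reindex_bij_betw[OF bij])
  hence "((\<lambda>x. norm (log_term z (snd x))) has_sum infsum (\<lambda>x. norm (log_term z (snd x))) (Sigma UNIV W)) (Sigma UNIV W)"
    by (rule has_sum_infsum)
  hence "((\<lambda>l. \<Sum>x\<in>W l. norm (log_term z x)) has_sum infsum (\<lambda>x. norm (log_term z (snd x))) (Sigma UNIV W)) UNIV"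
    by (rule has_sum_SigmaD) (auto simp: Wfin)
  hence "summable (\<lambda>l. \<Sum>x\<in>W l. norm (log_term z x))"
    using has_sum_imp_sums sums_summable by blast
  thus "summable (\<lambda>l. \<bar>poly (log_coeff l) z\<bar>)"
    by (rule summable_comparison_test'[where N = 0]) (auto simp flip: sumW intro!: sum_abs)
qed

lemma euler_fps_sums:
  assumes z: "0 \<le> z" "z < real q"
  shows "(\<lambda>m. poly (fps_nth euler_fps m) z) sums exp (infsum (log_term z) (\<P> \<times> {2..}))"
proof -
  have "(\<lambda>m. poly (fps_nth (poly_fps_exp log_fps) m) z) sums exp (\<Sum>m. poly (fps_nth log_fps m) z)"
    using log_coeff_sums(1)[OF z] by (intro poly_fps_exp_sums log_fps_nth_0) (simp add: log_fps_def)
  moreover have "(\<Sum>m. poly (fps_nth log_fps m) z) = infsum (log_term z) (\<P> \<times> {2..})"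
    using log_coeff_sums(2)[OF z] by (simp add: sums_iff log_fps_def)
  ultimately show ?thesis by (simp add: euler_fps_def)
qed

end

section \<open>Cycle polynomials and the factorization of the generating function\<close>

lemma poly_smult_sum:
  "Polynomial.smult c (\<Sum>i\<in>A. f i) = (\<Sum>i\<in>A. Polynomial.smult (c :: real) (f i))"
  by (induction A rule: infinite_finite_induct) (auto simp: smult_add_right)

text \<open>The coefficient of \<open>u^n\<close> in \<open>(1 - u)^(-z)\<close>, as a polynomial in
  \<open>z\<close>.\<close>

definition cycle_poly :: "nat \<Rightarrow> real poly" where
  "cycle_poly n = Polynomial.smult (1 / fact n) (pochhammer [:0, 1:] n)"

lemma coeff_cycle_poly: "Polynomial.coeff (cycle_poly n) k = cycle_prob n k"
proof -
  have "Polynomial.coeff (pochhammer [:0, 1:] n :: real poly) k =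
      (\<Sum>j\<le>n. Polynomial.coeff (of_nat (stirling n j) * [:0, 1:] ^ j) k)"
    unfolding stirling_pochhammer[symmetric] coeff_sum ..
  also have "\<dots> = (\<Sum>j\<le>n. if j = k then real (stirling n j) else 0)"
    by (intro sum.cong refl) (simp add: of_nat_poly flip: monom_altdef[of 1, simplified])
  also have "\<dots> = real (stirling n k)" by simp
  finally show ?thesis by (simp add: cycle_poly_def cycle_prob_def)
qed

lemma cycle_poly_Suc: "of_nat (Suc n) * cycle_poly (Suc n) = ([:0, 1:] + of_nat n) * cycle_poly n"
proof -
  have "of_nat (Suc n) * cycle_poly (Suc n) = Polynomial.smult (real (Suc n) * (1 / fact (Suc n))) (pochhammer [:0, 1:] (Suc n))"
    unfolding cycle_poly_def of_nat_poly by (simp del: of_nat_Suc fact_Suc)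
  also have "real (Suc n) * (1 / fact (Suc n)) = 1 / fact n" by (simp del: of_nat_Suc)
  finally show ?thesis by (simp add: cycle_poly_def pochhammer_Suc mult.commute)
qed

text \<open>Coefficient form of the differential equation \<open>G' = z / (1 - u) * G\<close> for
  \<open>G = (1 - u)^(-z)\<close>.\<close>

lemma cycle_poly_rec: "of_nat (Suc n) * cycle_poly (Suc n) = [:0, 1:] * (\<Sum>i\<le>n. cycle_poly (n - i))"
proof (induction n)
  case 0 show ?case using cycle_poly_Suc[of 0] by (simp del: of_nat_Suc)
next
  case (Suc n)
  have "of_nat (Suc (Suc n)) * cycle_poly (Suc (Suc n)) =
     [:0, 1:] * cycle_poly (Suc n) + of_nat (Suc n) * cycle_poly (Suc n)"
    by (simp only: cycle_poly_Suc[of "Suc n"] distrib_right)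
  also have "\<dots> = [:0, 1:] * (cycle_poly (Suc n) + (\<Sum>i\<le>n. cycle_poly (n - i)))"
    by (simp only: Suc distrib_left)
  also have "cycle_poly (Suc n) + (\<Sum>i\<le>n. cycle_poly (n - i)) = (\<Sum>i\<le>Suc n. cycle_poly (Suc n - i))"
    by (subst sum.atMost_Suc_shift) simp
  finally show ?case .
qed

lemma cycle_fps_poly_deriv:
  "fps_deriv (Abs_fps cycle_poly) = Abs_fps (\<lambda>_. [:0, 1:]) * Abs_fps cycle_poly"
proof (rule fps_ext)
  fix n
  have "fps_nth (fps_deriv (Abs_fps cycle_poly)) n = of_nat (Suc n) * cycle_poly (Suc n)"
    by simp
  also have "\<dots> = (\<Sum>i\<le>n. [:0, 1:] * cycle_poly (n - i))"
    unfolding cycle_poly_rec sum_distrib_left ..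
  also have "\<dots> = fps_nth (Abs_fps (\<lambda>_. [:0, 1:]) * Abs_fps cycle_poly) n"
    by (simp only: fps_mult_nth fps_nth_Abs_fps atLeast0AtMost)
  finally show "fps_nth (fps_deriv (Abs_fps cycle_poly)) n = fps_nth (Abs_fps (\<lambda>_. [:0, 1:]) * Abs_fps cycle_poly) n" .
qed

text \<open>\<open>T n\<close> stands for the sum of \<open>z^Omega(f)\<close> over monic
  \<open>f\<close> of degree \<open>n\<close>, and \<open>T_rec\<close> is, coefficient by
  coefficient, the logarithmic derivative of the product of all \<open>1 / (1 - z u^deg(P))\<close>.
  The recursion takes the place of an infinite product of formal series.\<close>

locale prime_system_gf = prime_system \<P> dg q for \<P> :: "'p set" and dg q +
  fixes T :: "nat \<Rightarrow> real poly"
  assumes T_0: "T 0 = 1"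
    and T_1: "poly (T n) 1 = real q ^ n"
    and T_rec: "of_nat n * T n =
      (\<Sum>l\<in>{1..n}. (\<Sum>(P, j)\<in>prime_powers_deg l. of_nat (dg P) * Polynomial.monom 1 j) * T (n - l))"
begin

text \<open>The prime polynomial theorem in the exact form \<open>\<Sum>\<^bsub>d dvd l\<^esub> d \<pi>(d) = q\<^sup>l\<close>.\<close>

lemma total_degree:
  assumes "l \<ge> 1"
  shows "(\<Sum>(P, j)\<in>prime_powers_deg l. real (dg P)) = real q ^ l"
  using assms
proof (induction l rule: less_induct)
  case (less n)
  define D where "D = (\<lambda>l. \<Sum>(P, j)\<in>prime_powers_deg l. real (dg P))"
  \<comment> \<open>At \<open>z = 1\<close> the recursion has \<open>n\<close> summands with total
    \<open>n q^n\<close>. By induction all but the last equal \<open>q^n\<close>, hence so does the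
    last.\<close>
  have "real n * real q ^ n = poly (of_nat n * T n) 1" by (simp add: T_1)
  also have "\<dots> = (\<Sum>l\<in>{1..n}. D l * real q ^ (n - l))"
    unfolding T_rec by (simp add: poly_sum T_1 D_def case_prod_unfold poly_monom)
  also have "{1..n} = insert n {1..<n}" using less.prems by auto
  also have "(\<Sum>l\<in>insert n {1..<n}. D l * real q ^ (n - l)) = D n + (\<Sum>l\<in>{1..<n}. D l * real q ^ (n - l))"
    by simp
  also have "(\<Sum>l\<in>{1..<n}. D l * real q ^ (n - l)) = (\<Sum>l\<in>{1..<n}. real q ^ n)"
  proof (intro sum.cong refl)
    fix l assume l: "l \<in> {1..<n}"
    hence "D l = real q ^ l" using less.IH by (simp add: D_def)
    thus "D l * real q ^ (n - l) = real q ^ n" using l by (simp flip: power_add)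
  qed
  finally show ?case using less.prems by (simp add: D_def of_nat_diff algebra_simps)
qed

definition deriv_coeff :: "nat \<Rightarrow> real poly" where
  "deriv_coeff l = Polynomial.smult (1 / real q ^ l)
     (\<Sum>(P, j)\<in>prime_powers_deg l. of_nat (dg P) * Polynomial.monom 1 j)"

text \<open>By \<open>total_degree\<close> the linear terms subtracted in \<open>log_coeff\<close>
  add up, after multiplication by \<open>l\<close>, to exactly \<open>z\<close>. Here the
  logarithmic derivative separates into the part of \<open>(1 - u)^(-z)\<close> and that of
  \<open>H\<close>.\<close>

lemma deriv_coeff_eq:
  assumes "l \<ge> 1"
  shows "deriv_coeff l = [:0, 1:] + of_nat l * log_coeff l"
proof -
  have "of_nat l * log_coeff l =
     (\<Sum>(P, j)\<in>prime_powers_deg l. Polynomial.smult (real (dg P) / real q ^ l) (Polynomial.monom 1 j - Polynomial.monom 1 1))"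
    unfolding log_coeff_def sum_distrib_left
    by (intro sum.cong refl) (auto simp: prime_powers_deg_def of_nat_poly)
  also have "\<dots> = deriv_coeff l - Polynomial.smult ((\<Sum>(P, j)\<in>prime_powers_deg l. real (dg P)) / real q ^ l) (Polynomial.monom 1 1)"
    unfolding deriv_coeff_def
    by (simp add: case_prod_unfold smult_diff_right sum_subtractf of_nat_poly smult_sum poly_smult_sum sum_divide_distrib)
  also have "\<dots> = deriv_coeff l - [:0, 1:]"
    using q_ge_2 by (simp add: total_degree[OF assms] monom_altdef)
  finally show ?thesis by simp
qed

text \<open>Both sides solve the linear differential equation with coefficient \<open>D\<close>, and
  both start with \<open>1\<close>.\<close>

lemma gf_factorization: "Abs_fps (\<lambda>n. Polynomial.smult (1 / real q ^ n) (T n)) = euler_fps * Abs_fps cycle_poly"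
proof (rule fps_ode_unique)
  define D where "D = Abs_fps (\<lambda>n. deriv_coeff (Suc n))"
  have D: "D = fps_deriv log_fps + Abs_fps (\<lambda>_. [:0, 1:])"
    by (rule fps_ext) (simp add: D_def deriv_coeff_eq log_fps_def)
  show "fps_deriv (euler_fps * Abs_fps cycle_poly) = D * (euler_fps * Abs_fps cycle_poly)"
    unfolding fps_deriv_mult cycle_fps_poly_deriv D euler_fps_def poly_fps_exp_deriv[OF log_fps_nth_0]
    by (simp add: algebra_simps)
  show "fps_deriv (Abs_fps (\<lambda>n. Polynomial.smult (1 / real q ^ n) (T n))) =
     D * Abs_fps (\<lambda>n. Polynomial.smult (1 / real q ^ n) (T n))"
  proof (rule fps_ext)
    fix n
    have "fps_nth (fps_deriv (Abs_fps (\<lambda>n. Polynomial.smult (1 / real q ^ n) (T n)))) n =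
        Polynomial.smult (1 / real q ^ Suc n) (of_nat (Suc n) * T (Suc n))"
      by (simp del: of_nat_Suc power_Suc)
    also have "of_nat (Suc n) * T (Suc n) =
       (\<Sum>i\<in>{0..n}. (\<Sum>(P, j)\<in>prime_powers_deg (Suc i). of_nat (dg P) * Polynomial.monom 1 j) * T (n - i))"
      unfolding T_rec by (rule sum.reindex_bij_witness[of _ Suc "\<lambda>l. l - 1"]) auto
    also have "Polynomial.smult (1 / real q ^ Suc n) \<dots> =
      (\<Sum>i\<in>{0..n}. deriv_coeff (Suc i) * Polynomial.smult (1 / real q ^ (n - i)) (T (n - i)))"
      unfolding poly_smult_sum
    proof (intro sum.cong refl)
      fix i assume "i \<in> {0..n}"
      hence e: "real q ^ Suc n = real q ^ Suc i * real q ^ (n - i)" by (simp flip: power_add)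
      show "Polynomial.smult (1 / real q ^ Suc n) ((\<Sum>(P, j)\<in>prime_powers_deg (Suc i). of_nat (dg P) * Polynomial.monom 1 j) * T (n - i)) =
        deriv_coeff (Suc i) * Polynomial.smult (1 / real q ^ (n - i)) (T (n - i))"
        unfolding e deriv_coeff_def by (simp add: mult.commute del: power_Suc)
    qed
    finally show "fps_nth (fps_deriv (Abs_fps (\<lambda>n. Polynomial.smult (1 / real q ^ n) (T n)))) n =
      fps_nth (D * Abs_fps (\<lambda>n. Polynomial.smult (1 / real q ^ n) (T n))) n"
      by (simp add: fps_mult_nth D_def)
  qed
  show "fps_nth (Abs_fps (\<lambda>n. Polynomial.smult (1 / real q ^ n) (T n))) 0 = fps_nth (euler_fps * Abs_fps cycle_poly) 0"
    by (simp add: T_0 euler_fps_def poly_fps_exp_nth_0 cycle_poly_def)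
qed

lemma coeff_T:
  "Polynomial.coeff (T n) k / real q ^ n =
     (\<Sum>m\<le>n. \<Sum>i\<le>k. Polynomial.coeff (fps_nth euler_fps m) i * cycle_prob (n - m) (k - i))"
proof -
  have "Polynomial.smult (1 / real q ^ n) (T n) = fps_nth (euler_fps * Abs_fps cycle_poly) n"
    unfolding gf_factorization[symmetric] by simp
  also have "\<dots> = (\<Sum>m\<le>n. fps_nth euler_fps m * cycle_poly (n - m))"
    by (simp add: fps_mult_nth atLeast0AtMost)
  finally have "Polynomial.coeff (Polynomial.smult (1 / real q ^ n) (T n)) k =
     Polynomial.coeff (\<Sum>m\<le>n. fps_nth euler_fps m * cycle_poly (n - m)) k" by simp
  thus ?thesis by (simp add: coeff_sum coeff_mult coeff_cycle_poly)
qed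

lemma coeff_T_estimate:
  fixes r \<delta> u Cu L :: real and n l :: nat
  assumes n: "n \<ge> 2" and L_def: "L = ln (real n)" and r: "r = real l / L"
    and \<delta>: "0 < \<delta>" "\<delta> < 1" and rq: "r \<le> real q * (1 - \<delta>)"
    and u: "u = 1 + \<delta> / 4" and Cu: "\<And>m. (real m)\<^sup>2 \<le> Cu * u ^ m"
  defines "\<rho> \<equiv> r + \<delta>"
  defines "K \<equiv> 8 * Cu / \<delta> * ((1 + r) * exp r) + 2 / \<delta>\<^sup>2 * exp (7 * \<rho> + 3 * \<rho> * ln (\<rho> + 1))"
  defines "B \<equiv> 32 / \<delta> * (\<rho>\<^sup>2 + \<rho>) / real q"
  shows "\<bar>Polynomial.coeff (T n) (Suc l) / real q ^ n
           - cycle_prob n (Suc l) * exp (infsum (log_term r) (\<P> \<times> {2..}))\<bar>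
         \<le> K * (pmf (poisson_pmf (ln (real n))) l * (real (Suc l) / L\<^sup>2)) * (B * exp B)"
proof -
  have L0: "L > 0" using n by (simp add: L_def)
  have r0: "r \<ge> 0" using L0 by (simp add: r)
  have q2: "real q \<ge> 2" using q_ge_2 by simp
  have rq': "r < real q"
  proof -
    have "real q * (1 - \<delta>) < real q * 1" using q2 \<delta> by (intro mult_strict_left_mono) auto
    thus ?thesis using rq by simp
  qed
  have \<rho>0: "\<rho> \<ge> 0" using r0 \<delta> by (simp add: \<rho>_def)
  \<comment> \<open>Since \<open>q \<ge> 2\<close>, half of the gap \<open>q \<delta>\<close>
    absorbs the step from \<open>r\<close> to \<open>r + \<delta>\<close>; half of what remains pays
    for \<open>u\<close>, as
    \<open>(1 - \<delta>/2) (1 + \<delta>/4) \<le> 1 - \<delta>/4\<close>.\<close>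
  have \<rho>u: "\<rho> * u \<le> real q * (1 - \<delta> / 4)"
  proof -
    have "2 * (\<delta> / 2) \<le> real q * (\<delta> / 2)" using q2 \<delta> by (intro mult_right_mono) auto
    hence "\<rho> \<le> real q * (1 - \<delta>) + real q * (\<delta> / 2)" using rq unfolding \<rho>_def by linarith
    also have "\<dots> = real q * (1 - \<delta> / 2)" by (simp add: algebra_simps)
    finally have "\<rho> * u \<le> real q * (1 - \<delta> / 2) * u" using \<delta> by (intro mult_right_mono) (auto simp: u)
    also have "\<dots> = real q * ((1 - \<delta> / 2) * u)" by simp
    also have "\<dots> \<le> real q * (1 - \<delta> / 4)"
    proof (rule mult_left_mono)
      have "(1 - \<delta> / 2) * u = 1 - \<delta> / 4 - \<delta> * \<delta> / 8" by (simp add: u algebra_simps)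
      thus "(1 - \<delta> / 2) * u \<le> 1 - \<delta> / 4" using \<delta> by simp
    qed (use q2 in auto)
    finally show ?thesis .
  qed
  define a where "a = (\<lambda>m i. Polynomial.coeff (fps_nth euler_fps m) i)"
  define Kp where "Kp = K * (pmf (poisson_pmf (ln (real n))) l * (real (Suc l) / L\<^sup>2))"
  define \<Delta> where "\<Delta> = (\<lambda>m i. (if m \<le> n then shifted_prob l (n - m) i else 0) - r ^ i * cycle_prob n (Suc l))"
  have \<Delta>: "\<bar>\<Delta> m i\<bar> \<le> Kp * (\<rho> ^ i * u ^ m)" for m i
    using shifted_prob_main[OF n L_def r \<delta>(1) less_imp_le[OF \<delta>(2)] Cu, of m i] \<delta>
    unfolding \<Delta>_def Kp_def K_def \<rho>_def poisson_eq[OF n L_def r \<delta>(1) less_imp_le[OF \<delta>(2)]]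
    by (simp add: u)
  have Kp0: "Kp \<ge> 0"
  proof -
    have "0 \<le> \<bar>\<Delta> 0 0\<bar>" by simp
    also have "\<dots> \<le> Kp" using \<Delta>[of 0 0] by simp
    finally show ?thesis .
  qed
  \<comment> \<open>\<open>M \<ge> n\<close> makes the convolution for degree \<open>n\<close>
    complete, and the bound is free of \<open>M\<close>, as the final limit requires.\<close>
  have bound: "\<bar>Polynomial.coeff (T n) (Suc l) / real q ^ n
           - cycle_prob n (Suc l) * (\<Sum>m\<le>M. poly (fps_nth euler_fps m) r)\<bar> \<le> Kp * (B * exp B)"
    if M: "M \<ge> n" for M
  proof -
    \<comment> \<open>Large enough for both expansions: it covers all shifts
      \<open>i \<le> k\<close> and the degree of every coefficient polynomial up to
      \<open>M\<close>.\<close>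
    define J where "J = Max (insert (Suc l) ((\<lambda>m. Polynomial.degree (fps_nth euler_fps m)) ` {..M}))"
    have J1: "Suc l \<le> J" unfolding J_def by (intro Max_ge) auto
    have J2: "Polynomial.degree (fps_nth euler_fps m) \<le> J" if "m \<le> M" for m
      unfolding J_def using that by (intro Max_ge) auto
    have "Polynomial.coeff (T n) (Suc l) / real q ^ n =
        (\<Sum>m\<le>n. \<Sum>i\<le>Suc l. a m i * shifted_prob l (n - m) i)"
      unfolding coeff_T a_def by (intro sum.cong refl) (auto simp: shifted_prob_def[OF n L_def r \<delta>(1) less_imp_le[OF \<delta>(2)]])
    also have "\<dots> = (\<Sum>m\<le>n. \<Sum>i\<le>J. a m i * shifted_prob l (n - m) i)"
      using J1 by (intro sum.cong refl sum.mono_neutral_left)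
        (auto simp: shifted_prob_def[OF n L_def r \<delta>(1) less_imp_le[OF \<delta>(2)]])
    also have "\<dots> = (\<Sum>m\<le>M. \<Sum>i\<le>J. a m i * (if m \<le> n then shifted_prob l (n - m) i else 0))"
      using M by (intro sum.mono_neutral_cong_left) auto
    finally have 1: "Polynomial.coeff (T n) (Suc l) / real q ^ n = \<dots>" .
    have 2: "cycle_prob n (Suc l) * (\<Sum>m\<le>M. poly (fps_nth euler_fps m) r) =
        (\<Sum>m\<le>M. \<Sum>i\<le>J. a m i * (r ^ i * cycle_prob n (Suc l)))"
      unfolding sum_distrib_left
    proof (intro sum.cong refl)
      fix m assume "m \<in> {..M}"
      hence "poly (fps_nth euler_fps m) r = (\<Sum>i\<le>J. a m i * r ^ i)"
        unfolding a_def by (intro poly_eq_sum_coeff J2) auto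
      thus "cycle_prob n (Suc l) * poly (fps_nth euler_fps m) r = (\<Sum>i\<le>J. a m i * (r ^ i * cycle_prob n (Suc l)))"
        by (simp add: sum_distrib_left mult_ac)
    qed
    have "Polynomial.coeff (T n) (Suc l) / real q ^ n
           - cycle_prob n (Suc l) * (\<Sum>m\<le>M. poly (fps_nth euler_fps m) r) = (\<Sum>m\<le>M. \<Sum>i\<le>J. a m i * \<Delta> m i)"
      unfolding 1 2 \<Delta>_def by (simp only: right_diff_distrib sum_subtractf)
    \<comment> \<open>The term \<open>m = 0\<close> drops out: the constant coefficient of
      \<open>H\<close> is \<open>1\<close>, so only \<open>i = 0\<close> occurs, and there the
      difference is zero.\<close>
    also have "\<dots> = (\<Sum>m\<in>{1..M}. \<Sum>i\<le>J. a m i * \<Delta> m i)"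
    proof (intro sum.mono_neutral_right ballI)
      fix m assume "m \<in> {..M} - {1..M}"
      hence "m = 0" by auto
      moreover have "a 0 i * \<Delta> 0 i = 0" for i
        by (cases i) (auto simp: a_def \<Delta>_def euler_fps_def poly_fps_exp_nth_0
              shifted_prob_def[OF n L_def r \<delta>(1) less_imp_le[OF \<delta>(2)]])
      ultimately show "(\<Sum>i\<le>J. a m i * \<Delta> m i) = 0" by (simp only: sum.neutral_const)
    qed auto
    also have "\<bar>\<dots>\<bar> \<le> (\<Sum>m\<in>{1..M}. \<Sum>i\<le>J. \<bar>a m i\<bar> * (Kp * (\<rho> ^ i * u ^ m)))"
      by (intro order_trans[OF sum_abs] sum_mono) (auto simp: abs_mult intro!: mult_left_mono \<Delta>)
    also have "\<dots> = Kp * (\<Sum>m\<in>{1..M}. poly_norm1 \<rho> J (fps_nth euler_fps m) * u ^ m)"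
      by (simp add: poly_norm1_altdef a_def sum_distrib_left sum_distrib_right mult_ac)
    also have "\<dots> \<le> Kp * ((8 / (\<delta> / 4) * (\<rho>\<^sup>2 + \<rho>) / real q) * exp (8 / (\<delta> / 4) * (\<rho>\<^sup>2 + \<rho>) / real q))"
      using Kp0 \<rho>0 \<delta> \<rho>u by (intro mult_left_mono euler_fps_norm_le) (auto simp: u)
    also have "8 / (\<delta> / 4) * (\<rho>\<^sup>2 + \<rho>) / real q = B" by (simp add: B_def)
    finally show ?thesis .
  qed
  have "(\<lambda>M. \<Sum>m\<le>M. poly (fps_nth euler_fps m) r) \<longlonglongrightarrow> exp (infsum (log_term r) (\<P> \<times> {2..}))"
    using euler_fps_sums[OF r0 rq'] by (simp add: sums_def_le)
  hence "(\<lambda>M. \<bar>Polynomial.coeff (T n) (Suc l) / real q ^ n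
           - cycle_prob n (Suc l) * (\<Sum>m\<le>M. poly (fps_nth euler_fps m) r)\<bar>) \<longlonglongrightarrow>
         \<bar>Polynomial.coeff (T n) (Suc l) / real q ^ n
           - cycle_prob n (Suc l) * exp (infsum (log_term r) (\<P> \<times> {2..}))\<bar>"
    by (intro tendsto_intros)
  thus ?thesis unfolding Kp_def[symmetric]
    by (rule LIMSEQ_le_const2) (use bound in blast)
qed

end

section \<open>Bounds for the constants\<close>

lemma square_le_geometric:
  fixes t :: real
  assumes "t > 0"
  shows "(real m)\<^sup>2 \<le> (2 / t\<^sup>2 + 1 / t) * (1 + t) ^ m"
proof -
  have 1: "real m * t \<le> (1 + t) ^ m" using Bernoulli_inequality[of t m] assms by simp
  have 2: "real (m choose 2) * t\<^sup>2 \<le> (1 + t) ^ m"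
  proof (cases "m \<ge> 2")
    case True thus ?thesis using binomial_term_le[of 1 t m] assms by simp
  next
    case False thus ?thesis using assms by (simp add: binomial_eq_0)
  qed
  \<comment> \<open>Splits \<open>m^2\<close> into binomial coefficients, each controlled by a term
    of the expansion of \<open>(1 + t)^m\<close>.\<close>
  have "real m * real m = 2 * real (m choose 2) + real m"
    by (induction m) (auto simp: numeral_2_eq_2 algebra_simps)
  also have "\<dots> = 2 / t\<^sup>2 * (real (m choose 2) * t\<^sup>2) + 1 / t * (real m * t)" using assms by simp
  also have "\<dots> \<le> 2 / t\<^sup>2 * (1 + t) ^ m + 1 / t * (1 + t) ^ m"
    using 1 2 assms by (intro add_mono mult_left_mono) auto
  finally show ?thesis by (simp add: power2_eq_square distrib_right)
qed

text \<open>All growth is measured by \<open>Y = 1 + r ln (r + 1)\<close>, because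
  \<open>exp (c Y)\<close> equals \<open>exp c\<close> times \<open>(r + 1)^(c r)\<close>.
  \<open>B\<close> is estimated twice: as a factor it keeps its \<open>1 / q\<close>, while in the
  exponent one power of \<open>\<rho> \<le> q\<close> cancels \<open>q\<close>. What is left is
  linear in \<open>\<rho>\<close>; a quadratic exponent would exceed the admissible
  \<open>(r + 1)^(C r)\<close>.\<close>

lemma error_constant_bound:
  fixes \<delta> Cu r q :: real
  assumes \<delta>: "0 < \<delta>" "\<delta> < 1" and Cu: "Cu \<ge> 0" and r: "r \<ge> 0" and q: "q > 0" and \<rho>q: "r + \<delta> \<le> q"
  defines "\<rho> \<equiv> r + \<delta>"
  defines "K \<equiv> 8 * Cu / \<delta> * ((1 + r) * exp r) + 2 / \<delta>\<^sup>2 * exp (7 * \<rho> + 3 * \<rho> * ln (\<rho> + 1))"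
  defines "B \<equiv> 32 / \<delta> * (\<rho>\<^sup>2 + \<rho>) / q"
  defines "C1 \<equiv> (8 * Cu / \<delta> + 2 / \<delta>\<^sup>2) * (64 / \<delta>)" and "C2 \<equiv> 43 + 128 / \<delta>"
  shows "K * (B * exp B) \<le> (C1 * exp C2 + C2) * (r + 1) powr ((C1 * exp C2 + C2) * r) / q"
proof -
  define w where "w = ln (r + 1)"
  define Y where "Y = 1 + r * w"
  have w: "0 \<le> w" "w \<le> r" using r ln_add_one_self_le_self[of r] by (auto simp: w_def add.commute)
  have rw: "0 \<le> r * w" using r w by simp
  \<comment> \<open>For \<open>r \<ge> 2\<close> the logarithm is at least \<open>1\<close>, because
    \<open>exp 1 \<le> 3\<close>; below \<open>2\<close> the summand \<open>1\<close> of
    \<open>Y\<close> suffices.\<close>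
  have rY: "r \<le> 2 * Y"
  proof (cases "r \<ge> 2")
    case True
    have "1 \<le> w"
    proof -
      have "exp 1 \<le> r + 1" using True exp_le by linarith
      thus ?thesis using r by (simp add: w_def ln_ge_iff)
    qed
    hence "r * 1 \<le> r * w" using r by (intro mult_left_mono) auto
    thus ?thesis using rw by (simp add: Y_def)
  next
    case False thus ?thesis using rw by (simp add: Y_def)
  qed
  have Y1: "Y \<ge> 1" using rw by (simp add: Y_def)
  have \<rho>: "0 < \<rho>" "\<rho> \<le> r + 1" "\<rho> \<le> q" using r \<delta> \<rho>q by (auto simp: \<rho>_def)
  have exp_w: "exp w = 1 + r" using r by (simp add: w_def add.commute)
  have ln\<rho>: "ln (\<rho> + 1) \<le> 1 + w"
  proof -
    have "\<rho> + 1 \<le> exp 1 * (r + 1)"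
    proof -
      have "\<rho> + 1 \<le> 2 * (r + 1)" using \<rho> r by simp
      also have "\<dots> \<le> exp 1 * (r + 1)" using r exp_ge_add_one_self[of "1 :: real"] by (intro mult_right_mono) auto
      finally show ?thesis .
    qed
    also have "\<dots> = exp (1 + w)" using exp_w by (simp add: exp_add add.commute)
    finally have "ln (\<rho> + 1) \<le> ln (exp (1 + w))" using \<rho> by (subst ln_le_cancel_iff) auto
    thus ?thesis by simp
  qed
  have K1: "(1 + r) * exp r \<le> exp (39 * Y)"
  proof -
    have "(1 + r) * exp r = exp (w + r)" by (simp add: exp_add exp_w)
    also have "\<dots> \<le> exp (39 * Y)" using w rY Y1 by (subst exp_le_cancel_iff) linarith
    finally show ?thesis .
  qed
  have "7 * \<rho> + 3 * \<rho> * ln (\<rho> + 1) \<le> 7 * (r + 1) + 3 * (r + 1) * (1 + w)"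
    using \<rho> ln\<rho> r w by (intro add_mono mult_mono) auto
  also have "\<dots> = 10 * r + 10 + 3 * (r * w) + 3 * w" by (simp add: algebra_simps)
  \<comment> \<open>\<open>10 r \<le> 20 Y\<close>, \<open>10 \<le> 10 Y\<close>,
    \<open>3 r w \<le> 3 Y\<close> and \<open>3 w \<le> 3 r \<le> 6 Y\<close> add up to
    \<open>39 Y\<close>.\<close>
  also have "\<dots> \<le> 39 * Y" proof -
    have "r * w \<le> Y" by (simp add: Y_def)
    thus ?thesis using rY Y1 w by linarith
  qed
  finally have K2: "exp (7 * \<rho> + 3 * \<rho> * ln (\<rho> + 1)) \<le> exp (39 * Y)" by simp
  have "K \<le> 8 * Cu / \<delta> * exp (39 * Y) + 2 / \<delta>\<^sup>2 * exp (39 * Y)"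
    unfolding K_def using K1 K2 Cu \<delta> by (intro add_mono mult_left_mono) auto
  hence K: "K \<le> (8 * Cu / \<delta> + 2 / \<delta>\<^sup>2) * exp (39 * Y)" by (simp add: distrib_right)
  have B0: "B \<ge> 0" using \<rho> \<delta> q by (simp add: B_def)
  have B1: "B \<le> 128 / \<delta> * Y"
  proof -
    have "\<rho>\<^sup>2 + \<rho> \<le> (\<rho> + 1) * q"
    proof -
      have "(\<rho> + 1) * \<rho> \<le> (\<rho> + 1) * q" using \<rho> by (intro mult_left_mono) auto
      thus ?thesis by (simp add: power2_eq_square algebra_simps)
    qed
    hence "(\<rho>\<^sup>2 + \<rho>) / q \<le> \<rho> + 1" using q by (simp add: divide_le_eq)
    also have "\<dots> \<le> 4 * Y" using \<rho> rY Y1 by linarith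
    finally have "32 / \<delta> * ((\<rho>\<^sup>2 + \<rho>) / q) \<le> 32 / \<delta> * (4 * Y)" using \<delta> by (intro mult_left_mono) auto
    thus ?thesis by (simp add: B_def)
  qed
  have B2: "B \<le> 64 / \<delta> * exp (4 * Y) / q"
  proof -
    have "\<rho>\<^sup>2 + \<rho> \<le> 2 * (r + 1)\<^sup>2"
    proof -
      have "\<rho>\<^sup>2 \<le> (r + 1)\<^sup>2" using \<rho> by (intro power_mono) auto
      moreover have "\<rho> \<le> (r + 1)\<^sup>2" using \<rho> r self_le_power[of "r + 1" 2] by simp
      ultimately show ?thesis by simp
    qed
    also have "(r + 1)\<^sup>2 = exp (2 * w)" using exp_w by (simp add: exp_double add.commute)
    also have "\<dots> \<le> exp (4 * Y)" using w rY by simp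
    finally have "32 / \<delta> * (\<rho>\<^sup>2 + \<rho>) / q \<le> 32 / \<delta> * (2 * exp (4 * Y)) / q"
      using \<delta> q by (intro divide_right_mono mult_left_mono) auto
    thus ?thesis by (simp add: B_def)
  qed
  have BB: "B * exp B \<le> (64 / \<delta> * exp (4 * Y) / q) * exp (128 / \<delta> * Y)"
    using B0 B1 B2 \<delta> q by (intro mult_mono) auto
  have "K * (B * exp B) \<le> ((8 * Cu / \<delta> + 2 / \<delta>\<^sup>2) * exp (39 * Y)) * ((64 / \<delta> * exp (4 * Y) / q) * exp (128 / \<delta> * Y))"
    by (rule mult_mono[OF K BB]) (use B0 Cu \<delta> in auto)
  \<comment> \<open>\<open>43 = 39 + 4\<close> collects the exponents of the bounds \<open>K\<close>
    and \<open>B2\<close>; \<open>128 / \<delta>\<close> is that of \<open>exp B\<close>.\<close>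
  also have "\<dots> = C1 * exp (C2 * Y) / q"
    by (simp add: C1_def C2_def distrib_right exp_add flip: exp_add)
  also have "exp (C2 * Y) = exp C2 * (r + 1) powr (C2 * r)"
    using r by (simp add: Y_def w_def powr_def distrib_left exp_add mult_ac)
  \<comment> \<open>Factor and exponent have to share one constant, hence the sum
    \<open>C1 exp C2 + C2\<close>.\<close>
  also have "C1 * (exp C2 * (r + 1) powr (C2 * r)) / q \<le> (C1 * exp C2 + C2) * (r + 1) powr ((C1 * exp C2 + C2) * r) / q"
  proof (rule divide_right_mono)
    have C: "C1 \<ge> 0" "C2 \<ge> 0" using Cu \<delta> by (auto simp: C1_def C2_def)
    have "(C1 * exp C2) * (r + 1) powr (C2 * r) \<le> (C1 * exp C2 + C2) * (r + 1) powr ((C1 * exp C2 + C2) * r)"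
      using C r by (intro mult_mono powr_mono mult_right_mono) auto
    thus "C1 * (exp C2 * (r + 1) powr (C2 * r)) \<le> (C1 * exp C2 + C2) * (r + 1) powr ((C1 * exp C2 + C2) * r)"
      by (simp add: mult.assoc)
  qed (use q in auto)
  finally show ?thesis .
qed

subsection \<open>Factorization of monic polynomials over a finite field\<close>

lemma GREATEST_le_iff:
  fixes R :: "nat \<Rightarrow> bool"
  assumes "R 0" "\<And>m. R (Suc m) \<Longrightarrow> R m" "\<And>m. R m \<Longrightarrow> m \<le> N"
  shows "R m \<longleftrightarrow> m \<le> (GREATEST m. R m)"
proof
  assume "R m" thus "m \<le> (GREATEST m. R m)" using assms(3) by (intro Greatest_le_nat) auto
next
  assume m: "m \<le> (GREATEST m. R m)"
  have "R (GREATEST m. R m)" using assms(1,3) by (rule GreatestI_nat)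
  with m show "R m" by (induction rule: inc_induct) (use assms(2) in auto)
qed

locale finite_field_polys = field F for F (structure) +
  assumes finite_carrier: "finite (carrier F)"
begin

abbreviation "PR \<equiv> poly_ring F"
abbreviation "q \<equiv> card (carrier F)"
abbreviation "pdeg \<equiv> \<lambda>p :: 'a list. length p - 1"

interpretation UP: principal_domain "poly_ring F"
  using univ_poly_is_principal[OF carrier_is_subfield] .

lemma poly_carrier: "p \<in> carrier PR \<longleftrightarrow> polynomial (carrier F) p"
  by (simp add: univ_poly_carrier)

lemma monic_carrier: "f \<in> monic_polys F \<Longrightarrow> f \<in> carrier PR"
  by (simp add: monic_polys_def)

lemma monic_nonzero: "f \<in> monic_polys F \<Longrightarrow> f \<noteq> []"
  by (simp add: monic_polys_def)

lemma one_monic: "\<one>\<^bsub>PR\<^esub> \<in> monic_polys F"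
  using UP.one_closed by (simp add: monic_polys_def univ_poly_one)

lemma hd_mult:
  assumes "f \<in> carrier PR" "g \<in> carrier PR" "f \<noteq> []" "g \<noteq> []"
  shows "hd (f \<otimes>\<^bsub>PR\<^esub> g) = hd f \<otimes> hd g"
  using poly_mult_lead_coeff[OF carrier_is_subring] assms by (simp add: poly_carrier univ_poly_mult)

lemma mult_nonzero:
  assumes "f \<in> carrier PR" "g \<in> carrier PR"
  shows "f \<otimes>\<^bsub>PR\<^esub> g = [] \<longleftrightarrow> f = [] \<or> g = []"
  using UP.integral_iff[OF assms] by (simp add: univ_poly_zero)

lemma deg_mult:
  assumes "f \<in> carrier PR" "g \<in> carrier PR" "f \<noteq> []" "g \<noteq> []"
  shows "pdeg (f \<otimes>\<^bsub>PR\<^esub> g) = pdeg f + pdeg g"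
  using poly_mult_degree_eq[OF carrier_is_subring, of f g] assms by (simp add: poly_carrier univ_poly_mult)

lemma hd_in_carrier: "p \<in> carrier PR \<Longrightarrow> p \<noteq> [] \<Longrightarrow> hd p \<in> carrier F - {\<zero>}"
  by (cases p) (auto simp: poly_carrier polynomial_def)

lemma monic_mult:
  assumes "f \<in> monic_polys F" "g \<in> monic_polys F"
  shows "f \<otimes>\<^bsub>PR\<^esub> g \<in> monic_polys F"
  using assms by (simp add: monic_polys_def hd_mult mult_nonzero)

lemma monic_pow: "f \<in> monic_polys F \<Longrightarrow> f [^]\<^bsub>PR\<^esub> (m :: nat) \<in> monic_polys F"
  by (induction m) (simp_all add: one_monic monic_mult)

lemma deg_pow: "f \<in> monic_polys F \<Longrightarrow> pdeg (f [^]\<^bsub>PR\<^esub> (m :: nat)) = m * pdeg f"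
  using polynomial_pow_degree[of f m] monic_carrier by simp

lemma monic_cofactor:
  assumes "f \<in> monic_polys F" "h \<in> carrier PR" "f \<otimes>\<^bsub>PR\<^esub> h \<in> monic_polys F"
  shows "h \<in> monic_polys F"
proof -
  have h: "h \<noteq> []" using assms mult_nonzero by (auto simp: monic_polys_def)
  have "hd h \<in> carrier F" using hd_in_carrier[OF assms(2) h] by simp
  moreover have "hd f \<otimes> hd h = \<one>" using hd_mult[of f h] assms h by (simp add: monic_polys_def)
  ultimately show ?thesis using assms h by (simp add: monic_polys_def)
qed

lemma pdividesE:
  assumes "f pdivides g" "f \<in> monic_polys F" "g \<in> monic_polys F"
  obtains h where "h \<in> monic_polys F" "g = f \<otimes>\<^bsub>PR\<^esub> h"
  using assms monic_cofactor unfolding pdivides_def factor_def by metis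

lemma pdividesI:
  assumes "h \<in> carrier PR"
  shows "f pdivides (f \<otimes>\<^bsub>PR\<^esub> h)"
  using assms unfolding pdivides_def factor_def by blast

lemma monic_deg_0: "f \<in> monic_polys F \<Longrightarrow> pdeg f = 0 \<Longrightarrow> f = \<one>\<^bsub>PR\<^esub>"
  by (cases f) (auto simp: monic_polys_def univ_poly_one)

lemma irred_monic: "P \<in> monic_irreds F \<Longrightarrow> P \<in> monic_polys F"
  by (simp add: monic_irreds_def)

lemma irred_deg_pos: "P \<in> monic_irreds F \<Longrightarrow> pdeg P \<ge> 1"
  using pirreducible_degree[OF carrier_is_subfield, of P] by (simp add: monic_irreds_def monic_polys_def)

lemma deg_0_unit:
  assumes "p \<in> carrier PR" "p \<noteq> []" "p \<notin> Units PR"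
  shows "pdeg p \<ge> 1"
  using univ_poly_units'[OF carrier_is_subfield, of p] assms by (simp add: Suc_leI)

text \<open>A monic divisor of least positive degree is irreducible, for a proper factor of it, made
  monic, would have smaller degree.\<close>

lemma exists_irred_divisor:
  assumes f: "f \<in> monic_polys F" "pdeg f \<ge> 1"
  shows "\<exists>P\<in>monic_irreds F. P pdivides f"
proof -
  define D where "D = {d \<in> monic_polys F. pdeg d \<ge> 1 \<and> d pdivides f}"
  have "f pdivides f" using pdividesI[OF UP.one_closed, of f] f monic_carrier by simp
  hence "f \<in> D" using f by (simp add: D_def)
  then obtain d where d: "d \<in> D" and min: "\<And>e. e \<in> D \<Longrightarrow> pdeg d \<le> pdeg e"
    using ex_has_least_nat[of "\<lambda>d. d \<in> D" f pdeg] by blast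
  have dm: "d \<in> monic_polys F" "pdeg d \<ge> 1" "d pdivides f" using d by (auto simp: D_def)
  have "pirreducible (carrier F) d"
  proof (rule pirreducibleI[OF carrier_is_subring])
    show "d \<in> carrier PR" "d \<noteq> []" using dm by (auto simp: monic_polys_def)
    show "d \<notin> Units PR" using univ_poly_units'[OF carrier_is_subfield, of d] dm by auto
    fix p r assume pr: "p \<in> carrier PR" "r \<in> carrier PR" "d = p \<otimes>\<^bsub>PR\<^esub> r"
    show "p \<in> Units PR \<or> r \<in> Units PR"
    proof (rule ccontr)
      assume nu: "\<not> (p \<in> Units PR \<or> r \<in> Units PR)"
      have ne: "p \<noteq> []" "r \<noteq> []" using pr mult_nonzero[OF pr(1,2)] monic_nonzero[OF dm(1)] by auto
      have degs: "pdeg p \<ge> 1" "pdeg r \<ge> 1" using nu pr ne deg_0_unit by auto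
      define a b where "a = hd p" and "b = hd r"
      have ab: "a \<in> carrier F - {\<zero>}" "b \<in> carrier F - {\<zero>}" using hd_in_carrier pr ne by (auto simp: a_def b_def)
      have ab1: "a \<otimes> b = \<one>" using hd_mult[OF pr(1,2) ne] dm pr by (simp add: a_def b_def monic_polys_def)
      have Ac: "[a] \<in> carrier PR" "[b] \<in> carrier PR" using ab by (auto simp: poly_carrier polynomial_def)
      have AB: "[b] \<otimes>\<^bsub>PR\<^esub> [a] = \<one>\<^bsub>PR\<^esub>"
      proof -
        have "pdeg ([b] \<otimes>\<^bsub>PR\<^esub> [a]) = 0" using deg_mult[OF Ac(2,1)] by simp
        moreover have "hd ([b] \<otimes>\<^bsub>PR\<^esub> [a]) = \<one>" using hd_mult[OF Ac(2,1)] ab ab1 by (simp add: m_comm)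
        moreover have "[b] \<otimes>\<^bsub>PR\<^esub> [a] \<noteq> []" using mult_nonzero[OF Ac(2,1)] by simp
        ultimately show ?thesis using UP.m_closed[OF Ac(2,1)] by (intro monic_deg_0) (auto simp: monic_polys_def)
      qed
      \<comment> \<open>\<open>hd p\<close> and \<open>hd r\<close> are inverse to each other since
        \<open>d\<close> is monic. Multiplying by \<open>b\<close> therefore makes \<open>p\<close>
        monic, and \<open>[a]\<close> restores the product.\<close>
      define p' where "p' = [b] \<otimes>\<^bsub>PR\<^esub> p"
      have p': "p' \<in> monic_polys F" "pdeg p' = pdeg p"
        using hd_mult[OF Ac(2) pr(1)] deg_mult[OF Ac(2) pr(1)] mult_nonzero[OF Ac(2) pr(1)] ne ab ab1
          UP.m_closed[OF Ac(2) pr(1)]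
        by (auto simp: monic_polys_def p'_def a_def m_comm)
      have "d = p' \<otimes>\<^bsub>PR\<^esub> ([a] \<otimes>\<^bsub>PR\<^esub> r)"
      proof -
        have "p' \<otimes>\<^bsub>PR\<^esub> ([a] \<otimes>\<^bsub>PR\<^esub> r) = ([b] \<otimes>\<^bsub>PR\<^esub> [a]) \<otimes>\<^bsub>PR\<^esub> (p \<otimes>\<^bsub>PR\<^esub> r)"
          unfolding p'_def using Ac pr by (simp add: UP.m_ac)
        thus ?thesis using AB pr by simp
      qed
      moreover obtain h where h: "h \<in> monic_polys F" "f = d \<otimes>\<^bsub>PR\<^esub> h" using pdividesE[OF dm(3,1) f(1)] .
      ultimately have "f = p' \<otimes>\<^bsub>PR\<^esub> (([a] \<otimes>\<^bsub>PR\<^esub> r) \<otimes>\<^bsub>PR\<^esub> h)"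
        using Ac pr p' by (simp add: UP.m_assoc monic_carrier)
      hence "p' pdivides f" using pdividesI[of "([a] \<otimes>\<^bsub>PR\<^esub> r) \<otimes>\<^bsub>PR\<^esub> h" p'] Ac pr h monic_carrier by simp
      hence "p' \<in> D" using p' degs by (simp add: D_def)
      hence "pdeg d \<le> pdeg p" using min p' by force
      moreover have "pdeg d = pdeg p + pdeg r" using deg_mult[OF pr(1,2) ne] pr by simp
      ultimately show False using degs by simp
    qed
  qed
  thus ?thesis using dm by (auto simp: monic_irreds_def)
qed

lemma irred_dvd_irred:
  assumes "P \<in> monic_irreds F" "Q \<in> monic_irreds F" "Q pdivides P"
  shows "Q = P"
proof -
  have c: "P \<in> carrier PR" "Q \<in> carrier PR" using assms irred_monic monic_carrier by auto
  have "Q \<in> Units PR \<or> Q \<sim>\<^bsub>PR\<^esub> P"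
    using divides_pirreducible_condition[of "carrier F" P Q] assms c
    by (auto simp: monic_irreds_def pdivides_def)
  moreover have "Q \<notin> Units PR"
    using irred_deg_pos[OF assms(2)] univ_poly_units'[OF carrier_is_subfield, of Q] by auto
  ultimately obtain k where k: "k \<in> carrier F - {\<zero>}" "Q = [k] \<otimes>\<^bsub>PR\<^esub> P"
    using associated_polynomials_iff[OF carrier_is_subfield c(2,1)] by blast
  have kc: "[k] \<in> carrier PR" using k by (auto simp: poly_carrier polynomial_def)
  have "hd Q = k \<otimes> hd P" unfolding k(2) using kc c assms monic_nonzero[OF irred_monic] by (subst hd_mult) auto
  hence "k = \<one>" using assms k by (simp add: monic_irreds_def monic_polys_def)
  thus ?thesis using k c by (simp flip: univ_poly_one[of F "carrier F"])
qed

section \<open>Multiplicities of irreducible factors\<close>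

abbreviation "v \<equiv> poly_multiplicity F"

text \<open>Divisibility by powers is downward closed and, as \<open>P\<close> has positive degree,
  bounded by \<open>deg f\<close>. This gives the \<open>GREATEST\<close> in
  \<open>poly_multiplicity\<close> its intended value.\<close>

lemma pow_dvd_iff:
  assumes P: "P \<in> monic_irreds F" and f: "f \<in> monic_polys F"
  shows "(P [^]\<^bsub>PR\<^esub> (m :: nat)) pdivides f \<longleftrightarrow> m \<le> v P f"
  unfolding poly_multiplicity_def
proof (rule GREATEST_le_iff)
  have Pm: "P \<in> monic_polys F" using P by (rule irred_monic)
  show "(P [^]\<^bsub>PR\<^esub> (0 :: nat)) pdivides f"
    using pdividesI[of f "\<one>\<^bsub>PR\<^esub>"] f monic_carrier by simp
  show "(P [^]\<^bsub>PR\<^esub> m) pdivides f" if dvd: "(P [^]\<^bsub>PR\<^esub> Suc m) pdivides f" for m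
  proof -
    obtain h where h: "h \<in> monic_polys F" "f = P [^]\<^bsub>PR\<^esub> Suc m \<otimes>\<^bsub>PR\<^esub> h"
      using pdividesE[OF dvd monic_pow[OF Pm] f] .
    hence "f = P [^]\<^bsub>PR\<^esub> m \<otimes>\<^bsub>PR\<^esub> (P \<otimes>\<^bsub>PR\<^esub> h)"
      using Pm monic_carrier by (simp add: UP.m_assoc)
    thus ?thesis using pdividesI[of "P \<otimes>\<^bsub>PR\<^esub> h" "P [^]\<^bsub>PR\<^esub> m"] Pm h monic_carrier by simp
  qed
  show "m \<le> pdeg f" if "(P [^]\<^bsub>PR\<^esub> m) pdivides f" for m
  proof -
    have "pdeg (P [^]\<^bsub>PR\<^esub> m) \<le> pdeg f"
      using pdivides_imp_degree_le[OF carrier_is_subring, of "P [^]\<^bsub>PR\<^esub> m" f] that f Pm monic_pow monic_carrier monic_nonzero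
      by auto
    hence "m * pdeg P \<le> pdeg f" using deg_pow[OF Pm] by simp
    moreover have "m * 1 \<le> m * pdeg P" using irred_deg_pos[OF P] by (intro mult_le_mono) auto
    ultimately show ?thesis by linarith
  qed
qed

text \<open>Equality is tested against every threshold \<open>m\<close>: for \<open>Q\<close>
  different from \<open>P\<close> the prime \<open>Q\<close> does not divide \<open>P\<close>, so
  its powers must divide \<open>g\<close>; for \<open>Q = P\<close> one factor cancels.\<close>

lemma multiplicity_mult_irred:
  assumes P: "P \<in> monic_irreds F" and Q: "Q \<in> monic_irreds F" and g: "g \<in> monic_polys F"
  shows "v Q (P \<otimes>\<^bsub>PR\<^esub> g) = v Q g + (if Q = P then 1 else 0)"
proof -
  have Pm: "P \<in> monic_polys F" and Qm: "Q \<in> monic_polys F" using P Q irred_monic by auto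
  have c: "P \<in> carrier PR" "Q \<in> carrier PR" "g \<in> carrier PR" using Pm Qm g monic_carrier by auto
  have Pg: "P \<otimes>\<^bsub>PR\<^esub> g \<in> monic_polys F" using Pm g by (rule monic_mult)
  have "m \<le> v Q (P \<otimes>\<^bsub>PR\<^esub> g) \<longleftrightarrow> m \<le> v Q g + (if Q = P then 1 else 0)" for m
  proof (cases "Q = P")
    case False
    hence "\<not> Q pdivides P" using irred_dvd_irred P Q by blast
    hence "(Q [^]\<^bsub>PR\<^esub> m) pdivides (P \<otimes>\<^bsub>PR\<^esub> g) \<longleftrightarrow> (Q [^]\<^bsub>PR\<^esub> m) pdivides g"
      using c Q by (intro pirreducible_pow_pdivides_iff[OF carrier_is_subfield]) (auto simp: monic_irreds_def)
    thus ?thesis using False by (simp add: pow_dvd_iff Q g Pg)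
  next
    case True
    show ?thesis
    proof (cases m)
      case (Suc i)
      have "(P [^]\<^bsub>PR\<^esub> Suc i) pdivides (P \<otimes>\<^bsub>PR\<^esub> g) \<longleftrightarrow> (P [^]\<^bsub>PR\<^esub> i) pdivides g"
      proof
        assume "(P [^]\<^bsub>PR\<^esub> Suc i) pdivides (P \<otimes>\<^bsub>PR\<^esub> g)"
        then obtain h where h: "h \<in> monic_polys F" "P \<otimes>\<^bsub>PR\<^esub> g = P [^]\<^bsub>PR\<^esub> Suc i \<otimes>\<^bsub>PR\<^esub> h"
          using pdividesE[OF _ monic_pow[OF Pm] Pg] by metis
        have "P \<otimes>\<^bsub>PR\<^esub> g = P \<otimes>\<^bsub>PR\<^esub> (P [^]\<^bsub>PR\<^esub> i \<otimes>\<^bsub>PR\<^esub> h)"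
          using h c monic_carrier[OF h(1)] by (simp add: UP.m_ac)
        hence "g = P [^]\<^bsub>PR\<^esub> i \<otimes>\<^bsub>PR\<^esub> h"
          using c monic_carrier[OF h(1)] monic_nonzero[OF Pm] UP.m_lcancel[of P g "P [^]\<^bsub>PR\<^esub> i \<otimes>\<^bsub>PR\<^esub> h"]
          by (simp add: univ_poly_zero)
        thus "(P [^]\<^bsub>PR\<^esub> i) pdivides g" using pdividesI monic_carrier[OF h(1)] by simp
      next
        assume "(P [^]\<^bsub>PR\<^esub> i) pdivides g"
        then obtain h where h: "h \<in> monic_polys F" "g = P [^]\<^bsub>PR\<^esub> i \<otimes>\<^bsub>PR\<^esub> h"
          using pdividesE[OF _ monic_pow[OF Pm] g] by metis
        hence "P \<otimes>\<^bsub>PR\<^esub> g = P [^]\<^bsub>PR\<^esub> Suc i \<otimes>\<^bsub>PR\<^esub> h"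
          using c monic_carrier[OF h(1)] by (simp add: UP.m_ac)
        thus "(P [^]\<^bsub>PR\<^esub> Suc i) pdivides (P \<otimes>\<^bsub>PR\<^esub> g)" using pdividesI monic_carrier[OF h(1)] by metis
      qed
      thus ?thesis using True Suc by (simp only: pow_dvd_iff[OF P g] pow_dvd_iff[OF P Pg]) simp
    qed simp
  qed
  thus ?thesis by (meson dual_order.antisym order_refl)
qed

lemma monic_polys_deg_eq:
  "monic_polys_deg F n = (\<lambda>cs. \<one> # cs) ` {cs. set cs \<subseteq> carrier F \<and> length cs = n}"
proof (intro equalityI subsetI)
  fix f assume "f \<in> monic_polys_deg F n"
  thus "f \<in> (\<lambda>cs. \<one> # cs) ` {cs. set cs \<subseteq> carrier F \<and> length cs = n}"
    by (cases f) (auto simp: monic_polys_deg_def monic_polys_def poly_carrier polynomial_def)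
next
  fix f assume "f \<in> (\<lambda>cs. \<one> # cs) ` {cs. set cs \<subseteq> carrier F \<and> length cs = n}"
  thus "f \<in> monic_polys_deg F n"
    by (auto simp: monic_polys_deg_def monic_polys_def poly_carrier polynomial_def)
qed

lemma finite_monic_polys_deg: "finite (monic_polys_deg F n)"
  unfolding monic_polys_deg_eq using finite_lists_length_eq[OF finite_carrier] by simp

lemma card_monic_polys_deg: "card (monic_polys_deg F n) = q ^ n"
  unfolding monic_polys_deg_eq
  by (subst card_image) (auto simp: inj_on_def card_lists_length_eq[OF finite_carrier])

lemma q_ge_2: "q \<ge> 2"
proof -
  have "card {\<zero>, \<one>} \<le> card (carrier F)" using finite_carrier by (intro card_mono) auto
  thus ?thesis by simp
qed

lemma prime_system: "prime_system (monic_irreds F) pdeg q"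
proof
  have sub: "{P \<in> monic_irreds F. pdeg P = d} \<subseteq> monic_polys_deg F d" for d
    by (auto simp: monic_polys_deg_def monic_irreds_def)
  show "finite {P \<in> monic_irreds F. pdeg P = d}" for d
    by (rule finite_subset[OF sub finite_monic_polys_deg])
  show "card {P \<in> monic_irreds F. pdeg P = d} \<le> q ^ d" for d
    using card_mono[OF finite_monic_polys_deg sub] by (simp add: card_monic_polys_deg)
qed (use irred_deg_pos q_ge_2 in auto)

sublocale PS: prime_system "monic_irreds F" pdeg q by (rule prime_system)

definition irreds_le where "irreds_le N = {P \<in> monic_irreds F. pdeg P \<le> N}"

lemma finite_irreds_le: "finite (irreds_le N)"
  unfolding irreds_le_def by (rule PS.finite_dg_le)

lemma multiplicity_pos_imp:
  assumes "P \<in> monic_irreds F" "f \<in> monic_polys F"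
  shows "P pdivides f \<longleftrightarrow> v P f \<ge> 1"
  using pow_dvd_iff[OF assms, of 1] monic_carrier[OF irred_monic[OF assms(1)]] by simp

lemma multiplicity_eq_0:
  assumes "P \<in> monic_irreds F" "f \<in> monic_polys F" "pdeg f < pdeg P"
  shows "v P f = 0"
proof (rule ccontr)
  assume "v P f \<noteq> 0"
  hence "P pdivides f" using multiplicity_pos_imp[OF assms(1,2)] by simp
  hence "pdeg P \<le> pdeg f"
    using pdivides_imp_degree_le[OF carrier_is_subring, of P f] assms irred_monic monic_carrier monic_nonzero by auto
  thus False using assms by simp
qed

text \<open>Replaces the divisors of \<open>f\<close> by a finite range of irreducibles common to
  all \<open>f\<close> of bounded degree.\<close>

lemma Omega_eq:
  assumes f: "f \<in> monic_polys F" "pdeg f \<le> N"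
  shows "Omega F f = (\<Sum>P\<in>irreds_le N. v P f)"
  unfolding Omega_def
proof (intro sum.mono_neutral_left ballI)
  show "finite (irreds_le N)" unfolding irreds_le_def by (rule PS.finite_dg_le)
  show "{P \<in> monic_irreds F. P pdivides f} \<subseteq> irreds_le N"
    using multiplicity_pos_imp[OF _ f(1)] multiplicity_eq_0[OF _ f(1)] f(2)
    by (fastforce simp: irreds_le_def not_le intro: ccontr)
  fix P assume "P \<in> irreds_le N - {P \<in> monic_irreds F. P pdivides f}"
  thus "v P f = 0" using multiplicity_pos_imp[OF _ f(1), of P] by (auto simp: irreds_le_def)
qed

lemma Omega_mult_irred:
  assumes "P \<in> monic_irreds F" "g \<in> monic_polys F"
  shows "Omega F (P \<otimes>\<^bsub>PR\<^esub> g) = Suc (Omega F g)"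
proof -
  define N where "N = pdeg P + pdeg g"
  have m: "P \<in> monic_polys F" using assms irred_monic by auto
  have d: "pdeg (P \<otimes>\<^bsub>PR\<^esub> g) = N"
    using deg_mult[of P g] m assms monic_carrier monic_nonzero by (simp add: N_def)
  have "Omega F (P \<otimes>\<^bsub>PR\<^esub> g) = (\<Sum>Q\<in>irreds_le N. v Q (P \<otimes>\<^bsub>PR\<^esub> g))"
    using monic_mult[OF m assms(2)] d by (intro Omega_eq) auto
  also have "\<dots> = (\<Sum>Q\<in>irreds_le N. v Q g + (if Q = P then 1 else 0))"
    using assms by (intro sum.cong refl multiplicity_mult_irred) (auto simp: irreds_le_def)
  also have "\<dots> = Omega F g + (\<Sum>Q\<in>irreds_le N. if Q = P then 1 else 0)"
    using Omega_eq[of g N] assms by (simp add: sum.distrib N_def)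
  also have "(\<Sum>Q\<in>irreds_le N. if Q = P then 1 else 0) = (1 :: nat)"
    using assms PS.finite_dg_le by (subst sum.delta) (auto simp: irreds_le_def N_def)
  finally show ?thesis by simp
qed

lemma Omega_mult_pow:
  assumes "P \<in> monic_irreds F" "g \<in> monic_polys F"
  shows "Omega F (P [^]\<^bsub>PR\<^esub> (j :: nat) \<otimes>\<^bsub>PR\<^esub> g) = j + Omega F g"
proof (induction j)
  case 0 thus ?case using assms monic_carrier by simp
next
  case (Suc j)
  have m: "P \<in> monic_polys F" using assms irred_monic by auto
  have "P [^]\<^bsub>PR\<^esub> Suc j \<otimes>\<^bsub>PR\<^esub> g = P \<otimes>\<^bsub>PR\<^esub> (P [^]\<^bsub>PR\<^esub> j \<otimes>\<^bsub>PR\<^esub> g)"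
    using m assms monic_carrier by (simp add: UP.m_ac)
  thus ?case using Suc Omega_mult_irred[OF assms(1) monic_mult[OF monic_pow[OF m] assms(2)]] by simp
qed

text \<open>Splitting off an irreducible divisor raises exactly one multiplicity by one.\<close>

lemma deg_eq_sum:
  assumes "f \<in> monic_polys F" "pdeg f \<le> N"
  shows "pdeg f = (\<Sum>P\<in>irreds_le N. pdeg P * v P f)"
  using assms
proof (induction "pdeg f" arbitrary: f rule: less_induct)
  case less
  show ?case
  proof (cases "pdeg f = 0")
    case True
    hence "v P f = 0" if "P \<in> irreds_le N" for P
      using that less.prems irred_deg_pos[of P] by (intro multiplicity_eq_0) (auto simp: irreds_le_def)
    thus ?thesis using True by simp
  next
    case False
    then obtain P where P: "P \<in> monic_irreds F" "P pdivides f" using exists_irred_divisor less.prems by force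
    have m: "P \<in> monic_polys F" using P irred_monic by auto
    obtain g where g: "g \<in> monic_polys F" "f = P \<otimes>\<^bsub>PR\<^esub> g" using pdividesE[OF P(2) m less.prems(1)] .
    have d: "pdeg f = pdeg P + pdeg g"
      unfolding g(2) using m g(1) monic_carrier monic_nonzero by (intro deg_mult) auto
    have dP: "pdeg P \<ge> 1" by (rule irred_deg_pos[OF P(1)])
    have IH: "pdeg g = (\<Sum>Q\<in>irreds_le N. pdeg Q * v Q g)"
      using d dP less.prems g by (intro less.hyps) auto
    have "(\<Sum>Q\<in>irreds_le N. pdeg Q * v Q f) = (\<Sum>Q\<in>irreds_le N. pdeg Q * v Q g + (if Q = P then pdeg P else 0))"
      unfolding g(2) using P g by (intro sum.cong refl) (auto simp: irreds_le_def multiplicity_mult_irred)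
    also have "\<dots> = pdeg g + (\<Sum>Q\<in>irreds_le N. if Q = P then pdeg P else 0)"
      using IH by (simp add: sum.distrib)
    also have "(\<Sum>Q\<in>irreds_le N. if Q = P then pdeg P else 0) = pdeg P"
      using P d less.prems PS.finite_dg_le by (subst sum.delta) (auto simp: irreds_le_def)
    finally show ?thesis using d by simp
  qed
qed

section \<open>The generating polynomial of \<open>Omega\<close>\<close>

definition omega_poly :: "nat \<Rightarrow> real poly" where
  "omega_poly n = (\<Sum>f\<in>monic_polys_deg F n. Polynomial.monom 1 (Omega F f))"

lemma coeff_omega_poly:
  "Polynomial.coeff (omega_poly n) k = real (card {f \<in> monic_polys_deg F n. Omega F f = k})"
proof -
  have "Polynomial.coeff (omega_poly n) k = (\<Sum>f\<in>monic_polys_deg F n. if Omega F f = k then 1 else 0)"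
    by (simp add: omega_poly_def coeff_sum)
  also have "\<dots> = real (card {f \<in> monic_polys_deg F n. Omega F f = k})"
    using finite_monic_polys_deg by (simp add: sum.If_cases Int_def)
  finally show ?thesis .
qed

lemma poly_omega_poly_1: "poly (omega_poly n) 1 = real q ^ n"
  by (simp add: omega_poly_def poly_sum poly_monom card_monic_polys_deg)

text \<open>Multiplication by \<open>P^j\<close> maps the monic polynomials of degree
  \<open>n - j deg P\<close> bijectively onto the multiples of \<open>P^j\<close>, and it raises
  \<open>Omega\<close> by \<open>j\<close>.\<close>

lemma sum_multiples:
  assumes P: "P \<in> monic_irreds F"
  shows "(\<Sum>f\<in>{f \<in> monic_polys_deg F n. (P [^]\<^bsub>PR\<^esub> j) pdivides f}. Polynomial.monom 1 (Omega F f)) =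
    (if j * pdeg P \<le> n then Polynomial.monom 1 j * omega_poly (n - j * pdeg P) else (0 :: real poly))"
proof (cases "j * pdeg P \<le> n")
  case True
  have m: "P \<in> monic_polys F" using P irred_monic by auto
  define B where "B = P [^]\<^bsub>PR\<^esub> j"
  have B: "B \<in> monic_polys F" "pdeg B = j * pdeg P" using m monic_pow[OF m, of j] deg_pow[OF m, of j] unfolding B_def by auto
  have Bc: "B \<in> carrier PR" "B \<noteq> []" using B monic_carrier monic_nonzero by auto
  have "bij_betw (\<lambda>g. B \<otimes>\<^bsub>PR\<^esub> g) (monic_polys_deg F (n - j * pdeg P)) {f \<in> monic_polys_deg F n. B pdivides f}"
  proof (rule bij_betw_imageI)
    show "inj_on (\<lambda>g. B \<otimes>\<^bsub>PR\<^esub> g) (monic_polys_deg F (n - j * pdeg P))"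
    proof (rule inj_onI)
      fix g h assume "g \<in> monic_polys_deg F (n - j * pdeg P)" "h \<in> monic_polys_deg F (n - j * pdeg P)"
        "B \<otimes>\<^bsub>PR\<^esub> g = B \<otimes>\<^bsub>PR\<^esub> h"
      thus "g = h" using UP.m_lcancel[of B g h] Bc by (auto simp: univ_poly_zero monic_polys_deg_def monic_carrier)
    qed
    show "(\<lambda>g. B \<otimes>\<^bsub>PR\<^esub> g) ` monic_polys_deg F (n - j * pdeg P) = {f \<in> monic_polys_deg F n. B pdivides f}"
    proof (intro equalityI subsetI)
      fix f assume "f \<in> (\<lambda>g. B \<otimes>\<^bsub>PR\<^esub> g) ` monic_polys_deg F (n - j * pdeg P)"
      then obtain g where g: "g \<in> monic_polys F" "pdeg g = n - j * pdeg P" "f = B \<otimes>\<^bsub>PR\<^esub> g"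
        by (auto simp: monic_polys_deg_def)
      have "f \<in> monic_polys F" "B pdivides f" using g B monic_mult pdividesI monic_carrier by auto
      moreover have "pdeg f = n"
        using deg_mult[of B g] Bc B g True monic_carrier[OF g(1)] monic_nonzero[OF g(1)] by simp
      ultimately show "f \<in> {f \<in> monic_polys_deg F n. B pdivides f}" by (simp add: monic_polys_deg_def)
    next
      fix f assume "f \<in> {f \<in> monic_polys_deg F n. B pdivides f}"
      hence f: "f \<in> monic_polys F" "pdeg f = n" "B pdivides f" by (auto simp: monic_polys_deg_def)
      obtain g where g: "g \<in> monic_polys F" "f = B \<otimes>\<^bsub>PR\<^esub> g" using pdividesE[OF f(3) B(1) f(1)] .
      have "n = pdeg B + pdeg g"
        using deg_mult[of B g] Bc g f(2) monic_carrier[OF g(1)] monic_nonzero[OF g(1)] by simp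
      thus "f \<in> (\<lambda>g. B \<otimes>\<^bsub>PR\<^esub> g) ` monic_polys_deg F (n - j * pdeg P)"
        using g B by (auto simp: monic_polys_deg_def)
    qed
  qed
  from sum.reindex_bij_betw[OF this, of "\<lambda>f. Polynomial.monom 1 (Omega F f) :: real poly"]
  have "(\<Sum>f\<in>{f \<in> monic_polys_deg F n. B pdivides f}. Polynomial.monom 1 (Omega F f)) =
     (\<Sum>g\<in>monic_polys_deg F (n - j * pdeg P). Polynomial.monom 1 (Omega F (B \<otimes>\<^bsub>PR\<^esub> g)) :: real poly)" by simp
  also have "\<dots> = (\<Sum>g\<in>monic_polys_deg F (n - j * pdeg P). Polynomial.monom 1 j * Polynomial.monom 1 (Omega F g))"
    using P by (intro sum.cong refl) (auto simp: B_def Omega_mult_pow monic_polys_deg_def mult_monom)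
  also have "\<dots> = Polynomial.monom 1 j * omega_poly (n - j * pdeg P)"
    by (simp add: omega_poly_def sum_distrib_left)
  finally show ?thesis using True by (simp add: B_def)
next
  case False
  have m: "P \<in> monic_polys F" using P irred_monic by auto
  have "\<not> (P [^]\<^bsub>PR\<^esub> j) pdivides f" if "f \<in> monic_polys_deg F n" for f
  proof
    assume "(P [^]\<^bsub>PR\<^esub> j) pdivides f"
    hence "pdeg (P [^]\<^bsub>PR\<^esub> j) \<le> pdeg f"
      using pdivides_imp_degree_le[OF carrier_is_subring, of "P [^]\<^bsub>PR\<^esub> j" f] that m monic_pow monic_carrier monic_nonzero
      by (auto simp: monic_polys_deg_def)
    thus False using False that deg_pow[OF m] by (simp add: monic_polys_deg_def)
  qed
  hence "{f \<in> monic_polys_deg F n. (P [^]\<^bsub>PR\<^esub> j) pdivides f} = {}" by auto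
  thus ?thesis using False by (simp only: sum.empty if_False)
qed

text \<open>
  Write \<open>n = deg f\<close> as the sum of \<open>deg P\<close> over all \<open>P\<close> and \<open>j \<ge> 1\<close> with \<open>P\<^sup>j\<close> dividing \<open>f\<close> and exchange the sums.
\<close>

lemma omega_poly_rec:
  "of_nat n * omega_poly n =
     (\<Sum>l\<in>{1..n}. (\<Sum>(P, j)\<in>PS.prime_powers_deg l. of_nat (pdeg P) * Polynomial.monom 1 j) * omega_poly (n - l))"
proof -
  define e where "e = (\<lambda>f. Polynomial.monom 1 (Omega F f) :: real poly)"
  define M where "M = monic_polys_deg F n"
  define A where "A = irreds_le n \<times> {1..n}"
  have finA: "finite A" by (simp add: A_def finite_irreds_le)
  have "of_nat n * omega_poly n = (\<Sum>f\<in>M. of_nat (pdeg f) * e f)"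
    unfolding omega_poly_def sum_distrib_left M_def
    by (intro sum.cong) (auto simp: monic_polys_deg_def e_def)
  also have "\<dots> = (\<Sum>f\<in>M. \<Sum>(P, j)\<in>A. if (P [^]\<^bsub>PR\<^esub> j) pdivides f then of_nat (pdeg P) * e f else 0)"
  proof (intro sum.cong refl)
    fix f assume f: "f \<in> M"
    hence fm: "f \<in> monic_polys F" "pdeg f = n" by (auto simp: M_def monic_polys_deg_def)
    \<comment> \<open>Lets \<open>j\<close> run over \<open>{1..n}\<close> for all \<open>f\<close>
      simultaneously.\<close>
    have vle: "v P f \<le> n" if "P \<in> irreds_le n" for P
    proof -
      have "1 * v P f \<le> pdeg P * v P f"
        using that irred_deg_pos[of P] by (intro mult_le_mono) (auto simp: irreds_le_def)
      also have "\<dots> \<le> (\<Sum>P\<in>irreds_le n. pdeg P * v P f)"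
        using that PS.finite_dg_le by (intro member_le_sum) (auto simp: irreds_le_def)
      also have "\<dots> = n" using deg_eq_sum[of f n] fm by simp
      finally show ?thesis by simp
    qed
    have "of_nat (pdeg f) = (\<Sum>P\<in>irreds_le n. of_nat (pdeg P) * of_nat (v P f) :: real poly)"
    proof -
      have "(of_nat (pdeg f) :: real poly) = of_nat (\<Sum>P\<in>irreds_le n. pdeg P * v P f)"
        using deg_eq_sum[OF fm(1), of n] fm(2) by (intro arg_cong[where f = of_nat]) auto
      also have "\<dots> = (\<Sum>P\<in>irreds_le n. of_nat (pdeg P) * of_nat (v P f))"
        by (simp only: of_nat_sum of_nat_mult)
      finally show ?thesis .
    qed
    also have "\<dots> = (\<Sum>P\<in>irreds_le n. \<Sum>j\<in>{1..n}. if (P [^]\<^bsub>PR\<^esub> j) pdivides f then of_nat (pdeg P) else 0)"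
    proof (intro sum.cong refl)
      fix P assume P: "P \<in> irreds_le n"
      have "{j \<in> {1..n}. (P [^]\<^bsub>PR\<^esub> j) pdivides f} = {1..v P f}"
      proof -
        have "P \<in> monic_irreds F" using P by (simp add: irreds_le_def)
        hence "{j \<in> {1..n}. (P [^]\<^bsub>PR\<^esub> j) pdivides f} = {j \<in> {1..n}. j \<le> v P f}"
          by (simp only: pow_dvd_iff[OF _ fm(1)])
        also have "\<dots> = {1..v P f}" using vle[OF P] by auto
        finally show ?thesis .
      qed
      moreover have "(\<Sum>j\<in>{1..n}. if (P [^]\<^bsub>PR\<^esub> j) pdivides f then of_nat (pdeg P) else 0 :: real poly)
        = (\<Sum>j\<in>{j \<in> {1..n}. (P [^]\<^bsub>PR\<^esub> j) pdivides f}. of_nat (pdeg P))"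
        by (intro sum.mono_neutral_cong_right) auto
      ultimately show "of_nat (pdeg P) * of_nat (v P f) =
        (\<Sum>j\<in>{1..n}. if (P [^]\<^bsub>PR\<^esub> j) pdivides f then of_nat (pdeg P) else 0 :: real poly)"
        by (simp add: mult.commute)
    qed
    also have "\<dots> = (\<Sum>(P, j)\<in>A. if (P [^]\<^bsub>PR\<^esub> j) pdivides f then of_nat (pdeg P) else 0)"
      by (simp add: A_def sum.cartesian_product)
    finally show "of_nat (pdeg f) * e f = (\<Sum>(P, j)\<in>A. if (P [^]\<^bsub>PR\<^esub> j) pdivides f then of_nat (pdeg P) * e f else 0)"
      by (simp only: sum_distrib_right) (auto intro!: sum.cong)
  qed
  also have "\<dots> = (\<Sum>(P, j)\<in>A. \<Sum>f\<in>M. if (P [^]\<^bsub>PR\<^esub> j) pdivides f then of_nat (pdeg P) * e f else 0)"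
    by (subst sum.swap) (simp add: case_prod_unfold)
  also have "\<dots> = (\<Sum>(P, j)\<in>A. if j * pdeg P \<le> n then of_nat (pdeg P) * (Polynomial.monom 1 j * omega_poly (n - j * pdeg P)) else 0)"
  proof (intro sum.cong refl)
    fix x assume x: "x \<in> A"
    obtain P j where [simp]: "x = (P, j)" by (cases x)
    have P: "P \<in> monic_irreds F" using x by (simp add: A_def irreds_le_def)
    have "(\<Sum>f\<in>M. if (P [^]\<^bsub>PR\<^esub> j) pdivides f then of_nat (pdeg P) * e f else 0) =
       (\<Sum>f\<in>{f \<in> M. (P [^]\<^bsub>PR\<^esub> j) pdivides f}. of_nat (pdeg P) * e f)"
      by (intro sum.mono_neutral_cong_right) (auto simp: M_def finite_monic_polys_deg)
    also have "\<dots> = of_nat (pdeg P) * (\<Sum>f\<in>{f \<in> M. (P [^]\<^bsub>PR\<^esub> j) pdivides f}. e f)"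
      by (rule sum_distrib_left[symmetric])
    finally show "(case x of (P, j) \<Rightarrow> \<Sum>f\<in>M. if (P [^]\<^bsub>PR\<^esub> j) pdivides f then of_nat (pdeg P) * e f else 0) =
      (case x of (P, j) \<Rightarrow> if j * pdeg P \<le> n then of_nat (pdeg P) * (Polynomial.monom 1 j * omega_poly (n - j * pdeg P)) else 0)"
      using sum_multiples[OF P, where n = n and j = j] by (simp add: M_def e_def)
  qed
  also have "\<dots> = (\<Sum>x\<in>{x \<in> A. snd x * pdeg (fst x) \<le> n}. of_nat (pdeg (fst x)) * (Polynomial.monom 1 (snd x) * omega_poly (n - snd x * pdeg (fst x))))"
    using finA by (intro sum.mono_neutral_cong_right) (auto split: if_splits)
  also have "\<dots> = (\<Sum>l\<in>{1..n}. \<Sum>x\<in>{x \<in> {x \<in> A. snd x * pdeg (fst x) \<le> n}. snd x * pdeg (fst x) = l}.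
      of_nat (pdeg (fst x)) * (Polynomial.monom 1 (snd x) * omega_poly (n - snd x * pdeg (fst x))))"
  proof (intro sum.group[symmetric])
    show "(\<lambda>x. snd x * pdeg (fst x)) ` {x \<in> A. snd x * pdeg (fst x) \<le> n} \<subseteq> {1..n}"
    proof safe
      fix P j assume a: "(P, j) \<in> A" "snd (P, j) * pdeg (fst (P, j)) \<le> n"
      hence "1 * 1 \<le> j * pdeg P" using irred_deg_pos[of P] by (intro mult_le_mono) (auto simp: A_def irreds_le_def)
      thus "snd (P, j) * pdeg (fst (P, j)) \<in> {1..n}" using a by simp
    qed
  qed (use finA in auto)
  also have "\<dots> = (\<Sum>l\<in>{1..n}. (\<Sum>(P, j)\<in>PS.prime_powers_deg l. of_nat (pdeg P) * Polynomial.monom 1 j) * omega_poly (n - l))"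
  proof (intro sum.cong refl)
    fix l assume l: "l \<in> {1..n}"
    have eq: "{x \<in> {x \<in> A. snd x * pdeg (fst x) \<le> n}. snd x * pdeg (fst x) = l} = PS.prime_powers_deg l"
    proof
      show "PS.prime_powers_deg l \<subseteq> {x \<in> {x \<in> A. snd x * pdeg (fst x) \<le> n}. snd x * pdeg (fst x) = l}"
      proof
        fix x assume x: "x \<in> PS.prime_powers_deg l"
        hence "x \<in> {P \<in> monic_irreds F. pdeg P \<le> l} \<times> {1..l}" using PS.prime_powers_deg_subset by blast
        thus "x \<in> {x \<in> {x \<in> A. snd x * pdeg (fst x) \<le> n}. snd x * pdeg (fst x) = l}"
          using x[unfolded PS.prime_powers_deg_def] l by (cases x) (auto simp: A_def irreds_le_def)
      qed
    qed (unfold PS.prime_powers_deg_def, auto simp: A_def irreds_le_def)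
    show "(\<Sum>x\<in>{x \<in> {x \<in> A. snd x * pdeg (fst x) \<le> n}. snd x * pdeg (fst x) = l}.
        of_nat (pdeg (fst x)) * (Polynomial.monom 1 (snd x) * omega_poly (n - snd x * pdeg (fst x)))) =
      (\<Sum>(P, j)\<in>PS.prime_powers_deg l. of_nat (pdeg P) * Polynomial.monom 1 j) * omega_poly (n - l)"
      unfolding sum_distrib_right
    proof (rule sum.cong[OF eq])
      fix x assume "x \<in> PS.prime_powers_deg l"
      hence "snd x * pdeg (fst x) = l" unfolding PS.prime_powers_deg_def by auto
      thus "of_nat (pdeg (fst x)) * (Polynomial.monom 1 (snd x) * omega_poly (n - snd x * pdeg (fst x))) =
         (case x of (P, j) \<Rightarrow> of_nat (pdeg P) * Polynomial.monom 1 j) * omega_poly (n - l)"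
        by (simp only: case_prod_unfold mult.assoc)
    qed
  qed
  finally show ?thesis .
qed

end

context finite_field_polys
begin

lemma omega_gf: "prime_system_gf (monic_irreds F) pdeg q omega_poly"
proof
  show "omega_poly 0 = 1"
  proof -
    have m: "monic_polys_deg F 0 = {[\<one>]}" by (auto simp: monic_polys_deg_eq)
    have "[\<one>] \<in> monic_polys F" using one_monic by (simp add: univ_poly_one)
    hence "Omega F [\<one>] = (\<Sum>P\<in>irreds_le 0. v P [\<one>])" by (intro Omega_eq) auto
    also have "irreds_le 0 = {}" using irred_deg_pos by (fastforce simp: irreds_le_def)
    finally show ?thesis by (simp add: omega_poly_def m)
  qed
qed (rule poly_omega_poly_1, rule omega_poly_rec)

sublocale PS: prime_system_gf "monic_irreds F" pdeg q omega_poly by (rule omega_gf)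

lemma prob_Omega:
  "measure_pmf.prob (pmf_of_set (monic_polys_deg F n)) {f. Omega F f = k}
     = Polynomial.coeff (omega_poly n) k / real q ^ n"
proof -
  have "monic_polys_deg F n \<noteq> {}" using card_monic_polys_deg[of n] q_ge_2 by auto
  from measure_pmf_of_set[OF this finite_monic_polys_deg, of "{f. Omega F f = k}"]
  show ?thesis by (simp add: coeff_omega_poly card_monic_polys_deg Int_def)
qed

text \<open>\<open>Lim\<close> is a description; the limit exhibited by
  \<open>euler_product_tendsto\<close> pins it down, limits being unique along a nontrivial
  filter.\<close>

lemma h_q_eq:
  assumes "0 \<le> x" "x < real q"
  shows "h_q F x = exp (infsum (PS.log_term x) (monic_irreds F \<times> {2..}))"
proof -
  have "h_q F x = Lim (finite_subsets_at_top (monic_irreds F)) (\<lambda>S. \<Prod>P\<in>S. PS.euler_factor x P)"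
    unfolding h_q_def PS.euler_factor_def poly_norm_def ..
  also have "\<dots> = exp (infsum (PS.log_term x) (monic_irreds F \<times> {2..}))"
    by (rule tendsto_Lim[OF finite_subsets_at_top_neq_bot PS.euler_product_tendsto[OF assms]])
  finally show ?thesis .
qed

end

subsection \<open>Cycles of random permutations\<close>

lemma orbit_eq_iff:
  assumes "permutation f"
  shows "orbit f x = orbit f y \<longleftrightarrow> y \<in> orbit f x"
proof
  assume "orbit f x = orbit f y"
  thus "y \<in> orbit f x" using permutation_self_in_orbit[OF assms, of y] by simp
next
  assume "y \<in> orbit f x"
  thus "orbit f x = orbit f y"
    using orbit_cyclic_eq3[OF cyclic_on_orbit'[OF assms], of y x] by simp
qed

text \<open>The orbits compared below are different sets, since one family involves a new point;
  they agree only in the partition they induce on \<open>A\<close>.\<close>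

lemma card_image_cong_kernel:
  assumes "\<And>x y. x \<in> A \<Longrightarrow> y \<in> A \<Longrightarrow> f x = f y \<longleftrightarrow> g x = g y"
  shows "card (f ` A) = card (g ` A)"
proof -
  define h where "h = (\<lambda>u. g (SOME x. x \<in> A \<and> f x = u))"
  have h: "h (f x) = g x" if "x \<in> A" for x
  proof -
    have "(SOME y. y \<in> A \<and> f y = f x) \<in> A \<and> f (SOME y. y \<in> A \<and> f y = f x) = f x"
      using that by (intro someI[of "\<lambda>y. y \<in> A \<and> f y = f x" x]) auto
    thus ?thesis using assms that by (auto simp: h_def)
  qed
  have "bij_betw h (f ` A) (g ` A)"
  proof (rule bij_betw_imageI)
    show "inj_on h (f ` A)" using assms h by (auto simp: inj_on_def)
    show "h ` f ` A = g ` A" using h by (force simp: image_image)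
  qed
  thus ?thesis by (rule bij_betw_same_card)
qed

lemma num_cycles_insert_fixed:
  assumes "finite A" "a \<notin> A" "p permutes A"
  shows "num_cycles (insert a A) p = Suc (num_cycles A p)"
proof -
  have "p a = a" using assms by (simp add: permutes_def)
  hence "orbit p a = {a}" by (simp add: orbit_eq_singleton_iff)
  moreover have "orbit p a \<notin> orbit p ` A"
    using permutes_orbit_subset[OF assms(3)] assms(2) \<open>orbit p a = {a}\<close> by fastforce
  ultimately show ?thesis using assms(1) by (simp add: num_cycles_def)
qed

text \<open>The composition inserts \<open>a\<close> immediately before \<open>b\<close> in the
  cycle of \<open>b\<close>: the step from \<open>z\<close> to \<open>b\<close> becomes a step from
  \<open>z\<close> to \<open>a\<close> and one from \<open>a\<close> to \<open>b\<close>.\<close>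

lemma num_cycles_insert_transpose:
  assumes A: "finite A" "a \<notin> A" "p permutes A" and b: "b \<in> A"
  shows "num_cycles (insert a A) (Transposition.transpose a b \<circ> p) = num_cycles A p"
proof -
  define s where "s = Transposition.transpose a b \<circ> p"
  have pa: "p a = a" using A by (simp add: permutes_def)
  have pA: "p x \<in> A \<longleftrightarrow> x \<in> A" for x using A(3) by (rule permutes_in_image)
  have sa: "s a = b" by (simp add: s_def pa)
  have sx: "s x = (if p x = b then a else p x)" if "x \<in> A" for x
    using that A pA[of x] by (auto simp: s_def Transposition.transpose_def)
  have "s permutes insert a A"
    unfolding s_def using A b
    by (intro permutes_compose permutes_swap_id) (auto intro: permutes_subset)
  hence perm_s: "permutation s" using A by (auto simp: permutation_permutes)
  have perm_p: "permutation p" using A by (auto simp: permutation_permutes)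
  \<comment> \<open>Each step of \<open>p\<close> inside \<open>A\<close> is one step of
    \<open>s\<close> or, through \<open>a\<close>, two.\<close>
  have 1: "y \<in> orbit s x" if "y \<in> orbit p x" "x \<in> A" for x y
  proof -
    have reach: "p z \<in> orbit s z" if "z \<in> A" for z
    proof (cases "p z = b")
      case True
      hence "a \<in> orbit s z" using sx[OF that] orbit.base[of s z] by simp
      from orbit.step[OF this] show ?thesis using sa True by simp
    next
      case False
      thus ?thesis using sx[OF that] orbit.base[of s z] by simp
    qed
    have "y \<in> orbit s x \<and> y \<in> A" using that(1)
    proof induction
      case base thus ?case using reach that pA by auto
    next
      case (step y)
      hence "p y \<in> orbit s y" using reach by blast
      thus ?case using step pA by (auto intro: orbit_trans)
    qed
    thus ?thesis ..
  qed
  \<comment> \<open>A path of \<open>s\<close> may visit \<open>a\<close>, which lies outside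
    \<open>A\<close>; the invariant then records that the next point \<open>b\<close> is already in
    the orbit of \<open>p\<close>.\<close>
  have 2: "y \<in> orbit p x" if "y \<in> orbit s x" "x \<in> A" "y \<in> A" for x y
  proof -
    have "(y \<in> A \<longrightarrow> y \<in> orbit p x) \<and> (y = a \<longrightarrow> b \<in> orbit p x) \<and> y \<in> insert a A" using that(1)
    proof induction
      case base
      thus ?case using sx[OF that(2)] that(2) pA A b orbit.base[of p x] by auto
    next
      case (step y)
      show ?case
      proof (cases "y = a")
        case True thus ?thesis using step sa b A by auto
      next
        case False
        hence y: "y \<in> A" "y \<in> orbit p x" using step by auto
        have "p y \<in> orbit p x" using y by (auto intro: orbit.step)
        thus ?thesis using sx[OF y(1)] pA y A by auto
      qed
    qed
    thus ?thesis using that by simp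
  qed
  have "orbit s a = orbit s b" using permutation_orbit_step[OF perm_s, of a] sa by simp
  hence "orbit s ` insert a A = orbit s ` A" using b by auto
  moreover have "card (orbit s ` A) = card (orbit p ` A)"
    by (rule card_image_cong_kernel) (use 1 2 in \<open>auto simp: orbit_eq_iff perm_s perm_p\<close>)
  ultimately show ?thesis by (simp add: num_cycles_def s_def)
qed

text \<open>Every permutation of \<open>insert a A\<close> is uniquely \<open>transpose a b\<close>
  after some \<open>p\<close> on \<open>A\<close>. The choice \<open>b = a\<close> adds a fixed
  point and hence a cycle, the other \<open>card A\<close> choices preserve the number: this is the
  Stirling recursion.\<close>

lemma card_permutations_num_cycles:
  assumes "finite A"
  shows "card {p. p permutes A \<and> num_cycles A p = k} = stirling (card A) k"
  using assms
proof (induction A arbitrary: k rule: finite_induct)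
  case empty
  have "{p. p permutes {} \<and> num_cycles {} p = k} = (if k = 0 then {id} else {})"
    by (auto simp: num_cycles_def permutes_empty)
  thus ?case by (cases k) auto
next
  case (insert a A)
  define T where "T = (\<lambda>(b, p :: 'a \<Rightarrow> 'a). Transposition.transpose a b \<circ> p)"
  define X1 where "X1 = {(b, p). b \<in> insert a A \<and> p permutes A}"
  have inj: "inj_on T X1"
  proof (rule inj_onI)
    fix x y assume xy: "x \<in> X1" "y \<in> X1" "T x = T y"
    obtain b p c p' where [simp]: "x = (b, p)" "y = (c, p')" by (cases x, cases y)
    have pp: "p permutes A" "p' permutes A" using xy by (auto simp: X1_def)
    have eq: "Transposition.transpose a b \<circ> p = Transposition.transpose a c \<circ> p'" using xy by (simp add: T_def)
    have "p a = a" "p' a = a" using pp insert by (auto simp: permutes_def)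
    hence "b = c" using fun_cong[OF eq, of a] by simp
    moreover from this have "p = p'" using eq by (metis fun.map_id comp_assoc transpose_comp_involutory id_comp)
    ultimately show "x = y" by simp
  qed
  have img: "{p. p permutes insert a A} = T ` X1"
    unfolding permutes_insert T_def X1_def by auto
  define nc where "nc = (\<lambda>(b, p). num_cycles A p + (if b = a then 1 else 0))"
  have ncT: "num_cycles (insert a A) (T x) = nc x" if "x \<in> X1" for x
    using that insert.hyps
    by (auto simp: X1_def T_def nc_def num_cycles_insert_fixed num_cycles_insert_transpose)
  have fin: "finite {p. p permutes A \<and> num_cycles A p = j}" for j
    by (rule finite_subset[OF _ finite_permutations[OF insert.hyps(1)]]) auto
  have "{p. p permutes insert a A \<and> num_cycles (insert a A) p = k} = T ` {x \<in> X1. nc x = k}"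
    using img ncT by (auto simp: set_eq_iff image_iff) metis+
  also have "card \<dots> = card {x \<in> X1. nc x = k}"
    by (rule card_image) (rule inj_on_subset[OF inj], auto)
  also have "{x \<in> X1. nc x = k} = ({a} \<times> {p. p permutes A \<and> num_cycles A p + 1 = k}) \<union> (A \<times> {p. p permutes A \<and> num_cycles A p = k})"
    using insert.hyps by (auto simp: X1_def nc_def split: if_splits)
  also have "card \<dots> = card {p. p permutes A \<and> num_cycles A p + 1 = k} + card A * stirling (card A) k"
    using insert fin finite_subset[OF _ finite_permutations[OF insert.hyps(1)], of "{p. p permutes A \<and> num_cycles A p + 1 = k}"]
    by (subst card_Un_disjoint) (auto simp: card_cartesian_product)
  also have "\<dots> = stirling (card (insert a A)) k"
  proof (cases k)
    case 0 thus ?thesis using insert.hyps by (cases "card A") auto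
  next
    case (Suc j)
    thus ?thesis using insert by simp
  qed
  finally show ?case .
qed

lemma prob_num_cycles:
  "measure_pmf.prob (pmf_of_set {\<pi>. \<pi> permutes {1..n}}) {\<pi>. num_cycles {1..n} \<pi> = k} = cycle_prob n k"
proof -
  have "{\<pi>. \<pi> permutes {1..n}} \<noteq> {}" "finite {\<pi>. \<pi> permutes {1..n}}"
    using permutes_id[of "{1..n}"] finite_permutations[of "{1..n}"] by blast+
  moreover have "card {\<pi>. \<pi> permutes {1..n}} = fact n" by (rule card_permutations) auto
  ultimately show ?thesis
    using measure_pmf_of_set[of "{\<pi>. \<pi> permutes {1..n}}" "{\<pi>. num_cycles {1..n} \<pi> = k}"]
      card_permutations_num_cycles[of "{1..n}" k]
    by (simp add: Int_def cycle_prob_def)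
qed

subsection \<open>The main theorem\<close>

theorem theorem1p3:
  fixes \<delta> :: real
  assumes "0 < \<delta>" and "\<delta> < 1"
  shows "\<exists>C::real. C > 0 \<and>
    (\<forall>(n::nat) (q::nat) (F::nat ring) (k::nat) (r::real).
       n \<ge> 2 \<longrightarrow> real n \<ge> 4 * (1 - \<delta>) / \<delta>\<^sup>2 \<longrightarrow>
       primepow q \<longrightarrow> real q \<ge> 1 / (1 - \<delta>)\<^sup>2 \<longrightarrow>
       field F \<longrightarrow> finite (carrier F) \<longrightarrow> card (carrier F) = q \<longrightarrow>
       1 \<le> k \<longrightarrow> k \<le> n \<longrightarrow>
       r = (real k - 1) / ln (real n) \<longrightarrow> r \<le> real q * (1 - \<delta>) \<longrightarrow>
       \<bar>measure_pmf.prob (pmf_of_set (monic_polys_deg F n)) {f. Omega F f = k}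
          - measure_pmf.prob (pmf_of_set {\<pi>. \<pi> permutes {1..n}}) {\<pi>. num_cycles {1..n} \<pi> = k}
            * h_q F r\<bar>
         \<le> C * (r + 1) powr (C * r) * pmf (poisson_pmf (ln (real n))) (k - 1)
            * (real k / (real q * (ln (real n))\<^sup>2)))"
proof -
  \<comment> \<open>\<open>\<delta> / 4\<close> is both the excess of \<open>u\<close> over
    \<open>1\<close> and the parameter of \<open>square_le_geometric\<close>; \<open>C\<close> and
    \<open>C2\<close> below are the constants of \<open>error_constant_bound\<close>.\<close>
  define u where "u = 1 + \<delta> / 4"
  define Cu where "Cu = 2 / (\<delta> / 4)\<^sup>2 + 1 / (\<delta> / 4)"
  define C2 where "C2 = 43 + 128 / \<delta>"
  define C where "C = (8 * Cu / \<delta> + 2 / \<delta>\<^sup>2) * (64 / \<delta>) * exp C2 + C2"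
  have Cu: "(real m)\<^sup>2 \<le> Cu * u ^ m" for m
    unfolding Cu_def u_def using assms by (intro square_le_geometric) auto
  have Cu0: "Cu \<ge> 0" using assms by (simp add: Cu_def)
  have C0: "C > 0" unfolding C_def C2_def using assms Cu0
    by (intro add_nonneg_pos[OF _ add_pos_pos] mult_nonneg_nonneg add_nonneg_nonneg divide_nonneg_nonneg) auto
  show ?thesis
  proof (intro exI[of _ C] conjI allI impI)
    fix n q :: nat and F :: "nat ring" and k :: nat and r :: real
    assume n: "n \<ge> 2" and F: "field F" "finite (carrier F)" "card (carrier F) = q"
      and k: "1 \<le> k" "k \<le> n" and r: "r = (real k - 1) / ln (real n)" and rq: "r \<le> real q * (1 - \<delta>)"
    interpret finite_field_polys F
      using F by (simp add: finite_field_polys_def finite_field_polys_axioms_def)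
    define L where "L = ln (real n)"
    obtain l where l: "k = Suc l" using k by (cases k) auto
    have r': "r = real l / L" by (simp add: r l L_def)
    have L0: "L > 0" using n by (simp add: L_def)
    have r0: "r \<ge> 0" using L0 by (simp add: r')
    have q2: "real q \<ge> 2" using q_ge_2 F by simp
    have q\<delta>: "2 * \<delta> \<le> real q * \<delta>" using q2 assms by (intro mult_right_mono) auto
    have r\<delta>q: "r + \<delta> \<le> real q" 
    proof -
      have "real q * (1 - \<delta>) = real q - real q * \<delta>" by (simp add: algebra_simps)
      thus ?thesis using rq q\<delta> assms by linarith
    qed
    hence "r < real q" using assms by simp
    hence hq: "h_q F r = exp (infsum (PS.log_term r) (monic_irreds F \<times> {2..}))"
      using h_q_eq[OF r0] F by simp
    define K where "K = 8 * Cu / \<delta> * ((1 + r) * exp r) + 2 / \<delta>\<^sup>2 * exp (7 * (r + \<delta>) + 3 * (r + \<delta>) * ln (r + \<delta> + 1))"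
    define B where "B = 32 / \<delta> * ((r + \<delta>)\<^sup>2 + (r + \<delta>)) / real q"
    define W where "W = pmf (poisson_pmf (ln (real n))) l * (real k / L\<^sup>2)"
    have "\<bar>measure_pmf.prob (pmf_of_set (monic_polys_deg F n)) {f. Omega F f = k}
          - measure_pmf.prob (pmf_of_set {\<pi>. \<pi> permutes {1..n}}) {\<pi>. num_cycles {1..n} \<pi> = k} * h_q F r\<bar>
        \<le> K * W * (B * exp B)"
      using PS.coeff_T_estimate[OF n L_def r' assms _ u_def Cu] rq F(3)
      unfolding prob_Omega prob_num_cycles hq K_def W_def B_def l by simp
    also have "\<dots> = K * (B * exp B) * W" by simp
    also have "\<dots> \<le> C * (r + 1) powr (C * r) / real q * W"
    proof (rule mult_right_mono)
      show "K * (B * exp B) \<le> C * (r + 1) powr (C * r) / real q"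
        using error_constant_bound[OF assms Cu0 r0 _ r\<delta>q] q2
        unfolding K_def B_def C_def C2_def by simp
    qed (simp add: W_def)
    also have "\<dots> = C * (r + 1) powr (C * r) * pmf (poisson_pmf (ln (real n))) (k - 1)
            * (real k / (real q * (ln (real n))\<^sup>2))"
      by (simp add: W_def l L_def)
    finally show "\<bar>measure_pmf.prob (pmf_of_set (monic_polys_deg F n)) {f. Omega F f = k}
          - measure_pmf.prob (pmf_of_set {\<pi>. \<pi> permutes {1..n}}) {\<pi>. num_cycles {1..n} \<pi> = k}
            * h_q F r\<bar>
         \<le> C * (r + 1) powr (C * r) * pmf (poisson_pmf (ln (real n))) (k - 1)
            * (real k / (real q * (ln (real n))\<^sup>2))" .
  qed (rule C0)
qed

end
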